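(* Let $\lambda>0$, $\beta\in[1,\infty)$ and $\delta\in(0,1/2)$. There exists a non-decreasing function $V\colon[0,\infty)\to[0,\infty)$, which is not identically zero and depends only on $\lambda$, $\beta$ and $\delta$, such that the following holds. Let $f$ be any random field on a complete probability space $(\Omega,\mathcal F,\mathbf P)$ of the form described in the context with these parameters $\lambda,\beta,\delta$, let $F>0$, and let $u\colon\mathbb R\times[0,\infty)\times\Omega\to\mathbb R$ be the solution of $$u_t(x,t,\omega)=u_{xx}(x,t,\omega)-f(x,u(x,t,\omega),\omega)+F,\qquad u(x,0,\omega)=0,\qquad x\in\mathbb R,\ t\ge 0,\ \omega\in\Omega.$$ Put $U(t,\omega):=\int_0^1 u(\xi,t,\omega)\,d\xi$. Then $$\mathbf E\,\frac{U(t)}{t}\ \ge\ V(F)\qquad\text{for all } t>0 .$$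
   Context: Random field: $f_{ij}(\omega)$, $i,j\in\mathbb Z$, are independent and identically distributed non-negative random variables on $(\Omega,\mathcal F,\mathbf P)$ with $\mathbf E\exp\{\lambda f_{00}\}=\beta<\infty$. The function $\phi\in C^1(\mathbb R^2)$ satisfies $0\le\phi\le1$ and $\operatorname{supp}\phi\subset[-\delta,\delta]^2$ with $\delta<1/2$. The field is $$f(x,y,\omega):=\sum_{i,j\in\mathbb Z}f_{ij}(\omega)\,\phi(x-i,\,y-j-1/2).$$ $\mathbf E$ denotes expectation with respect to $\mathbf P$. Solutions are classical solutions, bounded on strips $\mathbb R\times[0,T]$, $T<\infty$ (for each $\omega$). Existence and uniqueness of such a solution is taken as a known standing fact. *)

theory Defs
  imports "HOL-Probability.Probability"
begin

definition C1_plane :: "(real \<times> real \<Rightarrow> real) \<Rightarrow> bool" where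
  "C1_plane \<phi> \<longleftrightarrow>
    (\<exists>\<phi>' :: real \<times> real \<Rightarrow> (real \<times> real) \<Rightarrow>\<^sub>L real.
      (\<forall>z. (\<phi> has_derivative blinfun_apply (\<phi>' z)) (at z)) \<and> continuous_on UNIV \<phi>')"

definition bump :: "real \<Rightarrow> (real \<times> real \<Rightarrow> real) \<Rightarrow> bool" where
  "bump \<delta> \<phi> \<longleftrightarrow>
    C1_plane \<phi> \<and> (\<forall>z. 0 \<le> \<phi> z \<and> \<phi> z \<le> 1) \<and>
    closure {z. \<phi> z \<noteq> 0} \<subseteq> {-\<delta>..\<delta>} \<times> {-\<delta>..\<delta>}"

definition obstacle_strengths ::
    "'w measure \<Rightarrow> real \<Rightarrow> real \<Rightarrow> (int \<Rightarrow> int \<Rightarrow> 'w \<Rightarrow> real) \<Rightarrow> bool" where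
  "obstacle_strengths M lam \<beta> X \<longleftrightarrow>
    prob_space.indep_vars M (\<lambda>_. borel) (\<lambda>(i, j). X i j) UNIV \<and>
    (\<forall>i j. distr M borel (X i j) = distr M borel (X 0 0)) \<and>
    (\<forall>i j. \<forall>\<omega>\<in>space M. 0 \<le> X i j \<omega>) \<and>
    has_bochner_integral M (\<lambda>\<omega>. exp (lam * X 0 0 \<omega>)) \<beta>"

text \<open>If the support of \<open>\<phi>\<close> lies in \<open>[-\<delta>, \<delta>]\<^sup>2\<close> with \<open>\<delta> < 1/2\<close>, at most one
  summand is nonzero at any given point.\<close>

definition obstacle_field ::
    "(int \<Rightarrow> int \<Rightarrow> 'w \<Rightarrow> real) \<Rightarrow> (real \<times> real \<Rightarrow> real) \<Rightarrow> real \<Rightarrow> real \<Rightarrow> 'w \<Rightarrow> real" where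
  "obstacle_field X \<phi> x y \<omega> =
    (\<Sum>\<^sub>\<infinity>(i, j)\<in>UNIV. X i j \<omega> * \<phi> (x - of_int i, y - of_int j - 1/2))"

text \<open>Classical solutions of \<open>u\<^sub>t = u\<^sub>x\<^sub>x - f(x, u) + F\<close> with zero initial datum, bounded on
  strips: the derivatives \<open>u\<^sub>t\<close>, \<open>u\<^sub>x\<close>, \<open>u\<^sub>x\<^sub>x\<close> exist and are jointly continuous for \<open>t > 0\<close>,
  and \<open>u\<close> is continuous up to \<open>t = 0\<close>.\<close>

definition classical_solution ::
    "(real \<Rightarrow> real \<Rightarrow> real) \<Rightarrow> real \<Rightarrow> (real \<Rightarrow> real \<Rightarrow> real) \<Rightarrow> bool" where
  "classical_solution f F u \<longleftrightarrow>
    continuous_on (UNIV \<times> {0..}) (\<lambda>(x, t). u x t) \<and>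
    (\<exists>ut ux uxx.
      continuous_on (UNIV \<times> {0<..}) (\<lambda>(x, t). ut x t) \<and>
      continuous_on (UNIV \<times> {0<..}) (\<lambda>(x, t). ux x t) \<and>
      continuous_on (UNIV \<times> {0<..}) (\<lambda>(x, t). uxx x t) \<and>
      (\<forall>x. \<forall>t>0.
        ((\<lambda>s. u x s) has_real_derivative ut x t) (at t) \<and>
        ((\<lambda>y. u y t) has_real_derivative ux x t) (at x) \<and>
        ((\<lambda>y. ux y t) has_real_derivative uxx x t) (at x) \<and>
        ut x t = uxx x t - f x (u x t) + F)) \<and>
    (\<forall>x. u x 0 = 0) \<and>
    (\<forall>T\<ge>0. bounded ((\<lambda>(x, t). u x t) ` (UNIV \<times> {0..T})))"

definition mean_height :: "(real \<Rightarrow> real \<Rightarrow> 'w \<Rightarrow> real) \<Rightarrow> real \<Rightarrow> 'w \<Rightarrow> real" where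
  "mean_height u t \<omega> = integral {0..1} (\<lambda>\<xi>. u \<xi> t \<omega>)"

text \<open>\<open>V\<close> is a non-decreasing, not identically vanishing lower bound for the expected velocity,
  valid for all admissible fields whose probability space lives on the type \<open>'w\<close>.
  The integrability conjunct says that the expectation is well defined; without it the
  Lebesgue integral could take its default value \<open>0\<close>.\<close>

definition velocity_bound ::
    "'w itself \<Rightarrow> real \<Rightarrow> real \<Rightarrow> real \<Rightarrow> (real \<Rightarrow> real) \<Rightarrow> bool" where
  "velocity_bound (_ :: 'w itself) lam \<beta> \<delta> V \<longleftrightarrow>
    V \<in> {0..} \<rightarrow> {0..} \<and> mono_on {0..} V \<and> (\<exists>F\<ge>0. V F \<noteq> 0) \<and>
    (\<forall>(M :: 'w measure) X \<phi> F u.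
      prob_space M \<longrightarrow> complete_measure M \<longrightarrow>
      obstacle_strengths M lam \<beta> X \<longrightarrow> bump \<delta> \<phi> \<longrightarrow> F > 0 \<longrightarrow>
      (\<forall>\<omega>\<in>space M.
        classical_solution (\<lambda>x y. obstacle_field X \<phi> x y \<omega>) F (\<lambda>x t. u x t \<omega>)) \<longrightarrow>
      (\<forall>t>0. integrable M (\<lambda>\<omega>. mean_height u t \<omega> / t) \<and>
        prob_space.expectation M (\<lambda>\<omega>. mean_height u t \<omega> / t) \<ge> V F))"

text \<open>In ``there is \<open>V\<close>, depending only on \<open>lam\<close>, \<open>\<beta>\<close>, \<open>\<delta>\<close>, such that for every probability
  space \dots'' the function \<open>V\<close> is chosen before the probability space. As types cannot be
  quantified inside a formula, \<open>\<exists>V. velocity_bound TYPE('w) lam \<beta> \<delta> V\<close> would let \<open>V\<close> depend on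
  the type \<open>'w\<close>. Therefore \<open>V\<close> is chosen once and for all, as a witness for
  the fixed type \<open>int \<times> int \<Rightarrow> real\<close>, on which the family \<open>(f\<^sub>i\<^sub>j)\<close> can have any admissible law.
  For that type, \<open>velocity_bound\<close> of the chosen function is the existence statement itself;
  for any other type it says that the same \<open>V\<close> works there as well.\<close>

definition velocity_fun :: "real \<Rightarrow> real \<Rightarrow> real \<Rightarrow> real \<Rightarrow> real" where
  "velocity_fun lam \<beta> \<delta> = (SOME V. velocity_bound TYPE(int \<times> int \<Rightarrow> real) lam \<beta> \<delta> V)"

end

theory Submission
  imports Defs
begin

text \<open>Since \<open>0\<close> is a subsolution, \<open>u\<close> is non-negative, bounded by \<open>F t\<close>, and non-decreasing in
  time. Fix \<open>t\<close> and cut the line into unit cells around the columns of obstacles. Across a cell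
  the slope of the profile \<open>u(\<cdot>, t)\<close> changes by \<open>W + G - F\<close>, where \<open>W\<close> and \<open>G\<close> are the
  integrals of \<open>u\<^sub>t\<close> and of the obstacle field. Record the rounded height and slope at the cell
  boundaries and give such a lattice path the weight \<open>exp (\<theta> \<Sum>(G - W - F))\<close> with
  \<open>\<theta> = \<lambda>/2\<close>. The term \<open>- W\<close> pays for the number of possible continuations, so for large \<open>F\<close>
  the expected total weight of all paths of length \<open>k\<close> is at most \<open>C e\<^sup>-\<^sup>\<theta>\<^sup>k\<close>. The weight of the
  actual profile is the exponential of \<open>\<theta>\<close> times (change of slope \<open>- 2 \<Sum>W\<close>), and slopes are
  bounded for fixed \<open>t\<close>; by stationarity and \<open>1 + x \<le> e\<^sup>x\<close> the mean of \<open>W\<close> is therefore at least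
  \<open>1/2\<close>, which is a lower bound for the derivative of the mean height.

  Measurability, stationarity, and the passage between probability spaces all rest on the
  continuous dependence of \<open>u\<close> on the obstacle strengths: the mean height is a Borel function of
  the strengths that does not depend on the probability space.\<close>

section \<open>Comparison principle with linearly growing coefficients\<close>

text \<open>The strengths may be unbounded along every row, so the comparison principle has to
  tolerate a Lipschitz coefficient that grows linearly in x. As for the weights, write G - W - F = 2
  G - (W + G + F). Only the exponential moment of order \<lambda> is available and 2 G must use it
  up, hence \<theta> = \<lambda>/2. The factor exp (-\<theta> (W + G + F)) is the decay that pays
  for the choices: W + G + F is at least F and controls how far height and slope move within a cell.
  A profile of slope p may meet about |p| rows in one cell, a count that would ruin the sum over
  continuations; but each row is then met on a length of order 1/|p| only, and Jensen's inequality
  turns this length into a weight that cancels the count. After Jensen a path uses one site per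
  column, so its sites are distinct and independent. The bounds on height and slope depend on t, but
  they enter only through the number of starting states and a boundary term. Letting the number of
  columns tend to infinity removes both, and the velocity bound becomes uniform in t.\<close>

definition japanese :: "real \<Rightarrow> real" where
  "japanese x = sqrt (1 + x\<^sup>2)"

lemma japanese_ge_1: "1 \<le> japanese x"
  by (simp add: japanese_def)

lemma japanese_ge_abs: "\<bar>x\<bar> \<le> japanese x"
  unfolding japanese_def by (rule real_le_rsqrt) simp

lemma japanese_le: "japanese x \<le> 1 + \<bar>x\<bar>"
  unfolding japanese_def by (rule real_le_lsqrt) (auto simp: power2_eq_square algebra_simps)

definition japanese' :: "real \<Rightarrow> real" where "japanese' x = x / japanese x"

definition japanese'' :: "real \<Rightarrow> real" where
  "japanese'' x = (japanese x - x * japanese' x) / (japanese x)\<^sup>2"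

lemma japanese_has_derivative [derivative_intros]:
  assumes "(g has_real_derivative g') (at x)"
  shows "((\<lambda>x. japanese (g x)) has_real_derivative japanese' (g x) * g') (at x)"
proof -
  have "1 + (g x)\<^sup>2 > 0" by (simp add: add_pos_nonneg)
  with assms show ?thesis
    unfolding japanese_def japanese'_def by (auto intro!: derivative_eq_intros simp: field_simps)
qed

lemma japanese'_has_derivative: "(japanese' has_real_derivative japanese'' x) (at x)"
proof -
  have "japanese x \<noteq> 0" using japanese_ge_1[of x] by linarith
  then have "((\<lambda>x. x / japanese x) has_real_derivative japanese'' x) (at x)"
    unfolding japanese''_def by (auto intro!: derivative_eq_intros simp: power2_eq_square)
  then show ?thesis by (simp add: japanese'_def[abs_def])
qed

lemma japanese'_bound: "\<bar>japanese' x\<bar> \<le> 1"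
  using japanese_ge_1[of x] japanese_ge_abs[of x] by (simp add: japanese'_def)

lemma japanese''_bound: "japanese'' x \<le> 1"
proof -
  have pos: "japanese x > 0" using japanese_ge_1[of x] by linarith
  have "0 \<le> x * japanese' x" using pos by (simp add: japanese'_def)
  then have "japanese x - x * japanese' x \<le> japanese x * japanese x"
    using mult_mono[of 1 "japanese x" 1 "japanese x"] mult_left_mono[of 1 "japanese x" "japanese x"]
      japanese_ge_1[of x] by linarith
  then show ?thesis using pos by (simp add: japanese''_def power2_eq_square)
qed

text \<open>The source \<open>g\<close> is a given function of \<open>x\<close> and \<open>t\<close>
  and not a nonlinearity: the difference of two solutions of obstacle equations is again of this
  form. The derivatives at time \<open>T\<close> are two-sided, which solutions defined for all
  positive times have.\<close>

definition heat_eq ::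
    "real \<Rightarrow> (real \<Rightarrow> real \<Rightarrow> real) \<Rightarrow> (real \<Rightarrow> real \<Rightarrow> real) \<Rightarrow> bool" where
  "heat_eq T w g \<longleftrightarrow>
    continuous_on (UNIV \<times> {0..T}) (\<lambda>(x, t). w x t) \<and>
    bounded ((\<lambda>(x, t). w x t) ` (UNIV \<times> {0..T})) \<and>
    (\<exists>wt wx wxx. \<forall>x t. 0 < t \<longrightarrow> t \<le> T \<longrightarrow>
      ((\<lambda>s. w x s) has_real_derivative wt x t) (at t) \<and>
      ((\<lambda>y. w y t) has_real_derivative wx x t) (at x) \<and>
      ((\<lambda>y. wx y t) has_real_derivative wxx x t) (at x) \<and>
      wt x t = wxx x t + g x t)"

lemma second_derivative_nonneg_at_min:
  fixes f f' :: "real \<Rightarrow> real"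
  assumes min: "\<And>y. f x \<le> f y"
    and f': "\<And>y. (f has_real_derivative f' y) (at y)"
    and f'': "(f' has_real_derivative c) (at x)"
  shows "0 \<le> c"
proof (rule ccontr)
  assume "\<not> 0 \<le> c"
  then obtain d where d: "d > 0" "\<And>h. 0 < h \<Longrightarrow> h < d \<Longrightarrow> f' (x + h) < f' x"
    using DERIV_neg_dec_right[OF f''] by auto
  have "f' x = 0"
    by (rule DERIV_local_min[OF f', of 1]) (use min in auto)
  have "\<exists>z>x. z < x + d / 2 \<and> f (x + d / 2) - f x = (x + d / 2 - x) * f' z"
    by (rule MVT2) (use d f' in auto)
  then obtain z where z: "x < z" "z < x + d / 2" "f (x + d / 2) - f x = d / 2 * f' z" by auto
  have "f' z < 0" using d(2)[of "z - x"] z \<open>f' x = 0\<close> d(1) by auto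
  then have "d / 2 * f' z < 0" using d(1) by (simp add: mult_pos_neg)
  with z min[of "x + d / 2"] show False by linarith
qed

text \<open>The barrier \<open>exp ((1 + A t) s(x) + K t)\<close>, with \<open>s\<close> comparable to \<open>\<bar>x\<bar>\<close>, grows in \<open>t\<close> fast enough
  to absorb a zeroth-order coefficient of size \<open>A s(x)\<close>, and its growth in \<open>x\<close> forces the first
  touching point into a compact set.\<close>

lemma heat_eq_barrier:
  assumes heat: "heat_eq T w g" and A: "0 \<le> A" and eps: "0 < \<epsilon>"
    and init: "\<And>x. 0 \<le> w x 0"
    and g: "\<And>x t. 0 < t \<Longrightarrow> t \<le> T \<Longrightarrow> w x t < 0 \<Longrightarrow>
      A * japanese x * w x t - \<epsilon> * exp (japanese x) \<le> g x t"
    and K: "K = 2 * (1 + A * T)\<^sup>2 + 2" and t: "0 \<le> t" "t \<le> T"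
  shows "- \<epsilon> * exp ((1 + A * t) * japanese x + K * t) \<le> w x t"
proof (rule ccontr)
  assume neg: "\<not> - \<epsilon> * exp ((1 + A * t) * japanese x + K * t) \<le> w x t"
  define \<psi> where "\<psi> = (\<lambda>x t. exp ((1 + A * t) * japanese x + K * t))"
  define z where "z = (\<lambda>x t. w x t + \<epsilon> * \<psi> x t)"
  from heat obtain wt wx wxx where
    cont: "continuous_on (UNIV \<times> {0..T}) (\<lambda>(x, t). w x t)"
    and bdd: "bounded ((\<lambda>(x, t). w x t) ` (UNIV \<times> {0..T}))"
    and wt: "\<And>x t. 0 < t \<Longrightarrow> t \<le> T \<Longrightarrow> ((\<lambda>s. w x s) has_real_derivative wt x t) (at t)"
    and wx: "\<And>x t. 0 < t \<Longrightarrow> t \<le> T \<Longrightarrow> ((\<lambda>y. w y t) has_real_derivative wx x t) (at x)"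
    and wxx: "\<And>x t. 0 < t \<Longrightarrow> t \<le> T \<Longrightarrow> ((\<lambda>y. wx y t) has_real_derivative wxx x t) (at x)"
    and eq: "\<And>x t. 0 < t \<Longrightarrow> t \<le> T \<Longrightarrow> wt x t = wxx x t + g x t"
    unfolding heat_eq_def by blast
  from bdd obtain b where "\<forall>p\<in>UNIV \<times> {0..T}. \<bar>case p of (x, t) \<Rightarrow> w x t\<bar> \<le> b"
    unfolding bounded_iff by auto
  then have b: "\<And>x t. 0 \<le> t \<Longrightarrow> t \<le> T \<Longrightarrow> \<bar>w x t\<bar> \<le> b" by force
  have "0 \<le> T" using t by linarith
  have K0: "K \<ge> 0" unfolding K by simp
  have psi_ge: "\<psi> x t \<ge> exp (japanese x)" if "0 \<le> t" for x t
  proof -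
    have "0 \<le> A * t * japanese x" using A that japanese_ge_1[of x] by auto
    then show ?thesis using K0 that by (simp add: \<psi>_def algebra_simps)
  qed
  \<comment> \<open>Outside this radius the barrier beats the bound \<open>b\<close> of
    \<open>w\<close>, because \<open>\<psi> x t\<close> is at least \<open>exp (japanese x)\<close>,
    which exceeds \<open>\<bar>x\<bar>\<close>.\<close>
  define R where "R = b / \<epsilon>"
  have far: "z x t > 0" if "\<bar>x\<bar> > R" "0 \<le> t" "t \<le> T" for x t
  proof -
    have "b / \<epsilon> < \<psi> x t"
      using psi_ge[OF that(2), of x] that(1) exp_ge_add_one_self[of "japanese x"] japanese_ge_abs[of x]
      unfolding R_def by linarith
    then have "b < \<epsilon> * \<psi> x t" using eps by (simp add: field_simps)
    then show ?thesis using b[OF that(2,3), of x] by (simp add: z_def)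
  qed
  define S where "S = {p \<in> {-R..R} \<times> {0..T}. (\<lambda>(x, t). z x t) p \<le> 0}"
  have contpsi: "continuous_on (UNIV \<times> {0..T}) (\<lambda>(x, t). \<psi> x t)"
    unfolding \<psi>_def japanese_def case_prod_unfold by (intro continuous_intros)
  have contz: "continuous_on (UNIV \<times> {0..T}) (\<lambda>(x, t). z x t)"
    using continuous_on_add[OF cont continuous_on_mult_left[OF contpsi, of \<epsilon>]]
    by (simp add: z_def case_prod_unfold)
  have "compact S"
  proof -
    have cb: "compact ({-R..R} \<times> {0..T})" by (intro compact_Times) auto
    have "closed S" unfolding S_def
      by (rule continuous_on_closed_Collect_le)
         (auto intro!: continuous_on_subset[OF contz] compact_imp_closed[OF cb] continuous_intros)
    moreover have "S \<subseteq> {-R..R} \<times> {0..T}" unfolding S_def by auto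
    ultimately show ?thesis using cb by (metis compact_Int_closed inf.absorb_iff2)
  qed
  moreover have "(x, t) \<in> S"
  proof -
    have "z x t \<le> 0" using neg by (simp add: z_def \<psi>_def)
    then show ?thesis using far[of x t] t unfolding S_def by (cases "\<bar>x\<bar> \<le> R") (auto simp: not_le)
  qed
  \<comment> \<open>A point with the earliest time among those of the compact set where
    \<open>z\<close> is not positive.\<close>
  ultimately obtain p0 where p0: "p0 \<in> S" "\<And>p. p \<in> S \<Longrightarrow> snd p0 \<le> snd p"
    using continuous_attains_inf[of S snd] continuous_on_snd[OF continuous_on_id, of S]
    by blast
  obtain x0 t0 where p0eq: "p0 = (x0, t0)" by force
  have t0: "0 \<le> t0" "t0 \<le> T" and z0: "z x0 t0 \<le> 0" using p0 p0eq by (auto simp: S_def)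
  have before: "z y s > 0" if "0 \<le> s" "s < t0" for y s
  proof (rule ccontr)
    assume "\<not> z y s > 0"
    then have "(y, s) \<in> S" using far[of y s] that t0 unfolding S_def by (cases "\<bar>y\<bar> \<le> R") (auto simp: not_le)
    then show False using p0(2)[of "(y, s)"] p0eq that by simp
  qed
  have "t0 > 0"
  proof (rule ccontr)
    assume "\<not> 0 < t0"
    then have "z x0 0 \<le> 0" using z0 t0 by auto
    moreover have "\<epsilon> * \<psi> x0 0 > 0" using eps by (simp add: \<psi>_def)
    ultimately show False using init[of x0] by (simp add: z_def)
  qed
  have zt: "((\<lambda>s. z x s) has_real_derivative wt x t + \<epsilon> * ((A * japanese x + K) * \<psi> x t)) (at t)"
    if "0 < t" "t \<le> T" for x t
    unfolding z_def \<psi>_def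
    by (rule derivative_eq_intros wt[OF that] refl)+ (simp add: algebra_simps)
  define px where "px = (\<lambda>x t. (1 + A * t) * japanese' x * \<psi> x t)"
  have zx: "((\<lambda>y. z y t) has_real_derivative wx x t + \<epsilon> * px x t) (at x)"
    if "0 < t" "t \<le> T" for x t
    unfolding z_def \<psi>_def px_def
    by (rule derivative_eq_intros wx[OF that] refl)+ (simp add: algebra_simps)
  define pxx where "pxx = (\<lambda>x t. ((1 + A * t) * japanese'' x + ((1 + A * t) * japanese' x)\<^sup>2) * \<psi> x t)"
  have zxx: "((\<lambda>y. wx y t + \<epsilon> * px y t) has_real_derivative wxx x t + \<epsilon> * pxx x t) (at x)"
    if "0 < t" "t \<le> T" for x t
    unfolding \<psi>_def px_def pxx_def
    by (rule derivative_eq_intros wxx[OF that] japanese'_has_derivative refl)+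
       (simp add: algebra_simps power2_eq_square)
  \<comment> \<open>Minimality of \<open>t0\<close> speaks of earlier times only; the limit from the
    left makes \<open>x0\<close> a global minimum of the slice at time \<open>t0\<close>.\<close>
  have ge0: "z y t0 \<ge> 0" for y
  proof -
    have "isCont (\<lambda>s. z y s) t0" using zt[OF \<open>t0 > 0\<close> t0(2), of y] by (rule DERIV_isCont)
    then have "((\<lambda>s. z y s) \<longlongrightarrow> z y t0) (at_left t0)"
      by (simp add: isCont_def filterlim_at_split)
    moreover have "eventually (\<lambda>s. z y s \<ge> 0) (at_left t0)"
      using eventually_at_left_real[OF \<open>t0 > 0\<close>]
      by eventually_elim (use before in \<open>auto intro!: less_imp_le\<close>)
    ultimately show ?thesis by (rule tendsto_lowerbound) simp
  qed
  have z00: "z x0 t0 = 0" using ge0[of x0] z0 by linarith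
  have dt: "wt x0 t0 + \<epsilon> * ((A * japanese x0 + K) * \<psi> x0 t0) \<le> 0"
  proof (rule ccontr)
    assume "\<not> ?thesis"
    then obtain d where "d > 0" and d: "\<And>h. 0 < h \<Longrightarrow> h < d \<Longrightarrow> z x0 (t0 - h) < z x0 t0"
      using DERIV_pos_inc_left[OF zt[OF \<open>t0 > 0\<close> t0(2), of x0]] by auto
    define h where "h = min (d / 2) (t0 / 2)"
    have "0 < h" "h < d" "h < t0" using \<open>d > 0\<close> \<open>t0 > 0\<close> by (auto simp: h_def min_def)
    then show False using d[of h] before[of "t0 - h" x0] z00 by auto
  qed
  have dxx: "0 \<le> wxx x0 t0 + \<epsilon> * pxx x0 t0"
    by (rule second_derivative_nonneg_at_min[where f = "\<lambda>y. z y t0" and x = x0 and f' = "\<lambda>y. wx y t0 + \<epsilon> * px y t0"])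
       (use ge0 z00 zx[OF \<open>t0 > 0\<close> t0(2)] zxx[OF \<open>t0 > 0\<close> t0(2)] in auto)
  have psipos: "\<psi> x0 t0 > 0" by (simp add: \<psi>_def)
  have w0: "w x0 t0 = - \<epsilon> * \<psi> x0 t0" using z00 by (simp add: z_def)
  have "w x0 t0 < 0" using w0 psipos eps by simp
  from g[OF \<open>t0 > 0\<close> t0(2) this]
  have g0: "- (A * japanese x0 * \<epsilon> * \<psi> x0 t0) - \<epsilon> * exp (japanese x0) \<le> g x0 t0"
    by (simp add: w0 algebra_simps)
  have g1: "\<epsilon> * exp (japanese x0) \<le> \<epsilon> * \<psi> x0 t0"
    using psi_ge[OF t0(1)] eps by simp
  have pb: "pxx x0 t0 \<le> (2 * (1 + A * T)\<^sup>2) * \<psi> x0 t0"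
  proof -
    have a: "1 \<le> 1 + A * t0" "1 + A * t0 \<le> 1 + A * T" using A t0 by (auto intro: mult_left_mono)
    have "(1 + A * t0) * japanese'' x0 \<le> 1 + A * t0"
      using a japanese''_bound[of x0] by (simp add: mult_left_le)
    also have "\<dots> \<le> (1 + A * T)\<^sup>2"
      using a mult_mono[of 1 "1 + A*T" "1+A*t0" "1 + A*T"] by (simp add: power2_eq_square)
    finally have 1: "(1 + A * t0) * japanese'' x0 \<le> (1 + A * T)\<^sup>2" .
    have "\<bar>(1 + A * t0) * japanese' x0\<bar> \<le> 1 + A * T"
      using a japanese'_bound[of x0] mult_mono[of "1 + A*t0" "1 + A*T" "\<bar>japanese' x0\<bar>" 1]
      by (simp add: abs_mult)
    then have "((1 + A * t0) * japanese' x0)\<^sup>2 \<le> (1 + A * T)\<^sup>2" using a by (intro abs_le_square_iff[THEN iffD1]) auto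
    with 1 show ?thesis unfolding pxx_def using psipos by (intro mult_right_mono) auto
  qed
  \<comment> \<open>At the touching point the growth of the exponent in time cancels the term with
    \<open>A * japanese x\<close>. Of \<open>K\<close>, the part
    \<open>2 * (1 + A * T)\<^sup>2\<close> beats the second space derivative, one unit beats the
    error \<open>\<epsilon> * exp (japanese x)\<close>, and the last unit gives strictness.\<close>
  have "\<epsilon> * pxx x0 t0 \<le> \<epsilon> * ((2 * (1 + A * T)\<^sup>2) * \<psi> x0 t0)" using pb eps by simp
  moreover have "\<epsilon> * (K * \<psi> x0 t0) = \<epsilon> * ((2 * (1 + A * T)\<^sup>2) * \<psi> x0 t0) + 2 * (\<epsilon> * \<psi> x0 t0)"
    by (simp add: K algebra_simps)
  moreover have "\<epsilon> * \<psi> x0 t0 > 0" using eps psipos by simp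
  ultimately show False
    using dt dxx g0 g1 eq[OF \<open>t0 > 0\<close> t0(2), of x0] by (simp add: algebra_simps)
qed

section \<open>Obstacle fields\<close>

lemma C1_plane_lipschitz_on_compact:
  assumes "C1_plane \<phi>" "compact S" "convex S"
  obtains L where "0 \<le> L" "\<And>p q. p \<in> S \<Longrightarrow> q \<in> S \<Longrightarrow> \<bar>\<phi> p - \<phi> q\<bar> \<le> L * norm (p - q)"
proof -
  from assms(1) obtain \<phi>' :: "real \<times> real \<Rightarrow> (real \<times> real) \<Rightarrow>\<^sub>L real" where
    d: "\<And>z. (\<phi> has_derivative blinfun_apply (\<phi>' z)) (at z)" and c: "continuous_on UNIV \<phi>'"
    unfolding C1_plane_def by blast
  have "bounded (\<phi>' ` S)"
    using assms(2) c by (intro compact_imp_bounded compact_continuous_image) (auto intro: continuous_on_subset)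
  then obtain L where L: "\<And>z. z \<in> S \<Longrightarrow> norm (\<phi>' z) \<le> L" by (auto simp: bounded_iff)
  have "norm (\<phi> p - \<phi> q) \<le> max 0 L * norm (p - q)" if "p \<in> S" "q \<in> S" for p q
  proof (rule differentiable_bound[OF assms(3)])
    show "(\<phi> has_derivative blinfun_apply (\<phi>' z)) (at z within S)" if "z \<in> S" for z
      using d has_derivative_at_withinI by blast
    show "onorm (blinfun_apply (\<phi>' z)) \<le> max 0 L" if "z \<in> S" for z
      using L[OF that] by (simp add: norm_blinfun.rep_eq)
  qed (use that in auto)
  then show thesis by (intro that[of "max 0 L"]) auto
qed

lemma bump_range: "bump \<delta> \<phi> \<Longrightarrow> 0 \<le> \<phi> z" "bump \<delta> \<phi> \<Longrightarrow> \<phi> z \<le> 1"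
  unfolding bump_def by blast+

lemma bump_eq_0:
  assumes "bump \<delta> \<phi>" "\<delta> < \<bar>x\<bar> \<or> \<delta> < \<bar>y\<bar>"
  shows "\<phi> (x, y) = 0"
proof (rule ccontr)
  assume "\<phi> (x, y) \<noteq> 0"
  then have "(x, y) \<in> closure {z. \<phi> z \<noteq> 0}" by (intro closure_subset[THEN subsetD]) simp
  then have "(x, y) \<in> {- \<delta>..\<delta>} \<times> {- \<delta>..\<delta>}" using assms(1) unfolding bump_def by blast
  with assms(2) show False by auto
qed

lemma bump_lipschitz_snd:
  assumes "bump \<delta> \<phi>" "\<delta> < 1"
  obtains L where "0 \<le> L" "\<And>x y y'. \<bar>\<phi> (x, y) - \<phi> (x, y')\<bar> \<le> L * \<bar>y - y'\<bar>"
proof -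
  obtain L where L: "0 \<le> L"
    "\<And>p q. p \<in> {-1..1} \<times> {-1..1} \<Longrightarrow> q \<in> {-1..1} \<times> {-1..1} \<Longrightarrow> \<bar>\<phi> p - \<phi> q\<bar> \<le> L * norm (p - q)"
    using C1_plane_lipschitz_on_compact[of \<phi> "{-1..1} \<times> {-1..1}"] assms(1) unfolding bump_def
    by (metis compact_Times convex_Times compact_Icc convex_real_interval(5))
  \<comment> \<open>Clamping to [-1, 1] does not change \<open>\<phi>\<close>, whose support ends
    before 1; a Lipschitz bound on a compact square thus becomes global in the second
    variable.\<close>
  define c where "c = (\<lambda>y::real. max (-1) (min 1 y))"
  have clip: "\<phi> (x, y) = \<phi> (x, c y)" for x y
    using bump_eq_0[OF assms(1), of x y] bump_eq_0[OF assms(1), of x "c y"] assms(2)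
    by (cases "\<bar>y\<bar> \<le> 1") (auto simp: c_def max_def min_def)
  have "\<bar>\<phi> (x, y) - \<phi> (x, y')\<bar> \<le> L * \<bar>y - y'\<bar>" for x y y'
  proof (cases "\<bar>x\<bar> \<le> 1")
    case True
    have "\<bar>\<phi> (x, c y) - \<phi> (x, c y')\<bar> \<le> L * norm ((x, c y) - (x, c y'))"
      by (rule L(2)) (use True in \<open>auto simp: c_def\<close>)
    also have "norm ((x, c y) - (x, c y')) = \<bar>c y - c y'\<bar>" by (simp add: norm_Pair)
    also have "L * \<bar>c y - c y'\<bar> \<le> L * \<bar>y - y'\<bar>"
      using L(1) by (intro mult_left_mono) (auto simp: c_def)
    finally show ?thesis using clip by metis
  next
    case False
    then show ?thesis using bump_eq_0[OF assms(1), of x] assms(2) L(1) by auto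
  qed
  with L(1) show thesis by (rule that)
qed

text \<open>The only summand of the field that can be nonzero at (x, y): column i is centred at x =
  i and is found by rounding, row j is centred at height j + 1/2 and is found by the floor.\<close>

definition site_field :: "(real \<times> real \<Rightarrow> real) \<Rightarrow> (int \<times> int \<Rightarrow> real) \<Rightarrow> real \<Rightarrow> real \<Rightarrow> real" where
  "site_field \<phi> z x y = z (\<lfloor>x + 1/2\<rfloor>, \<lfloor>y\<rfloor>) * \<phi> (x - \<lfloor>x + 1/2\<rfloor>, y - \<lfloor>y\<rfloor> - 1/2)"

lemma site_term_eq_0:
  assumes "bump \<delta> \<phi>" "\<delta> < 1/2" "i \<noteq> \<lfloor>x + 1/2\<rfloor> \<or> j \<noteq> \<lfloor>y\<rfloor>"
  shows "\<phi> (x - real_of_int i, y - real_of_int j - 1/2) = 0"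
proof (rule ccontr)
  assume "\<not> ?thesis"
  then have "\<bar>x - real_of_int i\<bar> \<le> \<delta>" "\<bar>y - real_of_int j - 1/2\<bar> \<le> \<delta>"
    using bump_eq_0[OF assms(1)] by (meson not_le)+
  with assms(2) have "i = \<lfloor>x + 1/2\<rfloor>" "j = \<lfloor>y\<rfloor>" by linarith+
  with assms(3) show False by simp
qed

lemma obstacle_field_eq_site_field:
  assumes "bump \<delta> \<phi>" "\<delta> < 1/2"
  shows "obstacle_field X \<phi> x y \<omega> = site_field \<phi> (\<lambda>(i, j). X i j \<omega>) x y"
proof -
  have "obstacle_field X \<phi> x y \<omega> =
    (\<Sum>\<^sub>\<infinity>(i, j)\<in>{(\<lfloor>x + 1/2\<rfloor>, \<lfloor>y\<rfloor>)}. X i j \<omega> * \<phi> (x - of_int i, y - of_int j - 1/2))"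
    unfolding obstacle_field_def
    by (rule infsum_cong_neutral) (use site_term_eq_0[OF assms] in \<open>auto split: prod.splits\<close>)
  then show ?thesis by (simp add: site_field_def)
qed

text \<open>Summing over a fixed set of rows removes the floor of \<open>y\<close>, so that
  regularity in \<open>y\<close> is inherited from \<open>\<phi>\<close> even across integer
  heights.\<close>

lemma site_field_eq_sum:
  assumes "bump \<delta> \<phi>" "\<delta> < 1/2" "finite S" "\<lfloor>y\<rfloor> \<in> S"
  shows "site_field \<phi> z x y =
    (\<Sum>j\<in>S. z (\<lfloor>x + 1/2\<rfloor>, j) * \<phi> (x - \<lfloor>x + 1/2\<rfloor>, y - real_of_int j - 1/2))"
proof -
  have "(\<Sum>j\<in>S. z (\<lfloor>x + 1/2\<rfloor>, j) * \<phi> (x - \<lfloor>x + 1/2\<rfloor>, y - real_of_int j - 1/2)) =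
    (\<Sum>j\<in>{\<lfloor>y\<rfloor>}. z (\<lfloor>x + 1/2\<rfloor>, j) * \<phi> (x - \<lfloor>x + 1/2\<rfloor>, y - real_of_int j - 1/2))"
    by (rule sum.mono_neutral_right) (use assms site_term_eq_0[OF assms(1,2)] in auto)
  then show ?thesis by (simp add: site_field_def)
qed

text \<open>Linear growth along the rows is what the comparison principle tolerates, and the exponential
  moment makes it hold almost surely.\<close>

definition row_growth :: "nat \<Rightarrow> real \<Rightarrow> (int \<times> int \<Rightarrow> real) set" where
  "row_growth J B = {z. \<forall>i j. \<bar>j\<bar> \<le> int J \<longrightarrow> z (i, j) \<le> B * (1 + \<bar>of_int i\<bar>)}"

text \<open>The growth constant may depend on the range of rows, because a solution on a bounded
  time interval meets only rows in a bounded range.\<close>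

definition admissible :: "(int \<times> int \<Rightarrow> real) \<Rightarrow> bool" where
  "admissible z \<longleftrightarrow> (\<forall>p. 0 \<le> z p) \<and> (\<forall>J. \<exists>B. z \<in> row_growth J B)"

lemma admissible_nonneg: "admissible z \<Longrightarrow> 0 \<le> z p"
  unfolding admissible_def by blast

lemma site_index_le_japanese: "1 + \<bar>real_of_int \<lfloor>x + 1/2\<rfloor>\<bar> \<le> 3 * japanese x"
  using japanese_ge_1[of x] japanese_ge_abs[of x] by linarith

text \<open>\<open>A\<close> is chosen before the configuration: continuous dependence needs one
  constant for all of \<open>row_growth J B\<close>. The margin of 1 in the height bounds keeps the
  floors within [-J, J].\<close>

lemma site_field_lipschitz:
  assumes bump: "bump \<delta> \<phi>" "\<delta> < 1/2" and B: "0 \<le> B"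
  obtains A where "0 \<le> A"
    "\<And>z x y y'. (\<And>p. 0 \<le> z p) \<Longrightarrow> z \<in> row_growth J B \<Longrightarrow> \<bar>y\<bar> \<le> real J - 1 \<Longrightarrow> \<bar>y'\<bar> \<le> real J - 1 \<Longrightarrow>
      \<bar>site_field \<phi> z x y - site_field \<phi> z x y'\<bar> \<le> A * japanese x * \<bar>y - y'\<bar>"
proof -
  obtain L where L: "0 \<le> L" "\<And>x y y'. \<bar>\<phi> (x, y) - \<phi> (x, y')\<bar> \<le> L * \<bar>y - y'\<bar>"
    using bump_lipschitz_snd[OF bump(1)] bump(2) by auto
  define S where "S = {- int J..int J}"
  have "\<bar>site_field \<phi> z x y - site_field \<phi> z x y'\<bar> \<le> (real (card S) * (B * 3 * L)) * japanese x * \<bar>y - y'\<bar>"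
    if z: "\<And>p. 0 \<le> z p" "z \<in> row_growth J B" and y: "\<bar>y\<bar> \<le> real J - 1" "\<bar>y'\<bar> \<le> real J - 1" for z x y y'
  proof -
    let ?i = "\<lfloor>x + 1/2\<rfloor>"
    have fl: "\<lfloor>y\<rfloor> \<in> S" "\<lfloor>y'\<rfloor> \<in> S" using y by (auto simp: S_def le_floor_iff floor_le_iff)
    have "\<bar>site_field \<phi> z x y - site_field \<phi> z x y'\<bar> =
      \<bar>\<Sum>j\<in>S. z (?i, j) * (\<phi> (x - ?i, y - real_of_int j - 1/2) - \<phi> (x - ?i, y' - real_of_int j - 1/2))\<bar>"
      using fl by (simp add: site_field_eq_sum[OF bump, where S = S] S_def sum_subtractf right_diff_distrib)
    also have "\<dots> \<le> (\<Sum>j\<in>S. B * (3 * japanese x) * (L * \<bar>y - y'\<bar>))"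
    proof (rule order_trans[OF sum_abs sum_mono])
      fix j assume j: "j \<in> S"
      have "z (?i, j) \<le> B * (1 + \<bar>of_int ?i\<bar>)" using z(2) j by (auto simp: row_growth_def S_def)
      also have "\<dots> \<le> B * (3 * japanese x)" using B site_index_le_japanese by (intro mult_left_mono)
      finally have "z (?i, j) \<le> B * (3 * japanese x)" .
      moreover have "\<bar>\<phi> (x - ?i, y - real_of_int j - 1/2) - \<phi> (x - ?i, y' - real_of_int j - 1/2)\<bar> \<le> L * \<bar>y - y'\<bar>"
        using L(2)[of "x - ?i" "y - real_of_int j - 1/2" "y' - real_of_int j - 1/2"] by simp
      ultimately show "\<bar>z (?i, j) * (\<phi> (x - ?i, y - real_of_int j - 1/2) - \<phi> (x - ?i, y' - real_of_int j - 1/2))\<bar>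
        \<le> B * (3 * japanese x) * (L * \<bar>y - y'\<bar>)"
        unfolding abs_mult abs_of_nonneg[OF z(1)[of "(?i, j)"]]
        by (rule mult_mono) (use B japanese_ge_1[of x] in auto)
    qed
    also have "\<dots> = (real (card S) * (B * 3 * L)) * japanese x * \<bar>y - y'\<bar>"
      unfolding sum_constant by (simp only: mult_ac)
    finally show ?thesis .
  qed
  then show thesis using B L(1) by (intro that[of "real (card S) * (B * 3 * L)"]) auto
qed

lemma site_field_nonneg: "bump \<delta> \<phi> \<Longrightarrow> (\<And>p. 0 \<le> z p) \<Longrightarrow> 0 \<le> site_field \<phi> z x y"
  by (simp add: site_field_def bump_range)

lemma site_field_le: "bump \<delta> \<phi> \<Longrightarrow> (\<And>p. 0 \<le> z p) \<Longrightarrow> site_field \<phi> z x y \<le> z (\<lfloor>x + 1/2\<rfloor>, \<lfloor>y\<rfloor>)"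
  by (simp add: site_field_def bump_range mult_left_le)

lemma site_field_0: "bump \<delta> \<phi> \<Longrightarrow> \<delta> < 1/2 \<Longrightarrow> site_field \<phi> z x 0 = 0"
  using bump_eq_0[of \<delta> \<phi> "x - \<lfloor>x + 1/2\<rfloor>" "- 1/2"] by (simp add: site_field_def)

lemma site_field_diff_le:
  assumes "bump \<delta> \<phi>"
  shows "\<bar>site_field \<phi> z x y - site_field \<phi> z' x y\<bar> \<le> \<bar>z (\<lfloor>x + 1/2\<rfloor>, \<lfloor>y\<rfloor>) - z' (\<lfloor>x + 1/2\<rfloor>, \<lfloor>y\<rfloor>)\<bar>"
proof -
  have "site_field \<phi> z x y - site_field \<phi> z' x y =
    (z (\<lfloor>x + 1/2\<rfloor>, \<lfloor>y\<rfloor>) - z' (\<lfloor>x + 1/2\<rfloor>, \<lfloor>y\<rfloor>)) * \<phi> (x - \<lfloor>x + 1/2\<rfloor>, y - \<lfloor>y\<rfloor> - 1/2)"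
    by (simp add: site_field_def left_diff_distrib)
  then show ?thesis using assms by (simp add: abs_mult bump_range mult_left_le)
qed

lemma site_field_shift:
  "site_field \<phi> z (x + of_int k) y = site_field \<phi> (\<lambda>(i, j). z (i + k, j)) x y"
proof -
  have "\<lfloor>x + real_of_int k + 1/2\<rfloor> = \<lfloor>x + 1/2\<rfloor> + k"
    using floor_add_int[of "x + 1/2" k] by (simp add: algebra_simps)
  then show ?thesis by (simp add: site_field_def)
qed

section \<open>Differences and time shifts of solutions of the heat equation with a source\<close>

lemma heat_eqI:
  assumes "continuous_on (UNIV \<times> {0..T}) (\<lambda>(x, t). w x t)"
    and "bounded ((\<lambda>(x, t). w x t) ` (UNIV \<times> {0..T}))"
    and "\<And>x t. 0 < t \<Longrightarrow> t \<le> T \<Longrightarrow> ((\<lambda>s. w x s) has_real_derivative wt x t) (at t)"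
    and "\<And>x t. 0 < t \<Longrightarrow> t \<le> T \<Longrightarrow> ((\<lambda>y. w y t) has_real_derivative wx x t) (at x)"
    and "\<And>x t. 0 < t \<Longrightarrow> t \<le> T \<Longrightarrow> ((\<lambda>y. wx y t) has_real_derivative wxx x t) (at x)"
    and "\<And>x t. 0 < t \<Longrightarrow> t \<le> T \<Longrightarrow> wt x t = wxx x t + g x t"
  shows "heat_eq T w g"
  unfolding heat_eq_def using assms by blast

lemma heat_eqE:
  assumes "heat_eq T w g"
  obtains wt wx wxx where
    "continuous_on (UNIV \<times> {0..T}) (\<lambda>(x, t). w x t)"
    "bounded ((\<lambda>(x, t). w x t) ` (UNIV \<times> {0..T}))"
    "\<And>x t. 0 < t \<Longrightarrow> t \<le> T \<Longrightarrow> ((\<lambda>s. w x s) has_real_derivative wt x t) (at t)"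
    "\<And>x t. 0 < t \<Longrightarrow> t \<le> T \<Longrightarrow> ((\<lambda>y. w y t) has_real_derivative wx x t) (at x)"
    "\<And>x t. 0 < t \<Longrightarrow> t \<le> T \<Longrightarrow> ((\<lambda>y. wx y t) has_real_derivative wxx x t) (at x)"
    "\<And>x t. 0 < t \<Longrightarrow> t \<le> T \<Longrightarrow> wt x t = wxx x t + g x t"
  using assms unfolding heat_eq_def by blast

lemma heat_eq_classical:
  assumes "classical_solution f F u" "0 \<le> T"
  shows "heat_eq T u (\<lambda>x t. F - f x (u x t))"
proof -
  from assms obtain ut ux uxx where d:
    "\<And>x t. 0 < t \<Longrightarrow> ((\<lambda>s. u x s) has_real_derivative ut x t) (at t)"
    "\<And>x t. 0 < t \<Longrightarrow> ((\<lambda>y. u y t) has_real_derivative ux x t) (at x)"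
    "\<And>x t. 0 < t \<Longrightarrow> ((\<lambda>y. ux y t) has_real_derivative uxx x t) (at x)"
    "\<And>x t. 0 < t \<Longrightarrow> ut x t = uxx x t - f x (u x t) + F"
    unfolding classical_solution_def by blast
  show ?thesis
  proof (rule heat_eqI)
    show "continuous_on (UNIV \<times> {0..T}) (\<lambda>(x, t). u x t)"
      using assms(1) unfolding classical_solution_def by (auto intro: continuous_on_subset)
    show "bounded ((\<lambda>(x, t). u x t) ` (UNIV \<times> {0..T}))"
      using assms unfolding classical_solution_def by blast
    show "ut x t = uxx x t + (F - f x (u x t))" if "0 < t" for x t using d(4)[OF that] by simp
  qed (fact d(1) d(2) d(3) | assumption | rule d)+
qed

lemma heat_eq_diff:
  assumes "heat_eq T v g" "heat_eq T w h"
  shows "heat_eq T (\<lambda>x t. v x t - w x t) (\<lambda>x t. g x t - h x t)"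
proof -
  from assms(1) obtain vt vx vxx where v:
    "continuous_on (UNIV \<times> {0..T}) (\<lambda>(x, t). v x t)"
    "bounded ((\<lambda>(x, t). v x t) ` (UNIV \<times> {0..T}))"
    "\<And>x t. 0 < t \<Longrightarrow> t \<le> T \<Longrightarrow> ((\<lambda>s. v x s) has_real_derivative vt x t) (at t)"
    "\<And>x t. 0 < t \<Longrightarrow> t \<le> T \<Longrightarrow> ((\<lambda>y. v y t) has_real_derivative vx x t) (at x)"
    "\<And>x t. 0 < t \<Longrightarrow> t \<le> T \<Longrightarrow> ((\<lambda>y. vx y t) has_real_derivative vxx x t) (at x)"
    "\<And>x t. 0 < t \<Longrightarrow> t \<le> T \<Longrightarrow> vt x t = vxx x t + g x t" by (rule heat_eqE) blast
  from assms(2) obtain wt wx wxx where w: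
    "continuous_on (UNIV \<times> {0..T}) (\<lambda>(x, t). w x t)"
    "bounded ((\<lambda>(x, t). w x t) ` (UNIV \<times> {0..T}))"
    "\<And>x t. 0 < t \<Longrightarrow> t \<le> T \<Longrightarrow> ((\<lambda>s. w x s) has_real_derivative wt x t) (at t)"
    "\<And>x t. 0 < t \<Longrightarrow> t \<le> T \<Longrightarrow> ((\<lambda>y. w y t) has_real_derivative wx x t) (at x)"
    "\<And>x t. 0 < t \<Longrightarrow> t \<le> T \<Longrightarrow> ((\<lambda>y. wx y t) has_real_derivative wxx x t) (at x)"
    "\<And>x t. 0 < t \<Longrightarrow> t \<le> T \<Longrightarrow> wt x t = wxx x t + h x t" by (rule heat_eqE) blast
  show ?thesis
  proof (rule heat_eqI)
    show "bounded ((\<lambda>(x, t). v x t - w x t) ` (UNIV \<times> {0..T}))"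
      using bounded_minus_comp[OF v(2) w(2)] by (simp add: case_prod_unfold)
    show "continuous_on (UNIV \<times> {0..T}) (\<lambda>(x, t). v x t - w x t)"
      using continuous_on_diff[OF v(1) w(1)] by (simp add: case_prod_unfold)
  qed (rule derivative_eq_intros v w refl | assumption | simp add: v(6) w(6))+
qed

lemma heat_eq_time: "heat_eq T (\<lambda>x t. F * t) (\<lambda>x t. F)"
proof (rule heat_eqI)
  show "bounded ((\<lambda>(x::real, t). F * t) ` (UNIV \<times> {0..T}))"
    unfolding bounded_iff
    by (intro exI[of _ "\<bar>F\<bar> * \<bar>T\<bar>"]) (auto simp: abs_mult intro!: mult_left_mono)
  show "continuous_on (UNIV \<times> {0..T}) (\<lambda>(x::real, t). F * t)"
    by (auto simp: case_prod_unfold intro!: continuous_intros)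
  show "((\<lambda>s. F * s) has_real_derivative F) (at t)" for t
    by (auto intro!: derivative_eq_intros)
  show "((\<lambda>y. F * t) has_real_derivative 0) (at x)" for x t by simp
  show "((\<lambda>y. 0) has_real_derivative 0) (at x)" for x :: real by simp
qed simp

lemma heat_eq_time_shift:
  assumes "heat_eq (T + h) w g" "0 \<le> h"
  shows "heat_eq T (\<lambda>x t. w x (t + h)) (\<lambda>x t. g x (t + h))"
proof -
  from assms(1) obtain wt wx wxx where w:
    "continuous_on (UNIV \<times> {0..T + h}) (\<lambda>(x, t). w x t)"
    "bounded ((\<lambda>(x, t). w x t) ` (UNIV \<times> {0..T + h}))"
    "\<And>x t. 0 < t \<Longrightarrow> t \<le> T + h \<Longrightarrow> ((\<lambda>s. w x s) has_real_derivative wt x t) (at t)"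
    "\<And>x t. 0 < t \<Longrightarrow> t \<le> T + h \<Longrightarrow> ((\<lambda>y. w y t) has_real_derivative wx x t) (at x)"
    "\<And>x t. 0 < t \<Longrightarrow> t \<le> T + h \<Longrightarrow> ((\<lambda>y. wx y t) has_real_derivative wxx x t) (at x)"
    "\<And>x t. 0 < t \<Longrightarrow> t \<le> T + h \<Longrightarrow> wt x t = wxx x t + g x t" by (rule heat_eqE) blast
  have sub: "(\<lambda>(x, t). (x, t + h)) ` (UNIV \<times> {0..T}) \<subseteq> UNIV \<times> {0..T + h}" using assms(2) by auto
  show ?thesis
  proof (rule heat_eqI)
    have "continuous_on (UNIV \<times> {0..T}) (\<lambda>(x, t). (x, t + h))"
      by (auto simp: case_prod_unfold intro!: continuous_intros)
    then have "continuous_on (UNIV \<times> {0..T}) ((\<lambda>(x, t). w x t) \<circ> (\<lambda>(x, t). (x, t + h)))"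
      by (rule continuous_on_compose) (rule continuous_on_subset[OF w(1) sub])
    then show "continuous_on (UNIV \<times> {0..T}) (\<lambda>(x, t). w x (t + h))"
      by (simp add: case_prod_unfold o_def)
    show "bounded ((\<lambda>(x, t). w x (t + h)) ` (UNIV \<times> {0..T}))"
      using bounded_subset[OF w(2) image_mono[OF sub]] by (simp add: case_prod_unfold image_image)
    show "((\<lambda>s. w x (s + h)) has_real_derivative wt x (t + h)) (at t)" if "0 < t" "t \<le> T" for x t
      using w(3)[of "t + h" x] that assms(2) by (simp add: DERIV_shift)
    show "((\<lambda>y. w y (t + h)) has_real_derivative wx x (t + h)) (at x)" if "0 < t" "t \<le> T" for x t
      using w(4)[of "t + h" x] that assms(2) by simp
    show "((\<lambda>y. wx y (t + h)) has_real_derivative wxx x (t + h)) (at x)" if "0 < t" "t \<le> T" for x t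
      using w(5)[of "t + h" x] that assms(2) by simp
    show "wt x (t + h) = wxx x (t + h) + g x (t + h)" if "0 < t" "t \<le> T" for x t
      using w(6)[of "t + h" x] that assms(2) by simp
  qed
qed

section \<open>A priori bounds and continuous dependence\<close>

lemma nonneg_if_ge_small:
  fixes a C :: real
  assumes "\<And>\<epsilon>. 0 < \<epsilon> \<Longrightarrow> - \<epsilon> * C \<le> a"
  shows "0 \<le> a"
proof (rule ccontr)
  assume a: "\<not> 0 \<le> a"
  define \<epsilon> where "\<epsilon> = - a / (2 * (\<bar>C\<bar> + 1))"
  have "0 < \<epsilon>" unfolding \<epsilon>_def using a by (intro divide_pos_pos) auto
  moreover have "\<epsilon> * C \<le> \<epsilon> * (\<bar>C\<bar> + 1)" using \<open>0 < \<epsilon>\<close> by (intro mult_left_mono) auto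
  moreover have "\<epsilon> * (\<bar>C\<bar> + 1) = - a / 2" by (simp add: \<epsilon>_def field_simps)
  ultimately show False using assms[of \<epsilon>] a by auto
qed

text \<open>Serves as comparison principle (\<open>z1 = z2\<close>, arbitrary
  \<open>\<epsilon>\<close>) and as continuous dependence (equal drives, \<open>\<epsilon>\<close>
  measuring the distance of the configurations). The two obstacle terms differ by the change of the
  second field between the two heights, which the Lipschitz condition controls, and by the change of
  field at height \<open>u1\<close>, which may be as large as the error in
  \<open>heat_eq_barrier\<close>.\<close>

lemma site_field_comparison:
  assumes bump: "bump \<delta> \<phi>"
    and u1: "heat_eq T u1 (\<lambda>x t. F1 - site_field \<phi> z1 x (u1 x t))"
    and u2: "heat_eq T u2 (\<lambda>x t. F2 - site_field \<phi> z2 x (u2 x t))"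
    and F: "F1 \<le> F2" and A: "0 \<le> A" and eps: "0 < \<epsilon>"
    and lip: "\<And>x y y'. \<bar>y\<bar> \<le> real J - 1 \<Longrightarrow> \<bar>y'\<bar> \<le> real J - 1 \<Longrightarrow>
      \<bar>site_field \<phi> z2 x y - site_field \<phi> z2 x y'\<bar> \<le> A * japanese x * \<bar>y - y'\<bar>"
    and b1: "\<And>x t. 0 \<le> t \<Longrightarrow> t \<le> T \<Longrightarrow> \<bar>u1 x t\<bar> \<le> real J - 1"
    and b2: "\<And>x t. 0 \<le> t \<Longrightarrow> t \<le> T \<Longrightarrow> \<bar>u2 x t\<bar> \<le> real J - 1"
    and init: "\<And>x. u1 x 0 \<le> u2 x 0"
    and close: "\<And>x j. \<bar>j\<bar> \<le> int J \<Longrightarrow>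
      \<bar>z2 (\<lfloor>x + 1/2\<rfloor>, j) - z1 (\<lfloor>x + 1/2\<rfloor>, j)\<bar> \<le> \<epsilon> * exp (japanese x)"
    and t: "0 \<le> t" "t \<le> T"
  shows "- \<epsilon> * exp ((1 + A * t) * japanese x + (2 * (1 + A * T)\<^sup>2 + 2) * t) \<le> u2 x t - u1 x t"
proof -
  have heat: "heat_eq T (\<lambda>x t. u2 x t - u1 x t)
    (\<lambda>x t. (F2 - site_field \<phi> z2 x (u2 x t)) - (F1 - site_field \<phi> z1 x (u1 x t)))"
    by (rule heat_eq_diff[OF u2 u1])
  show ?thesis
  proof (rule heat_eq_barrier[OF heat A eps _ _ refl t])
    show "0 \<le> u2 x 0 - u1 x 0" for x using init[of x] by simp
    fix x t assume t: "0 < t" "t \<le> T" and neg: "u2 x t - u1 x t < 0"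
    have b: "\<bar>u1 x t\<bar> \<le> real J - 1" "\<bar>u2 x t\<bar> \<le> real J - 1" using b1 b2 t by auto
    have "site_field \<phi> z2 x (u2 x t) - site_field \<phi> z2 x (u1 x t) \<le> A * japanese x * \<bar>u2 x t - u1 x t\<bar>"
      using lip[OF b(2,1), of x] by linarith
    also have "\<dots> = - (A * japanese x * (u2 x t - u1 x t))"
      using neg by (simp only: abs_of_neg mult_minus_right)
    finally have 1: "site_field \<phi> z2 x (u2 x t) - site_field \<phi> z2 x (u1 x t) \<le> - (A * japanese x * (u2 x t - u1 x t))" .
    have "\<bar>\<lfloor>u1 x t\<rfloor>\<bar> \<le> int J" using b(1) by (auto simp: abs_le_iff floor_le_iff minus_le_iff le_floor_iff)
    then have "\<bar>z2 (\<lfloor>x + 1/2\<rfloor>, \<lfloor>u1 x t\<rfloor>) - z1 (\<lfloor>x + 1/2\<rfloor>, \<lfloor>u1 x t\<rfloor>)\<bar> \<le> \<epsilon> * exp (japanese x)"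
      by (rule close)
    then have 2: "site_field \<phi> z2 x (u1 x t) - site_field \<phi> z1 x (u1 x t) \<le> \<epsilon> * exp (japanese x)"
      using site_field_diff_le[OF bump, of z2 x "u1 x t" z1] by linarith
    show "A * japanese x * (u2 x t - u1 x t) - \<epsilon> * exp (japanese x)
      \<le> (F2 - site_field \<phi> z2 x (u2 x t)) - (F1 - site_field \<phi> z1 x (u1 x t))"
      using 1 2 F by linarith
  qed
qed

lemma classical_solution_bounded:
  assumes "classical_solution f F u" "0 \<le> T"
  obtains J :: nat where "\<And>x t. 0 \<le> t \<Longrightarrow> t \<le> T \<Longrightarrow> \<bar>u x t\<bar> \<le> real J - 1"
proof -
  have "bounded ((\<lambda>(x, t). u x t) ` (UNIV \<times> {0..T}))" using assms unfolding classical_solution_def by blast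
  then obtain b where "\<forall>p\<in>UNIV \<times> {0..T}. \<bar>case p of (x, t) \<Rightarrow> u x t\<bar> \<le> b" unfolding bounded_iff by auto
  then have b: "\<bar>u x t\<bar> \<le> b" if "0 \<le> t" "t \<le> T" for x t using that by force
  obtain J :: nat where "b + 1 \<le> real J" using real_arch_simple by blast
  then show thesis using b by (intro that[of J]) (meson order_trans le_diff_eq)
qed

lemma row_growth_mono:
  assumes "B \<le> B'"
  shows "row_growth J B \<subseteq> row_growth J B'"
proof -
  have "B * (1 + \<bar>real_of_int i\<bar>) \<le> B' * (1 + \<bar>real_of_int i\<bar>)" for i
    using assms by (intro mult_right_mono) auto
  then show ?thesis unfolding row_growth_def by (blast intro: order_trans)
qed

locale obstacle_solution =
  fixes \<delta> :: real and \<phi> :: "real \<times> real \<Rightarrow> real" and z :: "int \<times> int \<Rightarrow> real"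
    and F :: real and u :: "real \<Rightarrow> real \<Rightarrow> real"
  assumes bump: "bump \<delta> \<phi>" and delta: "\<delta> < 1/2" and F_pos: "0 < F" and adm: "admissible z"
    and sol: "classical_solution (site_field \<phi> z) F u"
begin

lemma init: "u x 0 = 0"
  using sol by (simp add: classical_solution_def)

lemma heat: "0 \<le> T \<Longrightarrow> heat_eq T u (\<lambda>x t. F - site_field \<phi> z x (u x t))"
  by (rule heat_eq_classical[OF sol])

lemma lipschitz:
  obtains A where "0 \<le> A"
    "\<And>x y y'. \<bar>y\<bar> \<le> real J - 1 \<Longrightarrow> \<bar>y'\<bar> \<le> real J - 1 \<Longrightarrow>
      \<bar>site_field \<phi> z x y - site_field \<phi> z x y'\<bar> \<le> A * japanese x * \<bar>y - y'\<bar>"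
proof -
  from adm obtain B where B: "z \<in> row_growth J B" unfolding admissible_def by blast
  then have "z \<in> row_growth J (max 0 B)" using row_growth_mono[of B "max 0 B" J] by auto
  then show thesis
    using site_field_lipschitz[OF bump delta, of "max 0 B" J] admissible_nonneg[OF adm] that by (metis max.cobounded1)
qed

lemma comparison:
  assumes v: "heat_eq T v (\<lambda>x t. G - site_field \<phi> z x (v x t))" and T: "0 \<le> T"
    and b: "\<And>x t. 0 \<le> t \<Longrightarrow> t \<le> T \<Longrightarrow> \<bar>v x t\<bar> \<le> real J - 1"
  shows "F \<le> G \<Longrightarrow> (\<And>x. 0 \<le> v x 0) \<Longrightarrow> u x T \<le> v x T"
    and "G \<le> F \<Longrightarrow> (\<And>x. v x 0 \<le> 0) \<Longrightarrow> v x T \<le> u x T"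
proof -
  obtain J' where J': "\<And>x t. 0 \<le> t \<Longrightarrow> t \<le> T \<Longrightarrow> \<bar>u x t\<bar> \<le> real J' - 1"
    using classical_solution_bounded[OF sol T] by blast
  define J2 where "J2 = max J J'"
  have b1: "\<bar>v x t\<bar> \<le> real J2 - 1" "\<bar>u x t\<bar> \<le> real J2 - 1" if "0 \<le> t" "t \<le> T" for x t
    using b[OF that, of x] J'[OF that, of x] by (auto simp: J2_def)
  obtain A where A: "0 \<le> A"
    "\<And>x y y'. \<bar>y\<bar> \<le> real J2 - 1 \<Longrightarrow> \<bar>y'\<bar> \<le> real J2 - 1 \<Longrightarrow>
      \<bar>site_field \<phi> z x y - site_field \<phi> z x y'\<bar> \<le> A * japanese x * \<bar>y - y'\<bar>"
    using lipschitz by blast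
  {
    assume FG: "F \<le> G" and v0: "\<And>x. 0 \<le> v x 0"
    have "0 \<le> v x T - u x T"
      by (rule nonneg_if_ge_small, rule site_field_comparison[OF bump heat[OF T] v FG A(1) _ A(2) b1(2,1)])
         (use v0 init T in auto)
    then show "u x T \<le> v x T" by simp
  next
    assume FG: "G \<le> F" and v0: "\<And>x. v x 0 \<le> 0"
    have "0 \<le> u x T - v x T"
      by (rule nonneg_if_ge_small, rule site_field_comparison[OF bump v heat[OF T] FG A(1) _ A(2) b1(1,2)])
         (use v0 init T in auto)
    then show "v x T \<le> u x T" by simp
  }
qed

text \<open>The zero function solves the equation with drive 0: rows are centred at half-integer
  heights, so no obstacle meets height 0.\<close>

lemma nonneg: "0 \<le> t \<Longrightarrow> 0 \<le> u x t"
  using comparison(2)[of t "\<lambda>x t. 0" 0 1 x] heat_eq_time[of t 0] F_pos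
  by (simp add: site_field_0[OF bump delta])

text \<open>Obstacles only retard: \<open>F * t - u\<close> has a non-negative source, so the
  barrier applies with coefficient 0.\<close>

lemma le_drive:
  assumes "0 \<le> t" shows "u x t \<le> F * t"
proof -
  have "0 \<le> F * t - u x t"
  proof (rule nonneg_if_ge_small)
    fix \<epsilon> :: real assume "0 < \<epsilon>"
    then show "- \<epsilon> * exp ((1 + 0 * t) * japanese x + (2 * (1 + 0 * t)\<^sup>2 + 2) * t) \<le> F * t - u x t"
      using assms init site_field_nonneg[of \<delta> \<phi> z, OF bump admissible_nonneg[OF adm]]
      by (intro heat_eq_barrier[OF heat_eq_diff[OF heat_eq_time heat[OF assms]]])
         (auto intro: order_trans[of _ 0])
  qed
  then show ?thesis by simp
qed

lemma abs_le_height: "0 \<le> t \<Longrightarrow> t \<le> T \<Longrightarrow> F * T + 1 \<le> real J \<Longrightarrow> \<bar>u x t\<bar> \<le> real J - 1"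
  using nonneg[of t x] le_drive[of t x] F_pos mult_left_mono[of t T F] by linarith

text \<open>The equation does not involve time explicitly, so the translate of \<open>u\<close> by
  \<open>h\<close> is a solution whose initial datum is at least 0.\<close>

lemma mono_time:
  assumes "0 \<le> s" "s \<le> t"
  shows "u x s \<le> u x t"
proof -
  define h where "h = t - s"
  have h: "0 \<le> h" "t = s + h" using assms by (auto simp: h_def)
  obtain J :: nat where J: "\<And>x r. 0 \<le> r \<Longrightarrow> r \<le> t \<Longrightarrow> \<bar>u x r\<bar> \<le> real J - 1"
    using classical_solution_bounded[OF sol, of t] assms by auto
  have "heat_eq s (\<lambda>x t. u x (t + h)) (\<lambda>x t. F - site_field \<phi> z x (u x (t + h)))"
    using heat_eq_time_shift[OF heat[of "s + h"] h(1)] assms(1) h by simp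
  then have "u x s \<le> u x (s + h)"
    by (rule comparison(1)[OF _ assms(1), of _ _ J]) (use h nonneg J assms in auto)
  then show ?thesis by (simp add: h_def)
qed

end

text \<open>A modulus of continuity in finitely many coordinates, with \<open>d\<close> and
  \<open>N\<close> independent of the configurations. Columns beyond \<open>N\<close> need no
  closeness: under the growth bound two configurations differ there by at most a multiple of
  \<open>japanese x\<close>, which the tolerated error \<open>\<epsilon> * exp (japanese x)\<close>
  dominates.\<close>

lemma site_solution_close:
  assumes bump: "bump \<delta> \<phi>" and delta: "\<delta> < 1/2" and F: "0 < F" and t: "0 \<le> t"
    and J: "F * t + 1 \<le> real J" and B: "0 \<le> B" and R: "0 \<le> R" and eta: "0 < \<eta>"
  obtains d N where "0 < d"
    "\<And>z1 z2 u1 u2 x. admissible z1 \<Longrightarrow> admissible z2 \<Longrightarrow> z1 \<in> row_growth J B \<Longrightarrow> z2 \<in> row_growth J B \<Longrightarrow>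
      classical_solution (site_field \<phi> z1) F u1 \<Longrightarrow> classical_solution (site_field \<phi> z2) F u2 \<Longrightarrow>
      (\<And>i j. \<bar>i\<bar> \<le> N \<Longrightarrow> \<bar>j\<bar> \<le> int J \<Longrightarrow> \<bar>z2 (i, j) - z1 (i, j)\<bar> \<le> d) \<Longrightarrow>
      \<bar>x\<bar> \<le> R \<Longrightarrow> \<bar>u2 x t - u1 x t\<bar> \<le> \<eta>"
proof -
  obtain A where A: "0 \<le> A"
    "\<And>z x y y'. (\<And>p. 0 \<le> z p) \<Longrightarrow> z \<in> row_growth J B \<Longrightarrow> \<bar>y\<bar> \<le> real J - 1 \<Longrightarrow> \<bar>y'\<bar> \<le> real J - 1 \<Longrightarrow>
      \<bar>site_field \<phi> z x y - site_field \<phi> z x y'\<bar> \<le> A * japanese x * \<bar>y - y'\<bar>"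
    using site_field_lipschitz[OF bump delta B] by metis
  define K where "K = 2 * (1 + A * t)\<^sup>2 + 2"
  \<comment> \<open>\<open>C\<close> bounds the barrier for |x| at most R, so that
    \<open>\<epsilon> * C = \<eta>\<close> is the desired precision there.\<close>
  define C where "C = exp ((1 + A * t) * (1 + R) + K * t)"
  define \<epsilon> where "\<epsilon> = \<eta> / C"
  have C: "0 < C" by (simp add: C_def)
  have eps: "0 < \<epsilon>" using eta C by (simp add: \<epsilon>_def)
  have "((\<lambda>s::real. s * exp (- s)) \<longlongrightarrow> 0) at_top"
    using tendsto_power_div_exp_0[of 1] by (simp add: exp_minus divide_inverse)
  then have "\<forall>\<^sub>F s in at_top. s * exp (- s) < \<epsilon> / (3 * B + 1)"
    by (rule order_tendstoD) (use eps B in auto)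
  then obtain s0 where s0: "\<And>s. s0 \<le> s \<Longrightarrow> s * exp (- s) < \<epsilon> / (3 * B + 1)"
    by (auto simp: eventually_at_top_linorder)
  \<comment> \<open>The extra 2 covers the distance between \<open>x\<close> and its rounded column
    index: a column outside the range has \<open>s0 \<le> \<bar>x\<bar>\<close>.\<close>
  define N where "N = \<lceil>\<bar>s0\<bar>\<rceil> + 2"
  have key: "- \<eta> \<le> v2 x t - v1 x t"
    if adm: "admissible y1" "admissible y2" and g: "y1 \<in> row_growth J B" "y2 \<in> row_growth J B"
      and sols: "classical_solution (site_field \<phi> y1) F v1" "classical_solution (site_field \<phi> y2) F v2"
      and near: "\<And>i j. \<bar>i\<bar> \<le> N \<Longrightarrow> \<bar>j\<bar> \<le> int J \<Longrightarrow> \<bar>y2 (i, j) - y1 (i, j)\<bar> \<le> \<epsilon>"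
      and x: "\<bar>x\<bar> \<le> R" for y1 y2 v1 v2 x
  proof -
    interpret S1: obstacle_solution \<delta> \<phi> y1 F v1 by standard (fact bump delta F adm sols)+
    interpret S2: obstacle_solution \<delta> \<phi> y2 F v2 by standard (fact bump delta F adm sols)+
    have close: "\<bar>y2 (\<lfloor>x + 1/2\<rfloor>, j) - y1 (\<lfloor>x + 1/2\<rfloor>, j)\<bar> \<le> \<epsilon> * exp (japanese x)" if j: "\<bar>j\<bar> \<le> int J" for x j
    proof (cases "\<bar>\<lfloor>x + 1/2\<rfloor>\<bar> \<le> N")
      case True
      have "\<bar>y2 (\<lfloor>x + 1/2\<rfloor>, j) - y1 (\<lfloor>x + 1/2\<rfloor>, j)\<bar> \<le> \<epsilon> * 1" using near[OF True j] by simp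
      also have "\<dots> \<le> \<epsilon> * exp (japanese x)" using eps japanese_ge_1[of x] by (intro mult_left_mono) auto
      finally show ?thesis .
    next
      case False
      let ?i = "\<lfloor>x + 1/2\<rfloor>"
      have "s0 \<le> \<bar>x\<bar>" using False unfolding N_def by linarith
      then have "s0 \<le> japanese x" using japanese_ge_abs[of x] by linarith
      then have "japanese x * exp (- japanese x) < \<epsilon> / (3 * B + 1)" by (rule s0)
      then have s: "(3 * B + 1) * japanese x \<le> \<epsilon> * exp (japanese x)"
        using B by (simp add: field_simps exp_minus)
      have "y (?i, j) \<le> 3 * B * japanese x" if "y \<in> row_growth J B" for y
      proof -
        have "y (?i, j) \<le> B * (1 + \<bar>of_int ?i\<bar>)" using that j by (auto simp: row_growth_def)
        also have "\<dots> \<le> B * (3 * japanese x)" using B site_index_le_japanese by (intro mult_left_mono)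
        finally show ?thesis by simp
      qed
      then have "y1 (?i, j) \<le> 3 * B * japanese x" "y2 (?i, j) \<le> 3 * B * japanese x" using g by auto
      then show ?thesis
        using admissible_nonneg[OF adm(1), of "(?i, j)"] admissible_nonneg[OF adm(2), of "(?i, j)"] s
          japanese_ge_1[of x] by (simp add: distrib_right)
    qed
    have "- \<eta> \<le> - \<epsilon> * exp ((1 + A * t) * japanese x + K * t)"
    proof -
      have "(1 + A * t) * japanese x \<le> (1 + A * t) * (1 + R)"
        using A(1) t japanese_le[of x] x by (intro mult_left_mono) auto
      then have "\<epsilon> * exp ((1 + A * t) * japanese x + K * t) \<le> \<epsilon> * C"
        using eps unfolding C_def by (intro mult_left_mono) auto
      also have "\<epsilon> * C = \<eta>" using C by (simp add: \<epsilon>_def)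
      finally show ?thesis by simp
    qed
    also have "\<dots> \<le> v2 x t - v1 x t" unfolding K_def
      by (rule site_field_comparison[OF bump S1.heat[OF t] S2.heat[OF t] order_refl A(1) eps _ _ _ _ close t order_refl])
         (use A(2)[OF admissible_nonneg[OF adm(2)] g(2)] S1.abs_le_height S2.abs_le_height J S1.init S2.init in auto)
    finally show ?thesis .
  qed
  show thesis
  proof (rule that[OF eps, of N])
    fix z1 z2 u1 u2 and x :: real
    assume *: "admissible z1" "admissible z2" "z1 \<in> row_growth J B" "z2 \<in> row_growth J B"
      "classical_solution (site_field \<phi> z1) F u1" "classical_solution (site_field \<phi> z2) F u2"
      and n: "\<And>i j. \<bar>i\<bar> \<le> N \<Longrightarrow> \<bar>j\<bar> \<le> int J \<Longrightarrow> \<bar>z2 (i, j) - z1 (i, j)\<bar> \<le> \<epsilon>" and x: "\<bar>x\<bar> \<le> R"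
    have "- \<eta> \<le> u2 x t - u1 x t" by (rule key[OF * n x])
    moreover have "- \<eta> \<le> u1 x t - u2 x t"
      by (rule key[OF *(2,1,4,3,6,5) _ x]) (use n in \<open>simp add: abs_minus_commute\<close>)
    ultimately show "\<bar>u2 x t - u1 x t\<bar> \<le> \<eta>" by linarith
  qed
qed

lemma (in obstacle_solution) unique:
  assumes v: "classical_solution (site_field \<phi> z) F v" and t: "0 \<le> t"
  shows "v x t = u x t"
proof -
  interpret v: obstacle_solution \<delta> \<phi> z F v by standard (fact bump delta F_pos adm v)+
  obtain J :: nat where J: "\<And>x r. 0 \<le> r \<Longrightarrow> r \<le> t \<Longrightarrow> \<bar>v x r\<bar> \<le> real J - 1"
    using classical_solution_bounded[OF v t] by blast
  show ?thesis
    using comparison[OF v.heat[OF t] t J, of x] v.init by (simp add: order_antisym)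
qed

lemma (in obstacle_solution) continuous_profile: "0 \<le> t \<Longrightarrow> continuous_on S (\<lambda>x. u x t)"
proof -
  assume t: "0 \<le> t"
  have c: "continuous_on (UNIV \<times> {0..}) (\<lambda>(x, t). u x t)" using sol by (simp add: classical_solution_def)
  have "continuous_on S ((\<lambda>(x, t). u x t) \<circ> (\<lambda>x. (x, t)))"
    by (intro continuous_on_compose continuous_intros continuous_on_subset[OF c]) (use t in auto)
  then show ?thesis by (simp add: o_def)
qed

section \<open>Borel dependence of the mean height on the configuration\<close>

lemma row_growth_closed: "closed (row_growth J B)"
proof -
  have "row_growth J B = (\<Inter>i. \<Inter>j\<in>{- int J..int J}. {z. z (i, j) \<le> B * (1 + \<bar>of_int i\<bar>)})"
    unfolding row_growth_def by (auto simp: abs_le_iff)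
  also have "closed \<dots>" by (intro closed_INT ballI closed_Collect_le continuous_intros) simp_all
  finally show ?thesis .
qed

text \<open>Neighbourhoods in the product topology control finitely many coordinates only; the
  growth constant common to \<open>S\<close> takes care of the others.\<close>

lemma mean_height_continuous:
  assumes bump: "bump \<delta> \<phi>" and delta: "\<delta> < 1/2" and F: "0 < F" and t: "0 \<le> t"
    and J: "F * t + 1 \<le> real J" and B: "0 \<le> B"
    and sol: "\<And>z. z \<in> S \<Longrightarrow> classical_solution (site_field \<phi> z) F (u z)"
    and adm: "\<And>z. z \<in> S \<Longrightarrow> admissible z" and S: "S \<subseteq> row_growth J B"
  shows "continuous_on S (\<lambda>z. integral {0..1} (\<lambda>x. u z x t))"
  unfolding continuous_on_def
proof (intro ballI tendstoI)
  fix z :: "int \<times> int \<Rightarrow> real" and \<eta> :: real assume z: "z \<in> S" and eta: "0 < \<eta>"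
  obtain d N where d: "0 < d" and close:
    "\<And>z1 z2 u1 u2 x. admissible z1 \<Longrightarrow> admissible z2 \<Longrightarrow> z1 \<in> row_growth J B \<Longrightarrow> z2 \<in> row_growth J B \<Longrightarrow>
      classical_solution (site_field \<phi> z1) F u1 \<Longrightarrow> classical_solution (site_field \<phi> z2) F u2 \<Longrightarrow>
      (\<And>i j. \<bar>i\<bar> \<le> N \<Longrightarrow> \<bar>j\<bar> \<le> int J \<Longrightarrow> \<bar>z2 (i, j) - z1 (i, j)\<bar> \<le> d) \<Longrightarrow>
      \<bar>x\<bar> \<le> 1 \<Longrightarrow> \<bar>u2 x t - u1 x t\<bar> \<le> \<eta> / 2"
    using site_solution_close[OF bump delta F t J B, of 1 "\<eta> / 2"] eta by (metis half_gt_zero zero_le_one)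
  have "\<forall>\<^sub>F y in at z within S. \<bar>y p - z p\<bar> < d" for p
  proof -
    have "((\<lambda>y. y p) \<longlongrightarrow> z p) (at z within S)"
      using continuous_on_subset[OF continuous_on_product_coordinates subset_UNIV, of S p] z
      unfolding continuous_on_def by blast
    then have "\<forall>\<^sub>F y in at z within S. dist (y p) (z p) < d" using d by (rule tendstoD)
    then show ?thesis by (simp add: dist_real_def)
  qed
  then have "\<forall>\<^sub>F y in at z within S. \<forall>p\<in>{-N..N} \<times> {- int J..int J}. \<bar>y p - z p\<bar> < d"
    by (intro eventually_ball_finite) auto
  moreover have "\<forall>\<^sub>F y in at z within S. y \<in> S" by (simp add: eventually_at_filter)
  ultimately show "\<forall>\<^sub>F y in at z within S.
      dist (integral {0..1} (\<lambda>x. u y x t)) (integral {0..1} (\<lambda>x. u z x t)) < \<eta>"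
  proof eventually_elim
    case (elim y)
    interpret Y: obstacle_solution \<delta> \<phi> y F "u y" by standard (fact bump delta F adm[OF elim(2)] sol[OF elim(2)])+
    interpret Z: obstacle_solution \<delta> \<phi> z F "u z" by standard (fact bump delta F adm[OF z] sol[OF z])+
    have iy: "(\<lambda>x. u y x t) integrable_on {0..1}" and iz: "(\<lambda>x. u z x t) integrable_on {0..1}"
      by (intro integrable_continuous_real Y.continuous_profile Z.continuous_profile t)+
    have near: "\<bar>y (i, j) - z (i, j)\<bar> \<le> d" if "\<bar>i\<bar> \<le> N" "\<bar>j\<bar> \<le> int J" for i j
    proof -
      have "(i, j) \<in> {-N..N} \<times> {- int J..int J}" using that by auto
      then show ?thesis using elim(1) by (blast intro: less_imp_le)
    qed
    have "\<bar>u y x t - u z x t\<bar> \<le> \<eta> / 2" if "x \<in> {0..1}" for x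
      by (rule close[OF adm[OF z] adm[OF elim(2)] _ _ sol[OF z] sol[OF elim(2)]])
         (use S z elim(2) that near in auto)
    then have "norm (integral {0..1} (\<lambda>x. u y x t - u z x t)) \<le> \<eta> / 2 * (1 - 0)"
      by (intro integral_bound continuous_intros Y.continuous_profile Z.continuous_profile t) auto
    then show ?case using eta iy iz by (simp add: dist_real_def integral_diff)
  qed
qed

text \<open>Solutions are given only for configurations that occur as samples, and the set
  \<open>E\<close> of solvable configurations is not known to be measurable. Hence \<open>G\<close>
  is built from Borel sets that agree on \<open>E\<close> with the superlevel sets of the mean
  height.\<close>

lemma mean_height_factorization:
  assumes bump: "bump \<delta> \<phi>" and delta: "\<delta> < 1/2" and F: "0 < F" and t: "0 \<le> t"
  obtains G :: "(int \<times> int \<Rightarrow> real) \<Rightarrow> real" where "G \<in> borel_measurable (Pi\<^sub>M UNIV (\<lambda>_. borel))"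
    "\<And>z. 0 \<le> G z" "\<And>z. G z \<le> F * t"
    "\<And>z u. admissible z \<Longrightarrow> classical_solution (site_field \<phi> z) F u \<Longrightarrow>
      integral {0..1} (\<lambda>x. u x t) = G z"
proof -
  define E where "E = {z. admissible z \<and> (\<exists>u. classical_solution (site_field \<phi> z) F u)}"
  define u where "u = (\<lambda>z. SOME u. classical_solution (site_field \<phi> z) F u)"
  define H where "H = (\<lambda>z. integral {0..1} (\<lambda>x. u z x t))"
  have sol: "classical_solution (site_field \<phi> z) F (u z)" if "z \<in> E" for z
    using that unfolding E_def u_def mem_Collect_eq by (elim conjE exE) (rule someI[where P = "classical_solution (site_field \<phi> z) F"])
  have HE: "integral {0..1} (\<lambda>x. v x t) = H z"
    if "admissible z" "classical_solution (site_field \<phi> z) F v" for z v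
  proof -
    have "z \<in> E" using that by (auto simp: E_def)
    interpret V: obstacle_solution \<delta> \<phi> z F v by standard (fact bump delta F that)+
    show ?thesis unfolding H_def using V.unique[OF sol[OF \<open>z \<in> E\<close>] t] by simp
  qed
  obtain J :: nat where J: "F * t + 1 \<le> real J" using real_arch_simple by blast
  have "continuous_on (E \<inter> row_growth J (real n)) H" for n :: nat
    unfolding H_def by (rule mean_height_continuous[OF bump delta F t J, of "real n"]) (auto simp: sol, auto simp: E_def)
  \<comment> \<open>Relative openness provides for every level an open set of the whole space;
    leaving \<open>E\<close> out of the intersection in \<open>Q\<close> then gives a Borel
    set.\<close>
  then have "\<exists>A. open A \<and> A \<inter> (E \<inter> row_growth J (real n)) = H -` {a<..} \<inter> (E \<inter> row_growth J (real n))" for n :: nat and a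
    unfolding continuous_on_open_invariant using open_greaterThan[of a] by presburger
  then obtain A where A: "\<And>n a. open (A n a)"
    "\<And>n a. A n a \<inter> (E \<inter> row_growth J (real n)) = H -` {a<..} \<inter> (E \<inter> row_growth J (real n))"
    by metis
  define Q where "Q = (\<lambda>a. \<Union>n. A n a \<inter> row_growth J (real n))"
  have Q_sets: "Q a \<in> sets (Pi\<^sub>M UNIV (\<lambda>_. borel))" for a
    unfolding Q_def sets_PiM_equal_borel
    by (rule sets.countable_UN) (auto intro!: sets.Int[OF borel_open[OF A(1)] borel_closed[OF row_growth_closed]])
  have Q: "z \<in> Q a \<longleftrightarrow> a < H z" if "z \<in> E" for z a
  proof
    assume "z \<in> Q a"
    then obtain n where "z \<in> A n a" "z \<in> row_growth J (real n)" by (auto simp: Q_def)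
    then have "z \<in> A n a \<inter> (E \<inter> row_growth J (real n))" using that by simp
    then show "a < H z" unfolding A(2) by simp
  next
    assume a: "a < H z"
    have "\<exists>B. z \<in> row_growth J B" using that by (simp add: E_def admissible_def)
    then obtain B where "z \<in> row_growth J B" by blast
    moreover obtain n :: nat where "B \<le> real n" using real_arch_simple by blast
    ultimately have "z \<in> row_growth J (real n)" using row_growth_mono by blast
    with a that have "z \<in> A n a \<inter> (E \<inter> row_growth J (real n))" unfolding A(2) by simp
    then show "z \<in> Q a" by (auto simp: Q_def)
  qed
  \<comment> \<open>Rational levels in the possible range of the mean height. \<open>G\<close> is
    the supremum of the exceeded levels, and the level 0 keeps it within bounds off \<open>E\<close>
    as well.\<close>
  define I where "I = \<rat> \<inter> {0..F * t}"
  have I: "countable I" "0 \<in> I" using F t by (auto simp: I_def countable_rat)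
  define G where "G = (\<lambda>z. SUP a\<in>I. if z \<in> Q a then a else 0)"
  have le: "(if z \<in> Q a then a else 0) \<le> F * t" if "a \<in> I" for a z using that F t by (auto simp: I_def)
  have bdd: "bdd_above ((\<lambda>a. if z \<in> Q a then a else 0) ` I)" for z
    using le by (intro bdd_aboveI[of _ "F * t"]) blast
  show thesis
  proof (rule that)
    have [measurable]: "Q a \<in> sets (Pi\<^sub>M UNIV (\<lambda>_. borel))" for a by (rule Q_sets)
    show "G \<in> borel_measurable (Pi\<^sub>M UNIV (\<lambda>_. borel))"
      unfolding G_def by (rule borel_measurable_cSUP[OF I(1) _ bdd]) measurable
    show "0 \<le> G z" for z unfolding G_def by (rule cSUP_upper2[OF bdd I(2)]) simp
    show "G z \<le> F * t" for z unfolding G_def using I(2) le by (intro cSUP_least) auto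
    show "integral {0..1} (\<lambda>x. v x t) = G z"
      if "admissible z" "classical_solution (site_field \<phi> z) F v" for z v
    proof -
      have zE: "z \<in> E" using that by (auto simp: E_def)
      interpret V: obstacle_solution \<delta> \<phi> z F v by standard (fact bump delta F that)+
      have int: "(\<lambda>x. v x t) integrable_on {0..1}"
        by (intro integrable_continuous_real V.continuous_profile t)
      have H: "0 \<le> H z" "H z \<le> F * t"
        unfolding HE[OF that, symmetric]
        using integral_nonneg[OF int] V.nonneg[OF t] V.le_drive[OF t]
          integral_le[OF int integrable_const_ivl[of "F * t"]]
        by auto
      have "G z = H z"
      proof (rule antisym)
        show "G z \<le> H z" unfolding G_def
          by (rule cSUP_least) (use I(2) Q[OF zE] H in auto)
        show "H z \<le> G z"
        proof (rule dense_le)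
          fix b assume b: "b < H z"
          show "b \<le> G z"
          proof (cases "b < 0")
            case True
            then show ?thesis using cSUP_upper2[OF bdd I(2), of b z] by (simp add: G_def)
          next
            case False
            obtain q where q: "q \<in> \<rat>" "b < q" "q < H z" using Rats_dense_in_real[OF b] by blast
            then have "q \<in> I" using False H by (auto simp: I_def)
            then show ?thesis unfolding G_def
              by (rule cSUP_upper2[OF bdd]) (use Q[OF zE] q in auto)
          qed
        qed
      qed
      then show ?thesis using HE[OF that] by simp
    qed
  qed
qed

section \<open>Slope change across one column\<close>

text \<open>Jensen's inequality, by integrating the tangent line of the exponential at the mean; the
  interval has length 1, so the integral of \<open>h\<close> is its mean.\<close>

lemma exp_integral_le_integral_exp:
  fixes h :: "real \<Rightarrow> real"
  assumes "continuous_on {l..l + 1} h"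
  shows "exp (c * integral {l..l + 1} h) \<le> integral {l..l + 1} (\<lambda>x. exp (c * h x))"
proof -
  let ?G = "integral {l..l + 1} h"
  let ?C = "exp (c * ?G)"
  have ih: "h integrable_on {l..l + 1}" using assms by (rule integrable_continuous_real)
  have i1: "(\<lambda>x. ?C * (1 - c * ?G) + (?C * c) * h x) integrable_on {l..l + 1}"
    by (intro integrable_continuous_real continuous_intros assms)
  have i2: "(\<lambda>x. exp (c * h x)) integrable_on {l..l + 1}"
    by (intro integrable_continuous_real continuous_intros assms)
  have "integral {l..l + 1} (\<lambda>x. ?C * (1 - c * ?G) + (?C * c) * h x) \<le> integral {l..l + 1} (\<lambda>x. exp (c * h x))"
  proof (rule integral_le[OF i1 i2])
    fix x
    have "?C * (1 + (c * h x - c * ?G)) \<le> ?C * exp (c * h x - c * ?G)"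
      by (intro mult_left_mono exp_ge_add_one_self) simp
    also have "\<dots> = exp (c * h x)" by (simp flip: exp_add)
    finally show "?C * (1 - c * ?G) + (?C * c) * h x \<le> exp (c * h x)" by (simp add: algebra_simps)
  qed
  moreover have "integral {l..l + 1} (\<lambda>x. ?C * (1 - c * ?G) + (?C * c) * h x) = ?C"
    using ih by (subst integral_add) (auto simp: algebra_simps intro!: integrable_on_mult_right)
  ultimately show ?thesis by simp
qed

lemma integral_indicator_interval_le:
  fixes lo hi :: real
  assumes "lo \<le> hi"
  shows "(\<lambda>x. if x \<in> {lo..hi} then 1 else (0::real)) integrable_on {l..l'}"
    and "integral {l..l'} (\<lambda>x. if x \<in> {lo..hi} then 1 else (0::real)) \<le> hi - lo"
proof -
  have i: "(\<lambda>x. 1::real) integrable_on {l..l'} \<inter> {lo..hi}" by (simp add: Int_atLeastAtMost integrable_const_ivl)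
  then show "(\<lambda>x. if x \<in> {lo..hi} then 1 else (0::real)) integrable_on {l..l'}"
    by (subst integrable_restrict_Int) (simp add: Int_commute)
  have "integral {l..l'} (\<lambda>x. if x \<in> {lo..hi} then 1 else (0::real)) = integral ({lo..hi} \<inter> {l..l'}) (\<lambda>x. 1::real)"
    by (rule integral_restrict_Int)
  also have "\<dots> \<le> integral {lo..hi} (\<lambda>x. 1::real)"
    by (rule integral_subset_le) (use i in \<open>auto simp: Int_commute integrable_const_ivl\<close>)
  also have "\<dots> = hi - lo" using assms by simp
  finally show "integral {l..l'} (\<lambda>x. if x \<in> {lo..hi} then 1 else (0::real)) \<le> hi - lo" .
qed

text \<open>A convex-up-to-\<open>F\<close> profile may sweep through many obstacles of one column. If the total
  change of slope, bounded by \<open>y\<close>, is small compared with the initial slope \<open>p\<close>, then each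
  obstacle is felt on a set of length \<open>O(1/\<bar>p\<bar>)\<close>; otherwise the number of obstacles met is
  \<open>O(y)\<close>. Jensen's inequality turns the averaged obstacle strength into an average of
  exponentials, so that only one-site exponential moments are needed later.\<close>

lemma cell_estimate:
  fixes v v' w h :: "real \<Rightarrow> real" and c :: "int \<Rightarrow> real"
  assumes F: "1 \<le> F" and \<theta>: "0 < \<theta>"
    and dv: "\<And>x. (v has_real_derivative v' x) (at x)"
    and dv': "\<And>x. (v' has_real_derivative w x + h x - F) (at x)"
    and w: "\<And>x. 0 \<le> w x" "continuous_on {l..l + 1} w"
    and h: "\<And>x. 0 \<le> h x" "continuous_on {l..l + 1} h" "\<And>x. x \<in> {l..l + 1} \<Longrightarrow> h x \<le> c \<lfloor>v x\<rfloor>"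
    and a: "a = \<lfloor>v l\<rfloor>" "a1 = \<lfloor>v (l + 1)\<rfloor>" and b: "b = \<lfloor>v' l\<rfloor>" "b1 = \<lfloor>v' (l + 1)\<rfloor>"
    and y: "y = of_int (b1 - b) + 1 + 2 * F"
  shows "F \<le> y" and "\<bar>of_int (a1 - a - b)\<bar> \<le> y + 2"
    and "exp (\<theta> * (v' (l + 1) - v' l - 2 * integral {l..l + 1} w)) \<le>
      exp (- \<theta> * (y - 2)) * (16 * (1 + y) / (1 + \<bar>of_int b\<bar>)) *
        (\<Sum>j | \<bar>of_int (j - a)\<bar> \<le> \<bar>of_int b\<bar> + y + 3. exp (2 * \<theta> * c j))"
proof -
  define p where "p = v' l"
  define G where "G = integral {l..l + 1} h"
  define W where "W = integral {l..l + 1} w"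
  let ?cell = "{l..l + 1}"
  have int: "w integrable_on {l..x}" "h integrable_on {l..x}" if "x \<in> ?cell" for x
    using that by (auto intro!: integrable_continuous_real intro: continuous_on_subset[OF w(2)] continuous_on_subset[OF h(2)])
  have slope: "v' x - p = integral {l..x} w + integral {l..x} h - F * (x - l)" if x: "x \<in> ?cell" for x
  proof -
    have "((\<lambda>s. w s + h s - F) has_integral v' x - v' l) {l..x}"
      using x by (intro fundamental_theorem_of_calculus)
        (auto simp: has_real_derivative_iff_has_vector_derivative[symmetric] has_field_derivative_at_within[OF dv'])
    moreover have "((\<lambda>s. w s + h s - F) has_integral integral {l..x} w + integral {l..x} h - F * (x - l)) {l..x}"
      using int[OF x] has_integral_const_real[of F l x] x
      by (intro has_integral_diff has_integral_add integrable_integral) (auto simp: mult.commute)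
    ultimately show ?thesis by (metis has_integral_unique p_def)
  qed
  have parts: "0 \<le> integral {l..x} w" "integral {l..x} w \<le> W" "0 \<le> integral {l..x} h" "integral {l..x} h \<le> G"
    if x: "x \<in> ?cell" for x
    unfolding W_def G_def using int[OF x] int[of "l + 1"] x w(1) h(1)
    by (auto intro!: integral_nonneg integral_subset_le)
  have total: "v' (l + 1) - p = W + G - F" using slope[of "l + 1"] by (simp add: W_def G_def)
  have WG: "0 \<le> W" "0 \<le> G" using parts[of l] by auto
  have b': "of_int b \<le> p" "p < of_int b + 1" "of_int b1 \<le> v' (l + 1)" "v' (l + 1) < of_int b1 + 1"
    using b by (auto simp: p_def)
  \<comment> \<open>The slope changes by \<open>W + G - F\<close>, and rounding both slopes alters
    this by less than 1; adding \<open>1 + 2 * F\<close> therefore puts \<open>y\<close> between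
    \<open>W + G + F\<close> and \<open>W + G + F + 2\<close>.\<close>
  have yWG: "W + G + F \<le> y" "y - 2 \<le> W + G + F" using total b' by (auto simp: y)
  show "F \<le> y" using yWG WG by linarith
  have dev: "\<bar>v' x - p\<bar> \<le> y" if x: "x \<in> ?cell" for x
  proof -
    have "0 \<le> F * (x - l)" "F * (x - l) \<le> F * 1" using x F by (auto intro!: mult_left_mono)
    then show ?thesis using slope[OF x] parts[OF x] yWG WG F by linarith
  qed
  have mvt: "\<exists>\<xi>\<in>?cell. v x' - v x = (x' - x) * v' \<xi>" if "x \<in> ?cell" "x' \<in> ?cell" "x \<le> x'" for x x'
  proof (cases "x = x'")
    case False
    then have "x < x'" using that by simp
    from MVT2[OF this, of v v'] dv obtain \<xi> where "x < \<xi>" "\<xi> < x'" "v x' - v x = (x' - x) * v' \<xi>" by blast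
    then show ?thesis using that by auto
  qed (use that in auto)
  have height: "\<bar>v x - v l - p * (x - l)\<bar> \<le> y" if x: "x \<in> ?cell" for x
  proof -
    obtain \<xi> where \<xi>: "\<xi> \<in> ?cell" "v x - v l = (x - l) * v' \<xi>" using mvt[of l x] x by auto
    then have "v x - v l - p * (x - l) = (x - l) * (v' \<xi> - p)" by (simp add: algebra_simps)
    then have "\<bar>v x - v l - p * (x - l)\<bar> = (x - l) * \<bar>v' \<xi> - p\<bar>" using x by (simp add: abs_mult)
    also have "\<dots> \<le> 1 * y" using dev[OF \<xi>(1)] x by (intro mult_mono) auto
    finally show ?thesis by simp
  qed
  have a': "of_int a \<le> v l" "v l < of_int a + 1" "of_int a1 \<le> v (l + 1)" "v (l + 1) < of_int a1 + 1"
    using a by auto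
  show "\<bar>of_int (a1 - a - b)\<bar> \<le> y + 2" using height[of "l + 1"] a' b' by (auto simp: abs_le_iff)
  have ybig: "1 \<le> y" using yWG WG F by linarith
  have bp: "\<bar>real_of_int b\<bar> \<le> \<bar>p\<bar> + 1" "\<bar>p\<bar> \<le> \<bar>real_of_int b\<bar> + 1"
    using b'(1,2) by (auto simp del: of_int_abs simp: abs_if split: if_splits)
  \<comment> \<open>The aim is that the profile spends at most the length \<open>m\<close> in any
    one row. If |p| < 2 y, then \<open>m\<close> is at least 1 and the whole cell will do. Otherwise
    the slope keeps modulus at least |p|/2 throughout the cell, and two points in the same row are
    at most 2/|p| apart.\<close>
  define m where "m = 16 * (1 + y) / (1 + \<bar>of_int b\<bar>)"
  have m0: "0 < m" using ybig by (auto simp: m_def intro!: divide_pos_pos)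
  have "\<exists>lo hi. lo \<le> hi \<and> hi - lo \<le> m \<and> {x \<in> ?cell. \<lfloor>v x\<rfloor> = j} \<subseteq> {lo..hi}" for j
  proof (cases "\<bar>p\<bar> < 2 * y")
    case True
    have "1 + \<bar>of_int b\<bar> \<le> 16 * (1 + y)" using True bp ybig by simp
    then have "1 \<le> m" by (simp add: m_def field_simps)
    then show ?thesis by (intro exI[of _ l] exI[of _ "l + 1"]) auto
  next
    case False
    show ?thesis
    proof (cases "{x \<in> ?cell. \<lfloor>v x\<rfloor> = j} = {}")
      case True
      then show ?thesis using m0 by (intro exI[of _ 0]) auto
    next
      case nonempty: False
      then obtain x0 where x0: "x0 \<in> ?cell" "\<lfloor>v x0\<rfloor> = j" by auto
      have p: "2 \<le> \<bar>p\<bar>" using False ybig by linarith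
      have steep: "(x' - x) * (\<bar>p\<bar> / 2) \<le> 1"
        if steep_prems: "x \<in> ?cell" "x' \<in> ?cell" "x \<le> x'" "\<lfloor>v x\<rfloor> = j" "\<lfloor>v x'\<rfloor> = j" for x x'
      proof -
        obtain \<xi> where \<xi>: "\<xi> \<in> ?cell" "v x' - v x = (x' - x) * v' \<xi>" using mvt[OF steep_prems(1-3)] by blast
        have "\<bar>p\<bar> / 2 \<le> \<bar>v' \<xi>\<bar>" using dev[OF \<xi>(1)] False by linarith
        then have "(x' - x) * (\<bar>p\<bar> / 2) \<le> (x' - x) * \<bar>v' \<xi>\<bar>" using steep_prems by (intro mult_left_mono) auto
        also have "\<dots> = \<bar>v x' - v x\<bar>" using \<xi> steep_prems by (simp add: abs_mult)
        also have "\<dots> \<le> 1" using steep_prems(4,5) by linarith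
        finally show ?thesis .
      qed
      have near: "\<bar>x - x0\<bar> \<le> 2 / \<bar>p\<bar>" if "x \<in> ?cell" "\<lfloor>v x\<rfloor> = j" for x
      proof -
        have "\<bar>x - x0\<bar> * (\<bar>p\<bar> / 2) \<le> 1"
          using steep[of x x0] steep[of x0 x] x0 that by (cases "x \<le> x0") auto
        then show ?thesis using p by (simp add: field_simps)
      qed
      have "4 * (1 + \<bar>real_of_int b\<bar>) \<le> 8 * \<bar>p\<bar>" using bp(1) p by simp
      also have "\<dots> \<le> 16 * (1 + y) * \<bar>p\<bar>" using ybig by (intro mult_right_mono) auto
      finally have "4 * (1 + \<bar>real_of_int b\<bar>) \<le> 16 * (1 + y) * \<bar>p\<bar>" .
      then have "4 / \<bar>p\<bar> \<le> m" using p by (simp add: m_def field_simps)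
      moreover have "(x0 + 2 / \<bar>p\<bar>) - (x0 - 2 / \<bar>p\<bar>) = 4 / \<bar>p\<bar>" by simp
      ultimately have "(x0 + 2 / \<bar>p\<bar>) - (x0 - 2 / \<bar>p\<bar>) \<le> m" by simp
      moreover have "{x \<in> ?cell. \<lfloor>v x\<rfloor> = j} \<subseteq> {x0 - 2 / \<bar>p\<bar>..x0 + 2 / \<bar>p\<bar>}"
        using near by (auto simp: abs_le_iff algebra_simps)
      moreover have "x0 - 2 / \<bar>p\<bar> \<le> x0 + 2 / \<bar>p\<bar>" using p by simp
      ultimately show ?thesis by blast
    qed
  qed
  then obtain lo hi where I: "\<And>j. lo j \<le> hi j" "\<And>j. hi j - lo j \<le> m"
    "\<And>j. {x \<in> ?cell. \<lfloor>v x\<rfloor> = j} \<subseteq> {lo j..hi j}" by metis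
  define J where "J = {j::int. \<bar>of_int (j - a)\<bar> \<le> \<bar>of_int b\<bar> + y + 3}"
  have finJ: "finite J"
  proof (rule finite_subset)
    show "J \<subseteq> {a - \<lceil>\<bar>of_int b\<bar> + y + 3\<rceil>..a + \<lceil>\<bar>of_int b\<bar> + y + 3\<rceil>}" unfolding J_def by (auto; linarith)
  qed simp
  have inJ: "\<lfloor>v x\<rfloor> \<in> J" if x: "x \<in> ?cell" for x
  proof -
    have "\<bar>p * (x - l)\<bar> \<le> \<bar>p\<bar> * 1" unfolding abs_mult using x by (intro mult_left_mono) auto
    then have "\<bar>v x - v l\<bar> \<le> \<bar>p\<bar> + y" using height[OF x] by linarith
    then show ?thesis unfolding J_def using a' bp by (auto simp del: of_int_abs simp: abs_le_iff) linarith+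
  qed
  define E where "E = (\<lambda>j. exp (2 * \<theta> * c j))"
  have i: "(\<lambda>x. if x \<in> {lo j..hi j} then 1 else (0::real)) integrable_on ?cell" for j
    by (rule integral_indicator_interval_le[OF I(1)])
  have "exp (2 * \<theta> * G) \<le> integral ?cell (\<lambda>x. exp (2 * \<theta> * h x))"
    unfolding G_def by (rule exp_integral_le_integral_exp[OF h(2)])
  also have "\<dots> \<le> integral ?cell (\<lambda>x. \<Sum>j\<in>J. E j * (if x \<in> {lo j..hi j} then 1 else (0::real)))"
  proof (rule integral_le)
    show "(\<lambda>x. exp (2 * \<theta> * h x)) integrable_on ?cell"
      by (intro integrable_continuous_real continuous_intros h(2))
    show "(\<lambda>x. \<Sum>j\<in>J. E j * (if x \<in> {lo j..hi j} then 1 else (0::real))) integrable_on ?cell"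
      using finJ i by (intro integrable_sum integrable_on_mult_right)
    fix x assume x: "x \<in> ?cell"
    \<comment> \<open>At \<open>x\<close> only the obstacle in row
      \<open>\<lfloor>v x\<rfloor>\<close> acts, so a single term of the sum already
      dominates.\<close>
    have "exp (2 * \<theta> * h x) \<le> E \<lfloor>v x\<rfloor> * (if x \<in> {lo \<lfloor>v x\<rfloor>..hi \<lfloor>v x\<rfloor>} then 1 else (0::real))"
      using h(3)[OF x] I(3)[of "\<lfloor>v x\<rfloor>"] x \<theta> by (auto simp: E_def)
    also have "\<dots> \<le> (\<Sum>j\<in>J. E j * (if x \<in> {lo j..hi j} then 1 else (0::real)))"
      by (rule member_le_sum[OF inJ[OF x]]) (auto simp: finJ E_def)
    finally show "exp (2 * \<theta> * h x) \<le> (\<Sum>j\<in>J. E j * (if x \<in> {lo j..hi j} then 1 else (0::real)))" .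
  qed
  also have "\<dots> = (\<Sum>j\<in>J. E j * integral ?cell (\<lambda>x. if x \<in> {lo j..hi j} then 1 else (0::real)))"
    by (subst integral_sum[OF finJ integrable_on_mult_right[OF i]]) (simp only: integral_mult_right)
  also have "\<dots> \<le> (\<Sum>j\<in>J. E j * m)"
    using order_trans[OF integral_indicator_interval_le(2)[OF I(1)] I(2)]
    by (intro sum_mono mult_left_mono) (auto simp: E_def)
  finally have G: "exp (2 * \<theta> * G) \<le> m * (\<Sum>j\<in>J. E j)" by (simp add: sum_distrib_left mult.commute)
  \<comment> \<open>The exponent is \<open>\<theta>\<close> times
    \<open>2 * G - (W + G + F)\<close>. The part with \<open>2 * G\<close> has just been bounded;
    the rest is decay in \<open>y\<close>, up to the rounding loss 2.\<close>
  have "exp (\<theta> * (v' (l + 1) - v' l - 2 * W)) = exp (- \<theta> * (W + G + F)) * exp (2 * \<theta> * G)"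
  proof -
    have "v' (l + 1) - v' l - 2 * W = G - W - F" using total by (simp add: p_def)
    then have "\<theta> * (v' (l + 1) - v' l - 2 * W) = - \<theta> * (W + G + F) + 2 * \<theta> * G"
      by (simp only:) (simp add: algebra_simps)
    then show ?thesis by (simp only: exp_add[symmetric])
  qed
  also have "\<dots> \<le> exp (- \<theta> * (y - 2)) * (m * (\<Sum>j\<in>J. E j))"
    using G yWG \<theta> by (intro mult_mono) auto
  finally show "exp (\<theta> * (v' (l + 1) - v' l - 2 * integral {l..l + 1} w)) \<le>
      exp (- \<theta> * (y - 2)) * (16 * (1 + y) / (1 + \<bar>of_int b\<bar>)) *
        (\<Sum>j | \<bar>of_int (j - a)\<bar> \<le> \<bar>of_int b\<bar> + y + 3. exp (2 * \<theta> * c j))"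
    by (simp add: W_def m_def J_def E_def mult.assoc)
qed

section \<open>Weighted lattice paths\<close>

text \<open>Partition function of a directed polymer: a path moves one column to the right per step,
  \<open>\<rho>\<close> is the deterministic weight of a step and \<open>e\<close> the random weight
  of the site it picks. The row belongs to the step and is not determined by the states, because
  Jensen's inequality leaves a sum over rows in every cell.\<close>

primrec path_sum ::
    "('s \<Rightarrow> ('s \<times> int) set) \<Rightarrow> ('s \<Rightarrow> 's \<times> int \<Rightarrow> real) \<Rightarrow> (int \<times> int \<Rightarrow> real) \<Rightarrow> nat \<Rightarrow> int \<Rightarrow> 's \<Rightarrow> real"
where
  "path_sum T \<rho> e 0 i s = 1"
| "path_sum T \<rho> e (Suc k) i s =
    (\<Sum>\<tau>\<in>T s. \<rho> s \<tau> * e (i, snd \<tau>) * path_sum T \<rho> e k (i + 1) (fst \<tau>))"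

lemma path_sum_nonneg:
  assumes "\<And>s \<tau>. \<tau> \<in> T s \<Longrightarrow> 0 \<le> \<rho> s \<tau>" "\<And>p. 0 \<le> e p"
  shows "0 \<le> path_sum T \<rho> e k i s"
  by (induction k arbitrary: i s) (auto intro!: sum_nonneg mult_nonneg_nonneg simp: assms)

text \<open>\<open>\<sigma>\<close> is one concrete sequence of states. Its one-column estimates
  multiply, and all other continuations only add non-negative terms.\<close>

lemma path_sum_lower_bound:
  assumes \<rho>: "\<And>s \<tau>. \<tau> \<in> T s \<Longrightarrow> 0 \<le> \<rho> s \<tau>" and e: "\<And>p. 0 \<le> e p" and fin: "\<And>s. finite (T s)"
    and step: "\<And>i. i0 \<le> i \<Longrightarrow> finite (J i) \<and> Pair (\<sigma> (i + 1)) ` J i \<subseteq> T (\<sigma> i) \<and>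
      exp (g i) \<le> (\<Sum>j\<in>J i. \<rho> (\<sigma> i) (\<sigma> (i + 1), j) * e (i, j))"
    and i: "i0 \<le> i"
  shows "exp (\<Sum>n<k. g (i + int n)) \<le> path_sum T \<rho> e k i (\<sigma> i)"
  using i
proof (induction k arbitrary: i)
  case (Suc k)
  note st = step[OF Suc.prems]
  let ?P = "path_sum T \<rho> e k (i + 1)"
  have "(\<Sum>n<Suc k. g (i + int n)) = g i + (\<Sum>n<k. g (i + 1 + int n))"
    by (subst sum.lessThan_Suc_shift) (simp add: algebra_simps)
  then have "exp (\<Sum>n<Suc k. g (i + int n)) = exp (g i) * exp (\<Sum>n<k. g (i + 1 + int n))"
    by (simp add: exp_add)
  also have "\<dots> \<le> (\<Sum>j\<in>J i. \<rho> (\<sigma> i) (\<sigma> (i + 1), j) * e (i, j)) * ?P (\<sigma> (i + 1))"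
    using st Suc.IH[of "i + 1"] Suc.prems path_sum_nonneg[of T \<rho> e, OF \<rho> e]
    by (intro mult_mono) (auto intro!: sum_nonneg mult_nonneg_nonneg \<rho> e)
  also have "\<dots> = (\<Sum>\<tau>\<in>Pair (\<sigma> (i + 1)) ` J i. \<rho> (\<sigma> i) \<tau> * e (i, snd \<tau>) * ?P (fst \<tau>))"
    by (subst sum.reindex) (auto simp: inj_on_def sum_distrib_right)
  also have "\<dots> \<le> path_sum T \<rho> e (Suc k) i (\<sigma> i)"
    unfolding path_sum.simps using st fin path_sum_nonneg[of T \<rho> e, OF \<rho> e]
    by (intro sum_mono2) (auto intro!: mult_nonneg_nonneg \<rho> e)
  finally show ?case .
qed simp

text \<open>The induction carries the product over the sites already picked in columns 0 to m - 1.
  They lie in different columns, so in the end independence factorises the expectation: one factor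
  \<open>\<beta>\<close> per site, and one factor \<open>r\<close> per step for the sum of the
  weights.\<close>

lemma (in prob_space) nn_integral_path_sum_le:
  fixes Y :: "int \<times> int \<Rightarrow> 'a \<Rightarrow> real"
  assumes indep: "indep_vars (\<lambda>_. borel) Y UNIV" and Y: "\<And>p \<omega>. 0 \<le> Y p \<omega>"
    and mean: "\<And>p. (\<integral>\<^sup>+\<omega>. Y p \<omega> \<partial>M) = ennreal \<beta>" and \<beta>: "0 \<le> \<beta>"
    and \<rho>: "\<And>s \<tau>. \<tau> \<in> T s \<Longrightarrow> 0 \<le> \<rho> s \<tau>"
    and r: "\<And>s. (\<Sum>\<tau>\<in>T s. \<rho> s \<tau>) \<le> r"
  shows "(\<integral>\<^sup>+\<omega>. (\<Prod>n<m. Y (int n, J n) \<omega>) * path_sum T \<rho> (\<lambda>p. Y p \<omega>) k (int m) s \<partial>M)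
    \<le> ennreal (\<beta> ^ m * (\<beta> * r) ^ k)"
proof (induction k arbitrary: m J s)
  case 0
  define K where "K = (\<lambda>n. (int n, J n)) ` {..<m}"
  have "(\<integral>\<^sup>+\<omega>. (\<Prod>n<m. Y (int n, J n) \<omega>) \<partial>M) = (\<integral>\<^sup>+\<omega>. (\<Prod>p\<in>K. ennreal (Y p \<omega>)) \<partial>M)"
    unfolding K_def by (subst prod.reindex) (auto simp: inj_on_def Y prod_ennreal intro!: nn_integral_cong)
  also have "\<dots> = (\<Prod>p\<in>K. \<integral>\<^sup>+\<omega>. ennreal (Y p \<omega>) \<partial>M)"
  proof (rule indep_vars_nn_integral)
    show "indep_vars (\<lambda>_. borel) (\<lambda>p \<omega>. ennreal (Y p \<omega>)) K"
      by (rule indep_vars_compose2[OF indep_vars_subset[OF indep subset_UNIV], where Y = "\<lambda>_. ennreal"]) simp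
  qed (auto simp: K_def)
  also have "\<dots> = ennreal (\<beta> ^ m)"
    unfolding K_def by (subst prod.reindex) (auto simp: inj_on_def mean \<beta> ennreal_power)
  finally show ?case by simp
next
  case (Suc k)
  have [measurable]: "Y p \<in> borel_measurable M" for p
    using indep unfolding indep_vars_def by blast
  have r0: "0 \<le> r" using sum_nonneg[of "T s" "\<rho> s"] \<rho> r[of s] by (meson order_trans)
  have meas [measurable]: "(\<lambda>\<omega>. path_sum T \<rho> (\<lambda>p. Y p \<omega>) k i s) \<in> borel_measurable M" for k i s
    by (induction k arbitrary: i s) auto
  let ?P = "\<lambda>\<omega>. \<Prod>n<m. Y (int n, J n) \<omega>"
  have P: "0 \<le> ?P \<omega>" for \<omega> by (intro prod_nonneg) (auto simp: Y)
  have nn: "0 \<le> path_sum T \<rho> (\<lambda>p. Y p \<omega>) k i s" for \<omega> k i s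
    by (intro path_sum_nonneg \<rho> Y)
  \<comment> \<open>The first step of the path is moved into the product: its site in column
    \<open>m\<close> becomes the next factor.\<close>
  have split: "?P \<omega> * path_sum T \<rho> (\<lambda>p. Y p \<omega>) (Suc k) (int m) s =
    (\<Sum>\<tau>\<in>T s. \<rho> s \<tau> * ((\<Prod>n<Suc m. Y (int n, (J(m := snd \<tau>)) n) \<omega>) *
      path_sum T \<rho> (\<lambda>p. Y p \<omega>) k (int (Suc m)) (fst \<tau>)))" for \<omega>
    by (simp add: sum_distrib_left algebra_simps cong: prod.cong_simp)
  have "(\<integral>\<^sup>+\<omega>. ?P \<omega> * path_sum T \<rho> (\<lambda>p. Y p \<omega>) (Suc k) (int m) s \<partial>M) =
    (\<Sum>\<tau>\<in>T s. ennreal (\<rho> s \<tau>) * (\<integral>\<^sup>+\<omega>. (\<Prod>n<Suc m. Y (int n, (J(m := snd \<tau>)) n) \<omega>) *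
      path_sum T \<rho> (\<lambda>p. Y p \<omega>) k (int (Suc m)) (fst \<tau>) \<partial>M))"
  proof -
    have *: "0 \<le> (\<Prod>n<Suc m. Y (int n, (J(m := snd \<tau>)) n) \<omega>) *
      path_sum T \<rho> (\<lambda>p. Y p \<omega>) k (int (Suc m)) (fst \<tau>)" for \<tau> \<omega>
      by (intro mult_nonneg_nonneg prod_nonneg nn) (simp add: Y)
    show ?thesis unfolding split
      by (subst sum_ennreal[symmetric])
         (use * \<rho> in \<open>auto intro!: mult_nonneg_nonneg sum.cong
           simp: nn_integral_sum nn_integral_cmult ennreal_mult simp del: prod.lessThan_Suc\<close>)
  qed
  also have "\<dots> \<le> (\<Sum>\<tau>\<in>T s. ennreal (\<rho> s \<tau>) * ennreal (\<beta> ^ Suc m * (\<beta> * r) ^ k))"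
    by (intro sum_mono mult_left_mono Suc.IH) simp
  also have "\<dots> = ennreal ((\<Sum>\<tau>\<in>T s. \<rho> s \<tau>) * (\<beta> ^ Suc m * (\<beta> * r) ^ k))"
    using \<rho> \<beta> r0 by (subst sum_distrib_right, subst sum_ennreal[symmetric])
      (auto simp: ennreal_mult intro!: mult_nonneg_nonneg)
  also have "\<dots> \<le> ennreal (r * (\<beta> ^ Suc m * (\<beta> * r) ^ k))"
    using \<beta> r0 r by (intro ennreal_leI mult_right_mono) auto
  also have "r * (\<beta> ^ Suc m * (\<beta> * r) ^ k) = \<beta> ^ m * (\<beta> * r) ^ Suc k" by simp
  finally show ?case .
qed

section \<open>Counting and weighing the steps of a path\<close>

lemma card_int_ball_le:
  assumes "0 \<le> q"
  shows "finite {j::int. \<bar>of_int (j - a)\<bar> \<le> q}" "real (card {j::int. \<bar>of_int (j - a)\<bar> \<le> q}) \<le> 2 * q + 1"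
proof -
  have sub: "{j::int. \<bar>of_int (j - a)\<bar> \<le> q} \<subseteq> {a - \<lfloor>q\<rfloor>..a + \<lfloor>q\<rfloor>}"
    by (auto simp: abs_le_iff le_floor_iff) linarith+
  then show "finite {j::int. \<bar>of_int (j - a)\<bar> \<le> q}" by (rule finite_subset) simp
  have "card {j::int. \<bar>of_int (j - a)\<bar> \<le> q} \<le> card {a - \<lfloor>q\<rfloor>..a + \<lfloor>q\<rfloor>}" by (rule card_mono[OF _ sub]) simp
  also have "\<dots> = nat (2 * \<lfloor>q\<rfloor> + 1)" by simp
  finally show "real (card {j::int. \<bar>of_int (j - a)\<bar> \<le> q}) \<le> 2 * q + 1" using assms by linarith
qed

text \<open>Comparison with the geometric series over all integers from \<open>b0\<close> on, so
  that the size of \<open>B\<close> does not enter the bound.\<close>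

lemma sum_exp_over_int_le:
  fixes B :: "int set" and \<kappa> c F :: real
  assumes B: "finite B" "\<And>b. b \<in> B \<Longrightarrow> F \<le> of_int b + c" and \<kappa>: "0 < \<kappa>"
  shows "(\<Sum>b\<in>B. exp (- \<kappa> * (of_int b + c))) \<le> exp (- \<kappa> * F) / (1 - exp (- \<kappa>))"
proof -
  define b0 where "b0 = \<lceil>F - c\<rceil>"
  define N where "N = (\<lambda>b. nat (b - b0)) ` B"
  have b0: "b0 \<le> b" if "b \<in> B" for b using B(2)[OF that] unfolding b0_def by linarith
  have "(\<Sum>b\<in>B. exp (- \<kappa> * (of_int b + c))) \<le> (\<Sum>b\<in>B. exp (- \<kappa> * F) * exp (- \<kappa>) ^ nat (b - b0))"
  proof (rule sum_mono)
    fix b assume b: "b \<in> B"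
    have "F + real (nat (b - b0)) \<le> of_int b + c" using b0[OF b] unfolding b0_def by linarith
    then have "- \<kappa> * (of_int b + c) \<le> - \<kappa> * F + real (nat (b - b0)) * (- \<kappa>)"
      using mult_left_mono[of _ _ \<kappa>] \<kappa> by (fastforce simp: algebra_simps)
    then show "exp (- \<kappa> * (of_int b + c)) \<le> exp (- \<kappa> * F) * exp (- \<kappa>) ^ nat (b - b0)"
      unfolding exp_of_nat_mult[symmetric] exp_add[symmetric] by simp
  qed
  also have "\<dots> = exp (- \<kappa> * F) * (\<Sum>n\<in>N. exp (- \<kappa>) ^ n)"
  proof -
    have "inj_on (\<lambda>b. nat (b - b0)) B"
    proof (rule inj_onI)
      fix x y assume "x \<in> B" "y \<in> B" "nat (x - b0) = nat (y - b0)"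
      then show "x = y" using b0[of x] b0[of y] by simp
    qed
    then show ?thesis unfolding N_def by (subst sum.reindex) (auto simp: sum_distrib_left)
  qed
  also have "\<dots> \<le> exp (- \<kappa> * F) * (\<Sum>n. exp (- \<kappa>) ^ n)"
    using \<kappa> B(1) by (intro mult_left_mono sum_le_suminf summable_geometric) (auto simp: N_def)
  also have "(\<Sum>n. exp (- \<kappa>) ^ n) = 1 / (1 - exp (- \<kappa>))"
    using \<kappa> by (intro suminf_geometric) simp
  finally show ?thesis by simp
qed

text \<open>The prefactor of the sum over rows in \<open>cell_estimate\<close>. Its denominator
  \<open>1 + \<bar>of_int b\<bar>\<close> reflects that a steep profile crosses each row
  quickly.\<close>

definition path_weight :: "real \<Rightarrow> real \<Rightarrow> int \<Rightarrow> real" where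
  "path_weight \<theta> y b = exp (- \<theta> * (y - 2)) * (16 * (1 + y) / (1 + \<bar>of_int b\<bar>))"

text \<open>With \<open>b\<close>, \<open>b1\<close> the rounded slopes at the two ends of a cell, this bounds \<open>W + G + F\<close> from
  above; the summand \<open>1\<close> accounts for the rounding.\<close>

definition excess :: "real \<Rightarrow> int \<Rightarrow> int \<Rightarrow> real" where
  "excess F b b1 = of_int (b1 - b) + 1 + 2 * F"

text \<open>The constraints are those that \<open>cell_estimate\<close> yields for the path of a
  solution. Confining the new state to \<open>S\<close> makes the set finite; the bound on its total
  weight will not depend on \<open>S\<close>.\<close>

definition path_steps :: "real \<Rightarrow> (int \<times> int) set \<Rightarrow> int \<times> int \<Rightarrow> ((int \<times> int) \<times> int) set" where
  "path_steps F S = (\<lambda>(a, b). {((a1, b1), j). (a1, b1) \<in> S \<and> F \<le> excess F b b1 \<and>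
    \<bar>of_int (a1 - (a + b))\<bar> \<le> excess F b b1 + 2 \<and> \<bar>of_int (j - a)\<bar> \<le> \<bar>of_int b\<bar> + excess F b b1 + 3})"

definition step_weight :: "real \<Rightarrow> real \<Rightarrow> int \<times> int \<Rightarrow> (int \<times> int) \<times> int \<Rightarrow> real" where
  "step_weight \<theta> F = (\<lambda>(a, b) ((a1, b1), j). path_weight \<theta> (excess F b b1) b)"

text \<open>Here 560 = 5 * 7 * 16, with 5 and 7 from counting heights and rows and 16 from
  \<open>path_weight\<close>; \<open>exp (2 * \<theta>)\<close> is the rounding loss. The other
  factors come from \<open>cube_le_exp\<close> and from a geometric series with ratio
  \<open>exp (- (\<theta> / 2))\<close>.\<close>

definition total_weight :: "real \<Rightarrow> real \<Rightarrow> real" where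
  "total_weight \<theta> F =
    560 * exp (2 * \<theta>) * (6 / \<theta>) ^ 3 * exp (\<theta> / 2) * (exp (- (\<theta> / 2) * F) / (1 - exp (- (\<theta> / 2))))"

text \<open>Half of the decay is spent on the cubic factor: put
  \<open>\<theta> / 6 * (1 + y)\<close> into x \<le> exp x and cube.\<close>

lemma cube_le_exp:
  fixes \<theta> y :: real
  assumes "0 < \<theta>" "0 \<le> y"
  shows "(1 + y) ^ 3 * exp (- \<theta> * y) \<le> (6 / \<theta>) ^ 3 * exp (\<theta> / 2) * exp (- (\<theta> / 2) * y)"
proof -
  have "\<theta> / 6 * (1 + y) \<le> exp (\<theta> / 6 * (1 + y))"
    using exp_ge_add_one_self[of "\<theta> / 6 * (1 + y)"] by linarith
  then have "1 + y \<le> 6 / \<theta> * exp (\<theta> / 6 * (1 + y))" using assms by (simp add: field_simps)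
  then have "(1 + y) ^ 3 \<le> (6 / \<theta> * exp (\<theta> / 6 * (1 + y))) ^ 3" using assms by (intro power_mono) auto
  also have "\<dots> = (6 / \<theta>) ^ 3 * exp (\<theta> / 2 * (1 + y))"
    unfolding power_mult_distrib exp_of_nat_mult[symmetric] by simp
  finally have "(1 + y) ^ 3 * exp (- \<theta> * y) \<le> (6 / \<theta>) ^ 3 * exp (\<theta> / 2 * (1 + y)) * exp (- \<theta> * y)"
    by (rule mult_right_mono) simp
  also have "\<dots> = (6 / \<theta>) ^ 3 * exp (\<theta> / 2) * exp (- (\<theta> / 2) * y)"
    by (simp add: mult.assoc flip: exp_add) (simp add: field_simps)
  finally show ?thesis .
qed

text \<open>A new slope with excess y admits O(1 + y) heights and O((1 + |b|)(1 + y)) rows, each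
  choice having weight O((1 + y)/(1 + |b|)) exp (-\<theta> y). The slope b cancels, and (1 + y)^3
  exp (-\<theta> y) is summable over the new slopes with y at least F. The bound is thus uniform in
  the state \<open>s\<close>.\<close>

lemma step_weight_sum_le:
  assumes S: "finite S" and F: "0 \<le> F" and \<theta>: "0 < \<theta>"
  shows "finite (path_steps F S s)" "(\<Sum>\<tau>\<in>path_steps F S s. step_weight \<theta> F s \<tau>) \<le> total_weight \<theta> F"
proof -
  obtain a b where s: "s = (a, b)" by force
  define B where "B = {b1 \<in> snd ` S. F \<le> excess F b b1}"
  define A where "A = (\<lambda>b1. {a1::int. \<bar>of_int (a1 - (a + b))\<bar> \<le> excess F b b1 + 2})"
  define J where "J = (\<lambda>b1. {j::int. \<bar>of_int (j - a)\<bar> \<le> \<bar>of_int b\<bar> + excess F b b1 + 3})"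
  define \<Omega> where "\<Omega> = (SIGMA b1:B. A b1 \<times> J b1)"
  define f where "f = (\<lambda>(b1::int, a1::int, j::int). ((a1, b1), j))"
  have finB: "finite B" using S by (simp add: B_def)
  have y0: "0 \<le> excess F b b1" if "b1 \<in> B" for b1 using that F by (simp add: B_def)
  have finA: "finite (A b1)" "real (card (A b1)) \<le> 5 * (1 + excess F b b1)" if "b1 \<in> B" for b1
    using card_int_ball_le[of "excess F b b1 + 2" "a + b"] y0[OF that] by (auto simp: A_def)
  have finJ: "finite (J b1)" "real (card (J b1)) \<le> 7 * (1 + \<bar>of_int b\<bar>) * (1 + excess F b b1)" if "b1 \<in> B" for b1
  proof -
    show "finite (J b1)" using card_int_ball_le[of "\<bar>of_int b\<bar> + excess F b b1 + 3" a] y0[OF that] by (auto simp: J_def)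
    have "real (card (J b1)) \<le> 2 * (\<bar>of_int b\<bar> + excess F b b1 + 3) + 1"
      unfolding J_def using y0[OF that] by (intro card_int_ball_le) auto
    also have "\<dots> \<le> 7 * (1 + \<bar>of_int b\<bar>) * (1 + excess F b b1)"
    proof -
      have "0 \<le> \<bar>real_of_int b\<bar> * excess F b b1" using y0[OF that] by simp
      then show ?thesis using y0[OF that] by (simp add: algebra_simps)
    qed
    finally show "real (card (J b1)) \<le> 7 * (1 + \<bar>of_int b\<bar>) * (1 + excess F b b1)" .
  qed
  have fin\<Omega>: "finite \<Omega>" unfolding \<Omega>_def using finA finJ finB by (intro finite_SigmaI finite_cartesian_product) auto
  have sub: "path_steps F S s \<subseteq> f ` \<Omega>"
    unfolding path_steps_def s f_def \<Omega>_def A_def J_def B_def by (force simp: image_iff)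
  then show "finite (path_steps F S s)" using fin\<Omega> by (rule finite_subset[OF _ finite_imageI])
  have inj: "inj_on f \<Omega>" by (auto simp: f_def inj_on_def)
  have "(\<Sum>\<tau>\<in>path_steps F S s. step_weight \<theta> F s \<tau>) \<le> (\<Sum>\<tau>\<in>f ` \<Omega>. step_weight \<theta> F s \<tau>)"
    using fin\<Omega> sub y0 by (intro sum_mono2) (auto simp: step_weight_def path_weight_def s f_def \<Omega>_def)
  also have "\<dots> = (\<Sum>\<omega>\<in>\<Omega>. path_weight \<theta> (excess F b (fst \<omega>)) b)"
    by (subst sum.reindex[OF inj]) (auto simp: step_weight_def s f_def intro!: sum.cong)
  also have "\<dots> = (\<Sum>b1\<in>B. \<Sum>\<alpha>\<in>A b1 \<times> J b1. path_weight \<theta> (excess F b b1) b)"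
    unfolding \<Omega>_def using finB finA finJ by (subst sum.Sigma) (auto simp: case_prod_unfold)
  also have "\<dots> \<le> (\<Sum>b1\<in>B. 560 * exp (2 * \<theta>) * ((6 / \<theta>) ^ 3 * exp (\<theta> / 2) * exp (- (\<theta> / 2) * excess F b b1)))"
  proof (rule sum_mono)
    fix b1 assume b1: "b1 \<in> B"
    let ?y = "excess F b b1"
    have y: "0 \<le> ?y" by (rule y0[OF b1])
    have "(\<Sum>\<alpha>\<in>A b1 \<times> J b1. path_weight \<theta> ?y b) = real (card (A b1)) * real (card (J b1)) * path_weight \<theta> ?y b"
      by (simp add: card_cartesian_product)
    also have "\<dots> \<le> (5 * (1 + ?y)) * (7 * (1 + \<bar>of_int b\<bar>) * (1 + ?y)) * path_weight \<theta> ?y b"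
      using finA[OF b1] finJ[OF b1] y by (intro mult_right_mono mult_mono) (auto simp: path_weight_def)
    also have "\<dots> = 560 * exp (2 * \<theta>) * ((1 + ?y) ^ 3 * exp (- \<theta> * ?y))"
    proof -
      have cancel: "(5 * Y) * (7 * q * Y) * (E * (16 * Y / q)) = 560 * (E * Y ^ 3)" if "0 < q" for Y q E :: real
        using that by (simp add: field_simps power3_eq_cube)
      have "exp (- \<theta> * (?y - 2)) = exp (2 * \<theta>) * exp (- \<theta> * ?y)" by (simp add: algebra_simps flip: exp_add)
      then show ?thesis unfolding path_weight_def by (subst cancel) auto
    qed
    also have "\<dots> \<le> 560 * exp (2 * \<theta>) * ((6 / \<theta>) ^ 3 * exp (\<theta> / 2) * exp (- (\<theta> / 2) * ?y))"
      by (intro mult_left_mono cube_le_exp \<theta> y) simp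
    finally show "(\<Sum>\<alpha>\<in>A b1 \<times> J b1. path_weight \<theta> ?y b) \<le>
      560 * exp (2 * \<theta>) * ((6 / \<theta>) ^ 3 * exp (\<theta> / 2) * exp (- (\<theta> / 2) * ?y))" .
  qed
  also have "\<dots> = 560 * exp (2 * \<theta>) * (6 / \<theta>) ^ 3 * exp (\<theta> / 2) *
      (\<Sum>b1\<in>B. exp (- (\<theta> / 2) * (of_int b1 + (1 + 2 * F - of_int b))))"
    by (simp add: sum_distrib_left excess_def algebra_simps)
  also have "\<dots> \<le> total_weight \<theta> F"
    unfolding total_weight_def
    by (intro mult_left_mono sum_exp_over_int_le finB) (use \<theta> in \<open>auto simp: B_def excess_def\<close>)
  finally show "(\<Sum>\<tau>\<in>path_steps F S s. step_weight \<theta> F s \<tau>) \<le> total_weight \<theta> F" .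
qed

text \<open>The threshold for the drive arises here, from \<open>\<theta>\<close> and
  \<open>\<beta>\<close> alone.\<close>

lemma total_weight_small:
  assumes "0 < \<theta>" "0 \<le> \<beta>"
  obtains F0 where "1 \<le> F0" "\<And>F. F0 \<le> F \<Longrightarrow> \<beta> * total_weight \<theta> F \<le> exp (- \<theta>)"
proof -
  define C where "C = \<beta> * (560 * exp (2 * \<theta>) * (6 / \<theta>) ^ 3 * exp (\<theta> / 2) / (1 - exp (- (\<theta> / 2))))"
  have eq: "\<beta> * total_weight \<theta> F = C * exp (- (\<theta> / 2) * F)" for F by (simp add: total_weight_def C_def)
  have "filterlim (\<lambda>F. \<theta> / 2 * F) at_top at_top"
    using assms by (intro filterlim_tendsto_pos_mult_at_top[OF tendsto_const]) (auto intro: filterlim_ident)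
  then have "((\<lambda>F. exp (- (\<theta> / 2 * F))) \<longlongrightarrow> 0) at_top"
    by (intro filterlim_compose[OF exp_at_bot]) (simp add: filterlim_uminus_at_bot)
  then have "((\<lambda>F. C * exp (- (\<theta> / 2) * F)) \<longlongrightarrow> C * 0) at_top" by (intro tendsto_mult tendsto_const) simp
  then have "\<forall>\<^sub>F F in at_top. C * exp (- (\<theta> / 2) * F) < exp (- \<theta>)" by (intro order_tendstoD(2)) auto
  then obtain F1 where "\<And>F. F1 \<le> F \<Longrightarrow> C * exp (- (\<theta> / 2) * F) < exp (- \<theta>)"
    by (auto simp: eventually_at_top_linorder)
  then show thesis by (intro that[of "max 1 F1"]) (auto simp: eq intro: less_imp_le)
qed

section \<open>The path of a solution\<close>

text \<open>On either side, within distance 1, the mean value theorem supplies a slope of modulus at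
  most \<open>H\<close>; and from left to right the slope falls by at most \<open>F\<close> over
  such a distance.\<close>

lemma slope_bound:
  fixes v v' v'' :: "real \<Rightarrow> real"
  assumes dv: "\<And>x. (v has_real_derivative v' x) (at x)"
    and dv': "\<And>x. (v' has_real_derivative v'' x) (at x)"
    and v'': "\<And>x. - F \<le> v'' x" and v: "\<And>x. 0 \<le> v x" "\<And>x. v x \<le> H" and F: "0 \<le> F"
  shows "\<bar>v' x\<bar> \<le> H + F"
proof -
  have lower: "v' x - F \<le> v' x'" if less: "x < x'" "x' \<le> x + 1" for x x'
  proof -
    obtain \<zeta> where \<zeta>: "v' x' - v' x = (x' - x) * v'' \<zeta>" using MVT2[OF less(1), of v' v''] dv' by blast
    have "(x' - x) * - F \<le> (x' - x) * v'' \<zeta>" using less v'' by (intro mult_left_mono) auto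
    moreover have "(x' - x) * F \<le> 1 * F" using less F by (intro mult_right_mono) auto
    ultimately show ?thesis using \<zeta> by simp
  qed
  obtain \<xi> where \<xi>: "x < \<xi>" "\<xi> < x + 1" "v (x + 1) - v x = v' \<xi>"
    using MVT2[of x "x + 1" v v'] dv by auto
  obtain \<eta> where \<eta>: "x - 1 < \<eta>" "\<eta> < x" "v x - v (x - 1) = v' \<eta>"
    using MVT2[of "x - 1" x v v'] dv by auto
  show ?thesis
    using lower[of x \<xi>] lower[of \<eta> x] \<xi> \<eta> v(1)[of x] v(2)[of x] v(1)[of "x + 1"] v(2)[of "x + 1"]
      v(1)[of "x - 1"] v(2)[of "x - 1"] by linarith
qed

lemma integral_combine_unit_intervals:
  fixes f :: "real \<Rightarrow> real"
  assumes "continuous_on UNIV f"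
  shows "(\<Sum>n<k. integral {l + real n..l + real n + 1} f) = integral {l..l + real k} f"
proof (induction k)
  case (Suc k)
  have "integral {l..l + real k} f + integral {l + real k..l + real (Suc k)} f = integral {l..l + real (Suc k)} f"
    by (rule Henstock_Kurzweil_Integration.integral_combine)
       (auto intro: integrable_continuous_real continuous_on_subset[OF assms])
  with Suc show ?case by (simp add: algebra_simps)
qed simp

context obstacle_solution
begin

text \<open>Using \<open>deriv\<close> makes the time derivative one fixed function instead of a
  witness obtained anew in each proof; the two agree at positive times.\<close>

definition rate :: "real \<Rightarrow> real \<Rightarrow> real" where
  "rate t x = deriv (\<lambda>s. u x s) t"

lemma profile:
  assumes t: "0 < t"
  obtains v' where "\<And>x. ((\<lambda>x. u x t) has_real_derivative v' x) (at x)"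
    "\<And>x. (v' has_real_derivative rate t x + site_field \<phi> z x (u x t) - F) (at x)"
    "continuous_on UNIV (\<lambda>x. site_field \<phi> z x (u x t))"
proof -
  from sol obtain ut ux uxx where c:
    "continuous_on (UNIV \<times> {0<..}) (\<lambda>(x, t). ut x t)" "continuous_on (UNIV \<times> {0<..}) (\<lambda>(x, t). uxx x t)"
    and d: "\<And>x t. 0 < t \<Longrightarrow> ((\<lambda>s. u x s) has_real_derivative ut x t) (at t)"
    "\<And>x t. 0 < t \<Longrightarrow> ((\<lambda>y. u y t) has_real_derivative ux x t) (at x)"
    "\<And>x t. 0 < t \<Longrightarrow> ((\<lambda>y. ux y t) has_real_derivative uxx x t) (at x)"
    "\<And>x t. 0 < t \<Longrightarrow> ut x t = uxx x t - site_field \<phi> z x (u x t) + F"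
    unfolding classical_solution_def by blast
  have rate: "rate t x = ut x t" for x unfolding rate_def using d(1)[OF t] by (rule DERIV_imp_deriv)
  have slice: "continuous_on UNIV (\<lambda>x. f x t)" if "continuous_on (UNIV \<times> {0<..}) (\<lambda>(x, t). f x t)" for f :: "real \<Rightarrow> real \<Rightarrow> real"
  proof -
    have "continuous_on UNIV ((\<lambda>(x, t). f x t) \<circ> (\<lambda>x. (x, t)))"
      by (intro continuous_on_compose continuous_intros continuous_on_subset[OF that]) (use t in auto)
    then show ?thesis by (simp add: o_def)
  qed
  \<comment> \<open>Continuity of the obstacle term along the profile is read off from the
    equation.\<close>
  have "site_field \<phi> z x (u x t) = uxx x t - ut x t + F" for x using d(4)[OF t, of x] by simp
  then have "continuous_on UNIV (\<lambda>x. site_field \<phi> z x (u x t))"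
    using slice[OF c(1)] slice[OF c(2)] by (simp add: continuous_intros)
  moreover have "((\<lambda>y. ux y t) has_real_derivative rate t x + site_field \<phi> z x (u x t) - F) (at x)" for x
    using d(3)[OF t, of x] d(4)[OF t, of x] by (simp add: rate)
  ultimately show thesis using that[of "\<lambda>x. ux x t"] d(2)[OF t] by blast
qed

lemma rate:
  assumes t: "0 < t"
  shows "((\<lambda>s. u x s) has_real_derivative rate t x) (at t)" "0 \<le> rate t x"
    and "continuous_on UNIV (rate t)"
    and "((\<lambda>s. integral {a..b} (\<lambda>x. u x s)) has_real_derivative integral {a..b} (rate t)) (at t)"
proof -
  from sol obtain ut where c: "continuous_on (UNIV \<times> {0<..}) (\<lambda>(x, t). ut x t)"
    and d: "\<And>x t. 0 < t \<Longrightarrow> ((\<lambda>s. u x s) has_real_derivative ut x t) (at t)"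
    unfolding classical_solution_def by blast
  have rate: "rate s x = ut x s" if "0 < s" for s x
    unfolding rate_def using d[OF that] by (rule DERIV_imp_deriv)
  show D: "((\<lambda>s. u x s) has_real_derivative rate t x) (at t)" using d[OF t, of x] rate[OF t] by simp
  have "continuous_on UNIV ((\<lambda>(x, t). ut x t) \<circ> (\<lambda>x. (x, t)))"
    by (intro continuous_on_compose continuous_intros continuous_on_subset[OF c]) (use t in auto)
  then show "continuous_on UNIV (rate t)" using rate[OF t] by (simp add: o_def fun_eq_iff[symmetric] cong: continuous_on_cong)
  show "0 \<le> rate t x"
  proof (rule ccontr)
    assume "\<not> 0 \<le> rate t x"
    then obtain e where "0 < e" "\<And>h. 0 < h \<Longrightarrow> h < e \<Longrightarrow> u x (t + h) < u x t"
      using DERIV_neg_dec_right[OF D] by auto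
    then show False using mono_time[of t "t + e / 2" x] t by (auto dest: spec[of _ "e/2"] simp: not_less[symmetric])
  qed
  have "((\<lambda>s. integral (cbox a b) (\<lambda>x. u x s)) has_field_derivative integral (cbox a b) (ut' t)) (at t within {0<..})"
    if "ut' = (\<lambda>t x. ut x t)" for ut'
  proof (rule leibniz_rule_field_derivative)
    show "((\<lambda>s. u x s) has_field_derivative ut' s x) (at s within {0<..})" if "s \<in> {0<..}" for s x
      using d[of s x] that \<open>ut' = _\<close> by (auto intro: has_field_derivative_at_within)
    show "(\<lambda>x. u x s) integrable_on cbox a b" if "s \<in> {0<..}" for s
      using that continuous_profile[of s "{a..b}"] by (auto intro!: integrable_continuous_real)
    have "continuous_on ({0<..} \<times> cbox a b) ((\<lambda>(x, t). ut x t) \<circ> (\<lambda>(s, x). (x, s)))"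
      by (intro continuous_on_compose) (auto simp: case_prod_unfold intro!: continuous_intros continuous_on_subset[OF c, unfolded case_prod_unfold])
    then show "continuous_on ({0<..} \<times> cbox a b) (\<lambda>(s, x). ut' s x)"
      using that by (simp add: o_def case_prod_unfold)
  qed (use t in auto)
  from this[OF refl] show "((\<lambda>s. integral {a..b} (\<lambda>x. u x s)) has_real_derivative integral {a..b} (rate t)) (at t)"
    using t rate[OF t] unfolding cbox_interval by (simp add: at_within_open[of t "{0<..}"] cong: integral_cong)
qed

text \<open>The rounded heights and slopes of the solution form one of the paths that are summed.
  Along it the slope changes telescope to a boundary term of modulus at most
  \<open>2 * (F * t + F)\<close>. The initial state depends on the configuration, hence the sum over
  all of \<open>S\<close>.\<close>

lemma path_sum_ge:
  assumes t: "0 < t" and F: "1 \<le> F" and \<theta>: "0 < \<theta>"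
    and S: "S = {0..\<lfloor>F * t\<rfloor>} \<times> {- \<lceil>F * t + F\<rceil>..\<lceil>F * t + F\<rceil>}"
  shows "exp (\<theta> * (- 2 * (F * t + F) - 2 * (\<Sum>n<Suc k. integral {real n - 1..real n} (rate t))))
    \<le> (\<Sum>s\<in>S. path_sum (path_steps F S) (step_weight \<theta> F) (\<lambda>p. exp (2 * \<theta> * z p)) k 0 s)"
proof -
  define P where "P = F * t + F"
  obtain v' where v': "\<And>x. ((\<lambda>x. u x t) has_real_derivative v' x) (at x)"
    "\<And>x. (v' has_real_derivative rate t x + site_field \<phi> z x (u x t) - F) (at x)"
    and ch: "continuous_on UNIV (\<lambda>x. site_field \<phi> z x (u x t))"
    using profile[OF t] by blast
  have h0: "0 \<le> site_field \<phi> z x y" for x y by (rule site_field_nonneg[OF bump admissible_nonneg[OF adm]])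
  have slope: "\<bar>v' x\<bar> \<le> P" for x
    unfolding P_def
    by (rule slope_bound[OF v']) (use rate(2)[OF t] h0 nonneg le_drive t F in \<open>auto simp: add_nonneg_nonneg\<close>)
  \<comment> \<open>Cells end halfway between columns, where the field vanishes, so that cell
    \<open>i\<close> sees column \<open>i\<close> only.\<close>
  define l where "l = (\<lambda>i::int. real_of_int i - 1/2)"
  have l1: "l i + 1 = l (i + 1)" for i by (simp add: l_def)
  define \<sigma> where "\<sigma> = (\<lambda>i. (\<lfloor>u (l i) t\<rfloor>, \<lfloor>v' (l i)\<rfloor>))"
  define W where "W = (\<lambda>i. integral {l i..l i + 1} (rate t))"
  have \<sigma>S: "\<sigma> i \<in> S" for i
  proof -
    have "0 \<le> \<lfloor>u (l i) t\<rfloor>" using nonneg[of t "l i"] t by simp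
    moreover have "\<lfloor>u (l i) t\<rfloor> \<le> \<lfloor>F * t\<rfloor>" using le_drive[of t "l i"] t by (intro floor_mono) auto
    moreover have "- \<lceil>P\<rceil> \<le> \<lfloor>v' (l i)\<rfloor>" "\<lfloor>v' (l i)\<rfloor> \<le> \<lceil>P\<rceil>" using slope[of "l i"] by linarith+
    ultimately show ?thesis by (simp add: S \<sigma>_def P_def)
  qed
  have finS: "finite S" by (simp add: S)
  have w0: "0 \<le> step_weight \<theta> F s \<tau>" if "\<tau> \<in> path_steps F S s" for s \<tau>
    using that F by (auto simp: step_weight_def path_weight_def path_steps_def split: prod.splits)
  have path: "exp (\<Sum>n<k. \<theta> * (v' (l (0 + int n + 1)) - v' (l (0 + int n)) - 2 * W (0 + int n)))
    \<le> path_sum (path_steps F S) (step_weight \<theta> F) (\<lambda>p. exp (2 * \<theta> * z p)) k 0 (\<sigma> 0)"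
  proof (rule path_sum_lower_bound[where i0 = 0 and g = "\<lambda>i. \<theta> * (v' (l (i + 1)) - v' (l i) - 2 * W i)"
        and J = "\<lambda>i. {j. \<bar>of_int (j - fst (\<sigma> i))\<bar> \<le> \<bar>of_int (snd (\<sigma> i))\<bar> + excess F (snd (\<sigma> i)) (snd (\<sigma> (i + 1))) + 3}"])
    show "finite (path_steps F S s)" for s by (rule step_weight_sum_le(1)[OF finS _ \<theta>]) (use F in simp)
    fix i :: int
    obtain a b where ab: "\<sigma> i = (a, b)" by force
    obtain a1 b1 where ab1: "\<sigma> (i + 1) = (a1, b1)" by force
    have hc: "site_field \<phi> z x (u x t) \<le> z (i, \<lfloor>u x t\<rfloor>)" if x: "x \<in> {l i..l i + 1}" for x
    proof (cases "x = l i + 1")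
      \<comment> \<open>At the right end rounding already gives column \<open>i + 1\<close>, but the
        field is 0 there because \<delta> < 1/2.\<close>
      case True
      then have "\<lfloor>x + 1/2\<rfloor> = i + 1" unfolding l_def by linarith
      then have "site_field \<phi> z x (u x t) = 0"
        unfolding site_field_def using bump_eq_0[OF bump, of "x - \<lfloor>x + 1/2\<rfloor>"] True delta
        by (auto simp: l_def)
      then show ?thesis using admissible_nonneg[OF adm] by simp
    next
      case False
      then have "\<lfloor>x + 1/2\<rfloor> = i" using x unfolding l_def by (auto intro!: floor_unique)
      then show ?thesis using site_field_le[of \<delta> \<phi> z x "u x t", OF bump admissible_nonneg[OF adm]] by simp
    qed
    note cell = cell_estimate[where l = "l i" and c = "\<lambda>j. z (i, j)" and a = a and ?a1.0 = a1 and b = b and ?b1.0 = b1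
        and y = "excess F b b1", OF F \<theta> v'(1) v'(2) rate(2)[OF t] continuous_on_subset[OF rate(3)[OF t] subset_UNIV] h0
        continuous_on_subset[OF ch subset_UNIV] hc]
    have eqs: "a = \<lfloor>u (l i) t\<rfloor>" "a1 = \<lfloor>u (l i + 1) t\<rfloor>" "b = \<lfloor>v' (l i)\<rfloor>" "b1 = \<lfloor>v' (l i + 1)\<rfloor>"
      "excess F b b1 = of_int (b1 - b) + 1 + 2 * F"
      using ab ab1 by (auto simp: \<sigma>_def l1 excess_def)
    have cellx: "F \<le> excess F b b1" "\<bar>of_int (a1 - a - b)\<bar> \<le> excess F b b1 + 2"
      "exp (\<theta> * (v' (l i + 1) - v' (l i) - 2 * integral {l i..l i + 1} (rate t))) \<le>
        exp (- \<theta> * (excess F b b1 - 2)) * (16 * (1 + excess F b b1) / (1 + \<bar>of_int b\<bar>)) *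
        (\<Sum>j | \<bar>of_int (j - a)\<bar> \<le> \<bar>of_int b\<bar> + excess F b b1 + 3. exp (2 * \<theta> * z (i, j)))"
      by (rule cell[OF _ eqs]; simp only:)+
    show "finite {j. \<bar>of_int (j - fst (\<sigma> i))\<bar> \<le> \<bar>of_int (snd (\<sigma> i))\<bar> + excess F (snd (\<sigma> i)) (snd (\<sigma> (i + 1))) + 3} \<and>
      Pair (\<sigma> (i + 1)) ` {j. \<bar>of_int (j - fst (\<sigma> i))\<bar> \<le> \<bar>of_int (snd (\<sigma> i))\<bar> + excess F (snd (\<sigma> i)) (snd (\<sigma> (i + 1))) + 3}
        \<subseteq> path_steps F S (\<sigma> i) \<and>
      exp (\<theta> * (v' (l (i + 1)) - v' (l i) - 2 * W i)) \<le>
        (\<Sum>j | \<bar>of_int (j - fst (\<sigma> i))\<bar> \<le> \<bar>of_int (snd (\<sigma> i))\<bar> + excess F (snd (\<sigma> i)) (snd (\<sigma> (i + 1))) + 3.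
          step_weight \<theta> F (\<sigma> i) (\<sigma> (i + 1), j) * exp (2 * \<theta> * z (i, j)))"
    proof (intro conjI)
      show "finite {j. \<bar>of_int (j - fst (\<sigma> i))\<bar> \<le> \<bar>of_int (snd (\<sigma> i))\<bar> + excess F (snd (\<sigma> i)) (snd (\<sigma> (i + 1))) + 3}"
        by (rule card_int_ball_le) (use cellx(1) F in \<open>simp add: ab ab1\<close>)
      show "Pair (\<sigma> (i + 1)) ` {j. \<bar>of_int (j - fst (\<sigma> i))\<bar> \<le> \<bar>of_int (snd (\<sigma> i))\<bar> + excess F (snd (\<sigma> i)) (snd (\<sigma> (i + 1))) + 3}
        \<subseteq> path_steps F S (\<sigma> i)"
        using cellx(1,2) \<sigma>S[of "i + 1"] by (auto simp: ab ab1 path_steps_def diff_diff_eq)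
      show "exp (\<theta> * (v' (l (i + 1)) - v' (l i) - 2 * W i)) \<le>
        (\<Sum>j | \<bar>of_int (j - fst (\<sigma> i))\<bar> \<le> \<bar>of_int (snd (\<sigma> i))\<bar> + excess F (snd (\<sigma> i)) (snd (\<sigma> (i + 1))) + 3.
          step_weight \<theta> F (\<sigma> i) (\<sigma> (i + 1), j) * exp (2 * \<theta> * z (i, j)))"
        using cellx(3) by (simp add: ab ab1 step_weight_def path_weight_def sum_distrib_left W_def l1)
    qed
  qed (use w0 in auto)
  have "(\<Sum>n<k. \<theta> * (v' (l (0 + int n + 1)) - v' (l (0 + int n)) - 2 * W (0 + int n)))
    = \<theta> * ((\<Sum>n<k. v' (l (int (Suc n))) - v' (l (int n))) - 2 * (\<Sum>n<k. W (int n)))"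
    by (simp add: sum_distrib_left sum_subtractf right_diff_distrib add.commute mult.left_commute)
  also have "(\<Sum>n<k. v' (l (int (Suc n))) - v' (l (int n))) = v' (l (int k)) - v' (l 0)"
    using sum_lessThan_telescope[of "\<lambda>n. v' (l (int n))" k] by simp
  also have "\<theta> * ((v' (l (int k)) - v' (l 0)) - 2 * (\<Sum>n<k. W (int n))) \<ge>
    \<theta> * (- 2 * P - 2 * (\<Sum>n<Suc k. integral {real n - 1..real n} (rate t)))"
  proof -
    \<comment> \<open>The mean height belongs to intervals between integers. The \<open>k\<close>
      cells between half-integers fit into \<open>Suc k\<close> of these, and \<open>rate\<close> is
      non-negative.\<close>
    have "(\<Sum>n<k. W (int n)) = integral {- 1/2..- 1/2 + real k} (rate t)"
      using integral_combine_unit_intervals[OF rate(3)[OF t], of "- 1/2" k] by (simp add: W_def l_def algebra_simps)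
    also have "\<dots> \<le> integral {- 1..- 1 + real (Suc k)} (rate t)"
      using rate(2,3)[OF t] by (intro integral_subset_le integrable_continuous_real)
        (auto intro: continuous_on_subset)
    also have "\<dots> = (\<Sum>n<Suc k. integral {real n - 1..real n} (rate t))"
      using integral_combine_unit_intervals[OF rate(3)[OF t], of "- 1" "Suc k"]
      by (simp add: algebra_simps del: sum.lessThan_Suc)
    finally have "(\<Sum>n<k. W (int n)) \<le> (\<Sum>n<Suc k. integral {real n - 1..real n} (rate t))" .
    moreover have "- 2 * P \<le> v' (l (int k)) - v' (l 0)" using slope[of "l (int k)"] slope[of "l 0"] by linarith
    ultimately show ?thesis using \<theta> by (intro mult_left_mono) auto
  qed
  finally have "exp (\<theta> * (- 2 * P - 2 * (\<Sum>n<Suc k. integral {real n - 1..real n} (rate t)))) \<le>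
    exp (\<Sum>n<k. \<theta> * (v' (l (0 + int n + 1)) - v' (l (0 + int n)) - 2 * W (0 + int n)))" by simp
  also note path
  also have "path_sum (path_steps F S) (step_weight \<theta> F) (\<lambda>p. exp (2 * \<theta> * z p)) k 0 (\<sigma> 0) \<le>
    (\<Sum>s\<in>S. path_sum (path_steps F S) (step_weight \<theta> F) (\<lambda>p. exp (2 * \<theta> * z p)) k 0 s)"
    using \<sigma>S finS w0 by (intro member_le_sum path_sum_nonneg) auto
  finally show ?thesis by (simp add: P_def)
qed

text \<open>Together with uniqueness this is the source of stationarity: translating the
  configuration by whole columns translates the solution.\<close>

lemma shifted: "obstacle_solution \<delta> \<phi> (\<lambda>(i, j). z (i + k, j)) F (\<lambda>x t. u (x + of_int k) t)"
proof
  show "admissible (\<lambda>(i, j). z (i + k, j))"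
    unfolding admissible_def
  proof (intro conjI allI)
    show "0 \<le> (case p of (i, j) \<Rightarrow> z (i + k, j))" for p using admissible_nonneg[OF adm] by (simp split: prod.split)
    fix J
    have "\<exists>B. z \<in> row_growth J B" using adm by (simp add: admissible_def)
    then obtain B where "z \<in> row_growth J B" by blast
    then have B: "z \<in> row_growth J \<bar>B\<bar>" by (rule subsetD[OF row_growth_mono, rotated]) simp
    have "z (i + k, j) \<le> (\<bar>B\<bar> * (1 + \<bar>of_int k\<bar>)) * (1 + \<bar>of_int i\<bar>)" if j: "\<bar>j\<bar> \<le> int J" for i j
    proof -
      have "z (i + k, j) \<le> \<bar>B\<bar> * (1 + \<bar>of_int (i + k)\<bar>)" using B j unfolding row_growth_def by blast
      also have "\<dots> \<le> \<bar>B\<bar> * ((1 + \<bar>of_int k\<bar>) * (1 + \<bar>of_int i\<bar>))"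
      proof (rule mult_left_mono)
        have "(1 + \<bar>real_of_int k\<bar>) * (1 + \<bar>of_int i\<bar>) = 1 + \<bar>of_int k\<bar> + \<bar>of_int i\<bar> + \<bar>of_int k\<bar> * \<bar>of_int i\<bar>"
          by (simp add: algebra_simps)
        moreover have "0 \<le> \<bar>real_of_int k\<bar> * \<bar>of_int i\<bar>" by (intro mult_nonneg_nonneg abs_ge_zero)
        ultimately show "1 + \<bar>real_of_int (i + k)\<bar> \<le> (1 + \<bar>of_int k\<bar>) * (1 + \<bar>of_int i\<bar>)"
          using abs_triangle_ineq[of "real_of_int i" "real_of_int k"] unfolding of_int_add by linarith
      qed simp
      finally show ?thesis by (simp add: mult.assoc)
    qed
    then show "\<exists>B. (\<lambda>(i, j). z (i + k, j)) \<in> row_growth J B" unfolding row_growth_def by auto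
  qed
  show "classical_solution (site_field \<phi> (\<lambda>(i, j). z (i + k, j))) F (\<lambda>x t. u (x + real_of_int k) t)"
  proof -
    let ?k = "real_of_int k"
    from sol obtain ut ux uxx where c: "continuous_on (UNIV \<times> {0..}) (\<lambda>(x, t). u x t)"
      "continuous_on (UNIV \<times> {0<..}) (\<lambda>(x, t). ut x t)" "continuous_on (UNIV \<times> {0<..}) (\<lambda>(x, t). ux x t)"
      "continuous_on (UNIV \<times> {0<..}) (\<lambda>(x, t). uxx x t)"
      and d: "\<And>x t. 0 < t \<Longrightarrow> ((\<lambda>s. u x s) has_real_derivative ut x t) (at t)"
      "\<And>x t. 0 < t \<Longrightarrow> ((\<lambda>y. u y t) has_real_derivative ux x t) (at x)"
      "\<And>x t. 0 < t \<Longrightarrow> ((\<lambda>y. ux y t) has_real_derivative uxx x t) (at x)"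
      "\<And>x t. 0 < t \<Longrightarrow> ut x t = uxx x t - site_field \<phi> z x (u x t) + F"
      and bd: "\<And>T. 0 \<le> T \<Longrightarrow> bounded ((\<lambda>(x, t). u x t) ` (UNIV \<times> {0..T}))"
      unfolding classical_solution_def by blast
    have sh: "continuous_on (UNIV \<times> A) (\<lambda>(x, t). f (x + ?k) t)"
      if "continuous_on (UNIV \<times> A) (\<lambda>(x, t). f x t)" for f :: "real \<Rightarrow> real \<Rightarrow> real" and A :: "real set"
    proof -
      have "continuous_on (UNIV \<times> A) (\<lambda>(x, t). (x + ?k, t))"
        by (auto simp: case_prod_unfold intro!: continuous_intros)
      then have "continuous_on (UNIV \<times> A) ((\<lambda>(x, t). f x t) \<circ> (\<lambda>(x, t). (x + ?k, t)))"
        by (rule continuous_on_compose) (auto intro: continuous_on_subset[OF that])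
      then show ?thesis by (simp add: case_prod_unfold o_def)
    qed
    have bd': "bounded ((\<lambda>(x, t). u (x + ?k) t) ` (UNIV \<times> {0..T}))" if "0 \<le> T" for T
      by (rule bounded_subset[OF bd[OF that]]) (auto simp: image_iff)
    have "((\<lambda>y. u (y + ?k) t) has_real_derivative ux (x + ?k) t) (at x)"
      "((\<lambda>y. ux (y + ?k) t) has_real_derivative uxx (x + ?k) t) (at x)" if "0 < t" for x t
      using d(2)[OF that, of "x + ?k"] d(3)[OF that, of "x + ?k"] by (simp_all add: DERIV_shift)
    then have der: "\<forall>x. \<forall>t>0.
        ((\<lambda>s. u (x + ?k) s) has_real_derivative ut (x + ?k) t) (at t) \<and>
        ((\<lambda>y. u (y + ?k) t) has_real_derivative ux (x + ?k) t) (at x) \<and>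
        ((\<lambda>y. ux (y + ?k) t) has_real_derivative uxx (x + ?k) t) (at x) \<and>
        ut (x + ?k) t = uxx (x + ?k) t - site_field \<phi> (\<lambda>(i, j). z (i + k, j)) x (u (x + ?k) t) + F"
      using d(1) d(4) by (simp add: site_field_shift[symmetric])
    show ?thesis unfolding classical_solution_def
    proof (rule conjI[OF _ conjI], goal_cases)
      case 2
      show ?case
        by (rule exI[of _ "\<lambda>x t. ut (x + ?k) t"], rule exI[of _ "\<lambda>x t. ux (x + ?k) t"],
            rule exI[of _ "\<lambda>x t. uxx (x + ?k) t"]) (intro conjI sh c der)
    next
      case 3
      show ?case using init bd' by simp
    qed (fact sh[OF c(1)])
  qed
qed (fact bump delta F_pos)+

end

section \<open>Random obstacles\<close>

text \<open>Neither continuity nor differentiability of \<open>g\<close> is at hand, and good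
  quotients are known only along some arbitrarily large \<open>n\<close>. Consider the supremum of
  the points at which the linear bound holds: monotonicity carries the bound to the supremum, and
  before \<open>t\<close> a good quotient there would push it further.\<close>

lemma diff_quotient_lower_bound:
  fixes g :: "real \<Rightarrow> real"
  assumes mono: "\<And>s t. 0 < s \<Longrightarrow> s \<le> t \<Longrightarrow> g s \<le> g t"
    and quot: "\<And>t N. 0 < t \<Longrightarrow> \<exists>n::nat. N \<le> n \<and> 0 < n \<and> c \<le> real n * (g (t + 1 / real n) - g t)"
    and s: "0 < s" "s \<le> t"
  shows "c * (t - s) \<le> g t - g s"
proof -
  define S where "S = {r \<in> {s..t}. c * (r - s) \<le> g r - g s}"
  define m where "m = Sup S"
  have sS: "s \<in> S" using s by (simp add: S_def)
  have bdd: "bdd_above S" by (rule bdd_aboveI[of _ t]) (simp add: S_def)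
  have m: "s \<le> m" "m \<le> t"
    unfolding m_def using cSup_upper[OF sS bdd] sS by (auto intro!: cSup_least simp: S_def)
  have "c * (m - s) \<le> g m - g s"
  proof (rule ccontr)
    assume neg: "\<not> c * (m - s) \<le> g m - g s"
    define e where "e = (c * (m - s) - (g m - g s)) / (\<bar>c\<bar> + 1)"
    have e: "0 < e" using neg unfolding e_def by (intro divide_pos_pos) auto
    then obtain r where r: "r \<in> S" "m - e < r" unfolding m_def
      using less_cSup_iff[OF _ bdd, of "Sup S - e"] sS by auto
    then have rm: "r \<le> m" unfolding m_def by (intro cSup_upper bdd)
    have "g r \<le> g m" using r rm s by (intro mono) (auto simp: S_def)
    moreover have "c * (r - s) \<le> g r - g s" using r by (simp add: S_def)
    moreover have "c * (m - r) \<le> \<bar>c\<bar> * (m - r)" using rm by (intro mult_right_mono) auto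
    moreover have "\<bar>c\<bar> * (m - r) \<le> \<bar>c\<bar> * e" using r by (intro mult_left_mono) auto
    moreover have "(\<bar>c\<bar> + 1) * e = c * (m - s) - (g m - g s)" by (simp add: e_def)
    ultimately show False using e by (simp add: algebra_simps)
  qed
  then have mS: "m \<in> S" using m by (simp add: S_def)
  have "m = t"
  proof (rule ccontr)
    assume "m \<noteq> t"
    then have "0 < t - m" using m by simp
    obtain N :: nat where N: "1 / (t - m) < real N" using reals_Archimedean2 by blast
    obtain n where n: "N \<le> n" "0 < n" "c \<le> real n * (g (m + 1 / real n) - g m)"
      using quot[of m N] s m by auto
    have "1 / (t - m) < real n" using N n by simp
    then have "1 / real n < t - m" using \<open>0 < t - m\<close> n by (simp add: field_simps)
    moreover have "c * (1 / real n) \<le> g (m + 1 / real n) - g m" using n by (simp add: field_simps)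
    then have "c * (m + 1 / real n - s) \<le> g (m + 1 / real n) - g s"
      using mS by (simp add: S_def algebra_simps)
    ultimately have "m + 1 / real n \<in> S" using m n by (simp add: S_def add_increasing2)
    then have "m + 1 / real n \<le> m" unfolding m_def by (rule cSup_upper[OF _ bdd])
    then show False using n by simp
  qed
  with mS show ?thesis by (simp add: S_def)
qed

text \<open>Meant for the mean height, whose measurability in \<omega> is not among the assumptions
  and has to come from completeness.\<close>

lemma (in complete_measure) borel_measurable_if_AE_eq:
  assumes g: "g \<in> borel_measurable M" and eq: "AE x in M. f x = g x"
  shows "f \<in> borel_measurable M"
proof (rule measurableI)
  fix A :: "'b set" assume "A \<in> sets borel"
  then have "g -` A \<inter> space M \<in> sets M" using g by (rule measurable_sets[rotated])
  then show "f -` A \<inter> space M \<in> sets M"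
    by (rule in_sets_AE[rotated]) (use eq in auto)
qed simp

text \<open>One choice for given \<open>\<phi>\<close>, \<open>F\<close> and \<open>t\<close>, made
  without reference to a probability space, so that the expected mean height is determined by the
  law of the strengths.\<close>

definition mean_height_fun ::
    "(real \<times> real \<Rightarrow> real) \<Rightarrow> real \<Rightarrow> real \<Rightarrow> (int \<times> int \<Rightarrow> real) \<Rightarrow> real" where
  "mean_height_fun \<phi> F t = (SOME G. G \<in> borel_measurable (Pi\<^sub>M UNIV (\<lambda>_. borel)) \<and>
    (\<forall>z. 0 \<le> G z \<and> G z \<le> F * t) \<and>
    (\<forall>z u. admissible z \<longrightarrow> classical_solution (site_field \<phi> z) F u \<longrightarrow> integral {0..1} (\<lambda>x. u x t) = G z))"

lemma mean_height_fun:
  assumes "bump \<delta> \<phi>" "\<delta> < 1/2" "0 < F" "0 \<le> t"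
  shows "mean_height_fun \<phi> F t \<in> borel_measurable (Pi\<^sub>M UNIV (\<lambda>_. borel))"
    and "0 \<le> mean_height_fun \<phi> F t z" "mean_height_fun \<phi> F t z \<le> F * t"
    and "admissible z \<Longrightarrow> classical_solution (site_field \<phi> z) F u \<Longrightarrow>
      integral {0..1} (\<lambda>x. u x t) = mean_height_fun \<phi> F t z"
proof -
  have "\<exists>G. G \<in> borel_measurable (Pi\<^sub>M UNIV (\<lambda>_. borel)) \<and>
    (\<forall>z. 0 \<le> G z \<and> G z \<le> F * t) \<and>
    (\<forall>z u. admissible z \<longrightarrow> classical_solution (site_field \<phi> z) F u \<longrightarrow> integral {0..1} (\<lambda>x. u x t) = G z)"
    by (rule mean_height_factorization[OF assms]) blast
  from someI_ex[OF this, folded mean_height_fun_def]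
  show "mean_height_fun \<phi> F t \<in> borel_measurable (Pi\<^sub>M UNIV (\<lambda>_. borel))"
    "0 \<le> mean_height_fun \<phi> F t z" "mean_height_fun \<phi> F t z \<le> F * t"
    "admissible z \<Longrightarrow> classical_solution (site_field \<phi> z) F u \<Longrightarrow>
      integral {0..1} (\<lambda>x. u x t) = mean_height_fun \<phi> F t z"
    by blast+
qed

definition shift :: "int \<Rightarrow> (int \<times> int \<Rightarrow> real) \<Rightarrow> int \<times> int \<Rightarrow> real" where
  "shift k z = (\<lambda>(i, j). z (i + k, j))"

lemma measurable_shift [measurable]:
  "shift k \<in> Pi\<^sub>M UNIV (\<lambda>_. borel) \<rightarrow>\<^sub>M Pi\<^sub>M UNIV (\<lambda>_. borel)"
  by (rule measurable_PiM_single') (auto simp: shift_def space_PiM case_prod_unfold)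

lemma distr_shift_PiM:
  assumes "prob_space \<nu>" "sets \<nu> = sets borel"
  shows "distr (Pi\<^sub>M UNIV (\<lambda>_. \<nu>)) (Pi\<^sub>M UNIV (\<lambda>_. borel)) (shift k) = Pi\<^sub>M UNIV (\<lambda>_. \<nu>)"
proof -
  have "distr (Pi\<^sub>M UNIV (\<lambda>_. \<nu>)) (Pi\<^sub>M UNIV (\<lambda>_. borel)) (shift k) =
    distr (Pi\<^sub>M UNIV (\<lambda>_. \<nu>)) (Pi\<^sub>M UNIV (\<lambda>_. \<nu>)) (\<lambda>\<omega>. \<lambda>n\<in>UNIV. \<omega> (fst n + k, snd n))"
    by (rule distr_cong) (auto simp: shift_def case_prod_unfold intro!: sets_PiM_cong assms(2)[symmetric])
  also have "\<dots> = Pi\<^sub>M UNIV (\<lambda>_. \<nu>)"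
    by (rule distr_PiM_reindex[where M = "\<lambda>_. \<nu>" and f = "\<lambda>n. (fst n + k, snd n)"])
       (auto simp: assms inj_on_def prod_eq_iff)
  finally show ?thesis .
qed

section \<open>Random configurations and the expected mean height\<close>

locale random_obstacles = prob_space M for M :: "'w measure" +
  fixes lam \<beta> \<delta> F :: real and X :: "int \<Rightarrow> int \<Rightarrow> 'w \<Rightarrow> real" and \<phi> :: "real \<times> real \<Rightarrow> real"
    and u :: "real \<Rightarrow> real \<Rightarrow> 'w \<Rightarrow> real"
  assumes lam: "0 < lam" and beta: "0 \<le> \<beta>" and delta: "\<delta> < 1/2" and F_pos: "0 < F"
    and strengths: "obstacle_strengths M lam \<beta> X" and bump: "bump \<delta> \<phi>"
    and solution: "\<And>\<omega>. \<omega> \<in> space M \<Longrightarrow>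
      classical_solution (\<lambda>x y. obstacle_field X \<phi> x y \<omega>) F (\<lambda>x t. u x t \<omega>)"
begin

definition Z :: "'w \<Rightarrow> int \<times> int \<Rightarrow> real" where
  "Z \<omega> = (\<lambda>(i, j). X i j \<omega>)"

lemma solution_Z: "\<omega> \<in> space M \<Longrightarrow> classical_solution (site_field \<phi> (Z \<omega>)) F (\<lambda>x t. u x t \<omega>)"
proof -
  have "(\<lambda>x y. obstacle_field X \<phi> x y \<omega>) = site_field \<phi> (Z \<omega>)"
    by (intro ext) (simp add: obstacle_field_eq_site_field[OF bump delta] Z_def)
  then show "\<omega> \<in> space M \<Longrightarrow> ?thesis" using solution[of \<omega>] by simp
qed

lemma indep_Z: "indep_vars (\<lambda>_. borel) (\<lambda>p \<omega>. Z \<omega> p) UNIV"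
proof -
  have "(\<lambda>p \<omega>. Z \<omega> p) = (\<lambda>(i, j). X i j)" by (auto simp: Z_def fun_eq_iff)
  then show ?thesis using strengths by (simp add: obstacle_strengths_def)
qed

lemma measurable_Z_component [measurable]: "(\<lambda>\<omega>. Z \<omega> p) \<in> borel_measurable M"
  using indep_Z unfolding indep_vars_def by blast

lemma measurable_Z [measurable]: "Z \<in> M \<rightarrow>\<^sub>M Pi\<^sub>M UNIV (\<lambda>_. borel)"
  by (rule measurable_PiM_single') (auto simp: space_PiM)

lemma law_Z: "distr M (Pi\<^sub>M UNIV (\<lambda>_. borel)) Z = Pi\<^sub>M UNIV (\<lambda>_. distr M borel (X 0 0))"
proof -
  have "distr M (Pi\<^sub>M UNIV (\<lambda>_. borel)) (\<lambda>\<omega>. \<lambda>p\<in>UNIV. Z \<omega> p) = Pi\<^sub>M UNIV (\<lambda>p. distr M borel (\<lambda>\<omega>. Z \<omega> p))"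
    using indep_Z by (subst (asm) indep_vars_iff_distr_eq_PiM') auto
  moreover have "distr M borel (\<lambda>\<omega>. Z \<omega> p) = distr M borel (X 0 0)" for p
    using strengths by (cases p) (simp add: obstacle_strengths_def Z_def)
  ultimately show ?thesis by (simp add: restrict_def)
qed

lemma law_shift_Z: "distr M (Pi\<^sub>M UNIV (\<lambda>_. borel)) (\<lambda>\<omega>. shift k (Z \<omega>)) = distr M (Pi\<^sub>M UNIV (\<lambda>_. borel)) Z"
proof -
  have "X 0 0 \<in> borel_measurable M" using measurable_Z_component[of "(0, 0)"] by (simp add: Z_def)
  then have p: "prob_space (distr M borel (X 0 0))" by (rule prob_space_distr)
  have "distr M (Pi\<^sub>M UNIV (\<lambda>_. borel)) (\<lambda>\<omega>. shift k (Z \<omega>)) =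
    distr (distr M (Pi\<^sub>M UNIV (\<lambda>_. borel)) Z) (Pi\<^sub>M UNIV (\<lambda>_. borel)) (shift k)"
    by (subst distr_distr) (auto simp: o_def)
  also have "\<dots> = Pi\<^sub>M UNIV (\<lambda>_. distr M borel (X 0 0))"
    unfolding law_Z by (rule distr_shift_PiM[OF p]) simp
  finally show ?thesis by (simp add: law_Z)
qed

lemma exp_moment: "(\<integral>\<^sup>+\<omega>. exp (lam * Z \<omega> p) \<partial>M) = ennreal \<beta>"
proof -
  obtain i j where p: "p = (i, j)" by force
  have m: "X i j \<in> borel_measurable M" for i j using measurable_Z_component[of "(i, j)"] by (simp add: Z_def)
  have "(\<integral>\<^sup>+\<omega>. exp (lam * Z \<omega> p) \<partial>M) = (\<integral>\<^sup>+x. exp (lam * x) \<partial>distr M borel (X i j))"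
    using m by (subst nn_integral_distr) (auto simp: Z_def p)
  also have "distr M borel (X i j) = distr M borel (X 0 0)"
    using strengths unfolding obstacle_strengths_def by blast
  also have "(\<integral>\<^sup>+x. exp (lam * x) \<partial>distr M borel (X 0 0)) = (\<integral>\<^sup>+\<omega>. exp (lam * X 0 0 \<omega>) \<partial>M)"
    using m by (subst nn_integral_distr) auto
  also have "\<dots> = ennreal \<beta>"
    using strengths unfolding obstacle_strengths_def has_bochner_integral_iff
    by (subst nn_integral_eq_integral) auto
  finally show ?thesis .
qed

text \<open>Weighted with exp (-|i|), the exponentials along a row have summable expectations; their
  sum is then almost surely finite and bounds each term.\<close>

lemma AE_exp_growth: "AE \<omega> in M. \<exists>C. \<forall>i. exp (lam * Z \<omega> (i, j)) \<le> C * exp \<bar>of_int i\<bar>"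
proof -
  define f where "f = (\<lambda>n::nat. \<lambda>\<omega>. ennreal (exp (lam * Z \<omega> (int n, j)) * exp (- real n)) +
    ennreal (exp (lam * Z \<omega> (- int n, j)) * exp (- real n)))"
  have [measurable]: "f n \<in> borel_measurable M" for n unfolding f_def by measurable
  have "(\<integral>\<^sup>+\<omega>. f n \<omega> \<partial>M) = ennreal (2 * \<beta> * exp (- 1) ^ n)" for n
  proof -
    have "(\<integral>\<^sup>+\<omega>. ennreal (exp (lam * Z \<omega> p) * exp (- real n)) \<partial>M) = ennreal (\<beta> * exp (- 1) ^ n)" for p
      using beta by (simp add: ennreal_mult nn_integral_multc exp_moment flip: exp_of_nat_mult)
    then show ?thesis unfolding f_def using beta by (subst nn_integral_add) (auto simp flip: ennreal_plus)
  qed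
  then have "(\<integral>\<^sup>+\<omega>. (\<Sum>n. f n \<omega>) \<partial>M) = (\<Sum>n. ennreal (2 * \<beta> * exp (- 1) ^ n))"
    by (subst nn_integral_suminf) auto
  also have "\<dots> = ennreal (\<Sum>n. 2 * \<beta> * exp (- 1) ^ n)"
    using beta by (intro suminf_ennreal2) (auto intro!: summable_mult summable_geometric)
  finally have "(\<integral>\<^sup>+\<omega>. (\<Sum>n. f n \<omega>) \<partial>M) \<noteq> \<infinity>" by simp
  then have "AE \<omega> in M. (\<Sum>n. f n \<omega>) \<noteq> \<infinity>" by (rule nn_integral_PInf_AE[rotated]) measurable
  then show ?thesis
  proof eventually_elim
    case (elim \<omega>)
    obtain C where C: "(\<Sum>n. f n \<omega>) = ennreal C" "0 \<le> C" using elim by (cases "\<Sum>n. f n \<omega>") auto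
    have "exp (lam * Z \<omega> (i, j)) \<le> C * exp \<bar>of_int i\<bar>" for i
    proof -
      define n where "n = nat \<bar>i\<bar>"
      have i: "i = int n \<or> i = - int n" and ri: "\<bar>real_of_int i\<bar> = real n" by (auto simp: n_def)
      have "ennreal (exp (lam * Z \<omega> (i, j)) * exp (- real n)) \<le> f n \<omega>"
        using i by (auto simp: f_def)
      also have "\<dots> \<le> ennreal C" unfolding C(1)[symmetric] using sum_le_suminf[of "\<lambda>n. f n \<omega>" "{n}"] by simp
      finally have "exp (lam * Z \<omega> (i, j)) * exp (- real n) \<le> C" using C(2) by simp
      then show ?thesis unfolding ri by (simp add: exp_minus field_simps)
    qed
    then show ?case by blast
  qed
qed

text \<open>Logarithms turn the exponential bound of \<open>AE_exp_growth\<close> into linear growth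
  of the strengths; a maximum over the finitely many rows up to \<open>J\<close> gives a common
  constant.\<close>

lemma AE_admissible: "AE \<omega> in M. admissible (Z \<omega>)"
proof -
  have "AE \<omega> in M. \<forall>j. \<exists>C. \<forall>i. exp (lam * Z \<omega> (i, j)) \<le> C * exp \<bar>of_int i\<bar>"
    using AE_exp_growth by (simp add: AE_all_countable)
  then show ?thesis
  proof (rule AE_mp, intro AE_I2 impI)
    fix \<omega> assume \<omega>: "\<omega> \<in> space M" and "\<forall>j. \<exists>C. \<forall>i. exp (lam * Z \<omega> (i, j)) \<le> C * exp \<bar>of_int i\<bar>"
    then obtain C where C: "\<And>i j. exp (lam * Z \<omega> (i, j)) \<le> C j * exp \<bar>of_int i\<bar>" by metis
    define b where "b = (\<lambda>j. (\<bar>ln (C j)\<bar> + 1) / lam)"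
    have b: "Z \<omega> (i, j) \<le> b j * (1 + \<bar>of_int i\<bar>)" for i j
    proof -
      have "0 < C j * exp \<bar>of_int i\<bar>" using C[of i j] exp_gt_zero by (rule less_le_trans[rotated])
      then have Cj: "0 < C j" by (simp add: zero_less_mult_iff)
      have "lam * Z \<omega> (i, j) \<le> ln (C j * exp \<bar>of_int i\<bar>)" using C[of i j] Cj by (subst ln_ge_iff) auto
      also have "\<dots> = ln (C j) + \<bar>of_int i\<bar>" using Cj by (simp add: ln_mult)
      also have "\<dots> \<le> (\<bar>ln (C j)\<bar> + 1) * (1 + \<bar>of_int i\<bar>)"
      proof -
        have "0 \<le> \<bar>ln (C j)\<bar> * \<bar>real_of_int i\<bar>" by (intro mult_nonneg_nonneg abs_ge_zero)
        moreover have "(\<bar>ln (C j)\<bar> + 1) * (1 + \<bar>real_of_int i\<bar>) = \<bar>ln (C j)\<bar> + \<bar>of_int i\<bar> + 1 + \<bar>ln (C j)\<bar> * \<bar>of_int i\<bar>"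
          by (simp add: algebra_simps)
        ultimately show ?thesis by linarith
      qed
      finally show ?thesis using lam by (simp add: b_def field_simps)
    qed
    show "admissible (Z \<omega>)" unfolding admissible_def
    proof (intro conjI allI)
      show "0 \<le> Z \<omega> p" for p using strengths \<omega> by (cases p) (auto simp: obstacle_strengths_def Z_def)
      fix J
      have "Z \<omega> (i, j) \<le> Max (b ` {- int J..int J}) * (1 + \<bar>of_int i\<bar>)" if "\<bar>j\<bar> \<le> int J" for i j
      proof -
        have "b j \<le> Max (b ` {- int J..int J})" using that by (intro Max_ge imageI) auto
        then show ?thesis by (intro order_trans[OF b mult_right_mono]) auto
      qed
      then show "\<exists>B. Z \<omega> \<in> row_growth J B" unfolding row_growth_def by blast
    qed
  qed
qed

lemma obstacle_solution:
  "\<omega> \<in> space M \<Longrightarrow> admissible (Z \<omega>) \<Longrightarrow> obstacle_solution \<delta> \<phi> (Z \<omega>) F (\<lambda>x t. u x t \<omega>)"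
  by (rule obstacle_solution.intro[OF bump delta F_pos _ solution_Z])

abbreviation G :: "real \<Rightarrow> (int \<times> int \<Rightarrow> real) \<Rightarrow> real" where
  "G \<equiv> mean_height_fun \<phi> F"

lemmas G = mean_height_fun[OF bump delta F_pos]

text \<open>All unit intervals are described by the same function \<open>G\<close> at shifted
  configurations. As shifts preserve the law, the means over these intervals coincide.\<close>

lemma integral_unit_interval:
  assumes \<omega>: "\<omega> \<in> space M" "admissible (Z \<omega>)" and t: "0 \<le> t"
  shows "integral {of_int i..of_int i + 1} (\<lambda>x. u x t \<omega>) = G t (shift i (Z \<omega>))"
proof -
  interpret S: obstacle_solution \<delta> \<phi> "Z \<omega>" F "\<lambda>x t. u x t \<omega>" by (rule obstacle_solution[OF \<omega>])
  interpret S': obstacle_solution \<delta> \<phi> "shift i (Z \<omega>)" F "\<lambda>x t. u (x + of_int i) t \<omega>"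
    unfolding shift_def by (rule S.shifted)
  have "G t (shift i (Z \<omega>)) = integral {0..1} (\<lambda>x. u (x + of_int i) t \<omega>)"
    using G(4)[OF t S'.adm S'.sol] by simp
  also have "\<dots> = integral {0 + of_int i..1 + of_int i} (\<lambda>x. u x t \<omega>)"
    using integral_shift[OF S.continuous_profile[OF t], where a = 0 and b = 1 and c = "of_int i"] by (simp add: o_def)
  finally show ?thesis by (simp add: add.commute)
qed

text \<open>The expectation is taken of the Borel version of the mean height, so that it makes sense
  before completeness is used.\<close>

definition g :: "real \<Rightarrow> real" where
  "g t = expectation (\<lambda>\<omega>. G t (Z \<omega>))"

lemma measurable_G [measurable]: "0 \<le> t \<Longrightarrow> (\<lambda>\<omega>. G t (shift i (Z \<omega>))) \<in> borel_measurable M"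
  using G(1)[of t] by measurable

lemma integrable_G: "0 \<le> t \<Longrightarrow> integrable M (\<lambda>\<omega>. G t (shift i (Z \<omega>)))"
  by (rule integrable_const_bound[of _ "F * t"]) (auto simp: G(2,3) intro!: AE_I2)

lemma expectation_G: "0 \<le> t \<Longrightarrow> expectation (\<lambda>\<omega>. G t (shift i (Z \<omega>))) = g t"
proof -
  assume t: "0 \<le> t"
  have "expectation (\<lambda>\<omega>. G t (shift i (Z \<omega>))) =
    (\<integral>z. G t z \<partial>distr M (Pi\<^sub>M UNIV (\<lambda>_. borel)) (\<lambda>\<omega>. shift i (Z \<omega>)))"
    using G(1)[OF t] by (subst integral_distr) auto
  also have "\<dots> = g t" unfolding law_shift_Z g_def using G(1)[OF t] by (subst integral_distr) auto
  finally show ?thesis .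
qed

lemma shift_0 [simp]: "shift 0 z = z"
  by (simp add: shift_def)

lemma AE_G_mono: "0 \<le> s \<Longrightarrow> s \<le> t \<Longrightarrow> AE \<omega> in M. G s (shift i (Z \<omega>)) \<le> G t (shift i (Z \<omega>))"
proof (rule AE_mp[OF AE_admissible], intro AE_I2 impI)
  fix \<omega> assume s: "0 \<le> s" "s \<le> t" and \<omega>: "\<omega> \<in> space M" "admissible (Z \<omega>)"
  interpret S: obstacle_solution \<delta> \<phi> "Z \<omega>" F "\<lambda>x t. u x t \<omega>" by (rule obstacle_solution[OF \<omega>])
  show "G s (shift i (Z \<omega>)) \<le> G t (shift i (Z \<omega>))"
    using s S.mono_time[OF s]
    by (subst (1 2) integral_unit_interval[OF \<omega>, symmetric])
       (auto intro!: integral_le integrable_continuous_real S.continuous_profile)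
qed

lemma g_mono: "0 \<le> s \<Longrightarrow> s \<le> t \<Longrightarrow> g s \<le> g t"
  using AE_G_mono[of s t 0] integrable_G[of s 0] integrable_G[of t 0] unfolding g_def
  by (intro integral_mono_AE) auto

lemma g_nonneg: "0 \<le> t \<Longrightarrow> 0 \<le> g t"
  unfolding g_def by (intro integral_nonneg_AE AE_I2 G(2))

end

context random_obstacles
begin

text \<open>Fatou's lemma along the difference quotients avoids any discussion of the measurability of
  \<open>u\<^sub>t\<close>.\<close>

definition quotient_rate :: "real \<Rightarrow> int \<Rightarrow> 'w \<Rightarrow> ennreal" where
  "quotient_rate t i \<omega> = liminf (\<lambda>n. ennreal (real n * (G (t + 1 / real n) (shift i (Z \<omega>)) - G t (shift i (Z \<omega>)))))"

lemma measurable_quotient_rate [measurable]: "0 < t \<Longrightarrow> quotient_rate t i \<in> borel_measurable M"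
  unfolding quotient_rate_def[abs_def]
  by (intro borel_measurable_liminf measurable_compose[OF _ measurable_ennreal] borel_measurable_times
      borel_measurable_diff borel_measurable_const measurable_G) auto

lemma quotient_rate_eq:
  assumes \<omega>: "\<omega> \<in> space M" "admissible (Z \<omega>)" and t: "0 < t"
  shows "quotient_rate t i \<omega> =
    ennreal (integral {of_int i..of_int i + 1} (obstacle_solution.rate (\<lambda>x t. u x t \<omega>) t))"
proof -
  interpret S: obstacle_solution \<delta> \<phi> "Z \<omega>" F "\<lambda>x t. u x t \<omega>" by (rule obstacle_solution[OF \<omega>])
  let ?U = "\<lambda>s. integral {of_int i..of_int i + 1} (\<lambda>x. u x s \<omega>)"
  let ?D = "integral {of_int i..of_int i + 1} (S.rate t)"
  have "((\<lambda>h. (?U (t + h) - ?U t) / h) \<longlongrightarrow> ?D) (at 0)"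
    using S.rate(4)[OF t, of "of_int i" "of_int i + 1"] by (simp add: DERIV_def)
  then have "((\<lambda>h. (?U (t + h) - ?U t) / h) \<longlongrightarrow> ?D) (at_right 0)"
    by (rule tendsto_mono[rotated]) (simp add: at_le)
  moreover have "filterlim (\<lambda>n. 1 / real n) (at_right 0) sequentially"
    using filterlim_compose[OF filterlim_inverse_at_right_top filterlim_real_sequentially]
    by (simp add: inverse_eq_divide)
  ultimately have "(\<lambda>n. (?U (t + 1 / real n) - ?U t) / (1 / real n)) \<longlonglongrightarrow> ?D"
    by (rule filterlim_compose)
  then have "(\<lambda>n. real n * (G (t + 1 / real n) (shift i (Z \<omega>)) - G t (shift i (Z \<omega>)))) \<longlonglongrightarrow> ?D"
    using t by (simp add: integral_unit_interval[OF \<omega>] mult.commute)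
  then have "(\<lambda>n. ennreal (real n * (G (t + 1 / real n) (shift i (Z \<omega>)) - G t (shift i (Z \<omega>))))) \<longlonglongrightarrow> ennreal ?D"
    by (rule tendsto_ennrealI)
  then show ?thesis unfolding quotient_rate_def by (intro lim_imp_Liminf) auto
qed

lemma nn_integral_quotient_rate_le:
  assumes t: "0 < t" and c: "\<And>n. N \<le> n \<Longrightarrow> 0 < n \<Longrightarrow> real n * (g (t + 1 / real n) - g t) \<le> c"
  shows "(\<integral>\<^sup>+\<omega>. quotient_rate t i \<omega> \<partial>M) \<le> ennreal c"
proof -
  let ?D = "\<lambda>n \<omega>. real n * (G (t + 1 / real n) (shift i (Z \<omega>)) - G t (shift i (Z \<omega>)))"
  \<comment> \<open>For \<open>n = 0\<close> both sides vanish, and \<open>1 / real 0 = 0\<close>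
    keeps the time argument at \<open>t\<close>.\<close>
  have D: "(\<integral>\<^sup>+\<omega>. ?D n \<omega> \<partial>M) = ennreal (real n * (g (t + 1 / real n) - g t))" for n
  proof -
    have pos: "0 \<le> t + 1 / real n" "t \<le> t + 1 / real n" using t by auto
    have "AE \<omega> in M. 0 \<le> ?D n \<omega>"
      using AE_G_mono[OF less_imp_le[OF t] pos(2), of i] by eventually_elim simp
    moreover have int: "integrable M (\<lambda>\<omega>. G (t + 1 / real n) (shift i (Z \<omega>)))" "integrable M (\<lambda>\<omega>. G t (shift i (Z \<omega>)))"
      using integrable_G pos t by auto
    ultimately have "(\<integral>\<^sup>+\<omega>. ?D n \<omega> \<partial>M) = ennreal (expectation (?D n))"
      by (intro nn_integral_eq_integral) auto
    also have "expectation (?D n) = real n * (g (t + 1 / real n) - g t)"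
      using int expectation_G pos t by simp
    finally show ?thesis .
  qed
  have "(\<integral>\<^sup>+\<omega>. quotient_rate t i \<omega> \<partial>M) \<le> liminf (\<lambda>n. \<integral>\<^sup>+\<omega>. ?D n \<omega> \<partial>M)"
    unfolding quotient_rate_def using t
    by (intro nn_integral_liminf measurable_compose[OF _ measurable_ennreal] borel_measurable_times
      borel_measurable_diff borel_measurable_const measurable_G) auto
  also have "\<dots> \<le> liminf (\<lambda>n. ennreal c)"
  proof (rule Liminf_mono)
    show "\<forall>\<^sub>F n in sequentially. (\<integral>\<^sup>+\<omega>. ?D n \<omega> \<partial>M) \<le> ennreal c"
      using eventually_ge_at_top[of "max N 1"] by eventually_elim (auto simp: D intro!: ennreal_leI c)
  qed
  also have "\<dots> = ennreal c" by (rule Liminf_const) simp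
  finally show ?thesis .
qed

text \<open>The inequality 1 + x \<le> exp x is applied to the logarithm of the normalised lower
  bound from \<open>path_sum_ge\<close>, and then expectations are taken. The boundary term and the
  number of states do not grow with \<open>k\<close>.\<close>

lemma path_sum_bound:
  assumes t: "0 < t" and F: "1 \<le> F" and small: "\<beta> * total_weight (lam / 2) F \<le> exp (- (lam / 2))"
    and S: "S = {0..\<lfloor>F * t\<rfloor>} \<times> {- \<lceil>F * t + F\<rceil>..\<lceil>F * t + F\<rceil>}" and c: "0 \<le> c"
    and rate: "\<And>i. (\<integral>\<^sup>+\<omega>. quotient_rate t i \<omega> \<partial>M) \<le> ennreal c"
  shows "lam / 2 * real k - lam * (F * t + F) - ln (card S) \<le> lam * (real (Suc k) * c)"
proof -
  define \<theta> where "\<theta> = lam / 2"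
  have \<theta>: "0 < \<theta>" using lam by (simp add: \<theta>_def)
  define T where "T = (\<lambda>\<omega>. \<Sum>s\<in>S. path_sum (path_steps F S) (step_weight \<theta> F) (\<lambda>p. exp (lam * Z \<omega> p)) k 0 s)"
  have finS: "finite S" by (simp add: S)
  have "0 \<le> F * t" using F t by simp
  then have "(0, 0) \<in> S" using F by (auto simp: S)
  then have cardS: "0 < real (card S)" using finS by (auto simp: card_gt_0_iff)
  have w0: "0 \<le> step_weight \<theta> F s \<tau>" if "\<tau> \<in> path_steps F S s" for s \<tau>
    using that F by (auto simp: step_weight_def path_weight_def path_steps_def split: prod.splits)
  have T0: "0 \<le> T \<omega>" for \<omega> unfolding T_def by (intro sum_nonneg path_sum_nonneg w0) auto
  have [measurable]: "(\<lambda>\<omega>. path_sum (path_steps F S) (step_weight \<theta> F) (\<lambda>p. exp (lam * Z \<omega> p)) k i s) \<in> borel_measurable M" for k i s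
    by (induction k arbitrary: i s) auto
  have [measurable]: "T \<in> borel_measurable M" unfolding T_def by measurable
  have indep: "indep_vars (\<lambda>_. borel) (\<lambda>p \<omega>. exp (lam * Z \<omega> p)) UNIV"
    by (rule indep_vars_compose2[OF indep_Z, where Y = "\<lambda>_ x. exp (lam * x)"]) simp
  have nn_T: "(\<integral>\<^sup>+\<omega>. T \<omega> \<partial>M) \<le> ennreal (real (card S) * exp (- \<theta> * real k))"
  proof -
    have "(\<integral>\<^sup>+\<omega>. path_sum (path_steps F S) (step_weight \<theta> F) (\<lambda>p. exp (lam * Z \<omega> p)) k 0 s \<partial>M)
      \<le> ennreal (exp (- \<theta> * real k))" for s
    proof -
      have tw: "0 \<le> total_weight \<theta> F"
        using F by (intro order_trans[OF sum_nonneg[OF w0] step_weight_sum_le(2)[OF finS _ \<theta>, of F s]]) auto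
      have "(\<integral>\<^sup>+\<omega>. path_sum (path_steps F S) (step_weight \<theta> F) (\<lambda>p. exp (lam * Z \<omega> p)) k 0 s \<partial>M)
        \<le> ennreal (\<beta> ^ 0 * (\<beta> * total_weight \<theta> F) ^ k)"
        using nn_integral_path_sum_le[OF indep _ exp_moment beta w0 step_weight_sum_le(2)[OF finS _ \<theta>], where m = 0] F
        by simp
      also have "\<dots> \<le> ennreal (exp (- \<theta>) ^ k)"
        using small beta tw by (auto intro!: ennreal_leI power_mono simp: \<theta>_def)
      also have "exp (- \<theta>) ^ k = exp (- \<theta> * real k)" by (simp add: mult.commute flip: exp_of_nat_mult)
      finally show ?thesis .
    qed
    then have "(\<Sum>s\<in>S. \<integral>\<^sup>+\<omega>. path_sum (path_steps F S) (step_weight \<theta> F) (\<lambda>p. exp (lam * Z \<omega> p)) k 0 s \<partial>M)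
      \<le> (\<Sum>s\<in>S. ennreal (exp (- \<theta> * real k)))" by (intro sum_mono)
    also have "\<dots> = ennreal (real (card S) * exp (- \<theta> * real k))" by (simp add: ennreal_mult ennreal_of_nat_eq_real_of_nat)
    also have "(\<Sum>s\<in>S. \<integral>\<^sup>+\<omega>. path_sum (path_steps F S) (step_weight \<theta> F) (\<lambda>p. exp (lam * Z \<omega> p)) k 0 s \<partial>M) = (\<integral>\<^sup>+\<omega>. T \<omega> \<partial>M)"
      unfolding T_def by (subst nn_integral_sum[symmetric])
        (auto intro!: nn_integral_cong sum_ennreal path_sum_nonneg w0)
    finally show ?thesis .
  qed
  \<comment> \<open>\<open>e\<close> normalises the path sum: the expectation of
    \<open>e * T\<close> is at most 1, and this 1 cancels the one in \<open>A\<close>.\<close>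
  define A where "A = 1 + (\<theta> * real k - 2 * \<theta> * (F * t + F) - ln (card S))"
  define e where "e = exp (\<theta> * real k) / real (card S)"
  have e: "0 < e" using cardS by (simp add: e_def)
  have "AE \<omega> in M. ennreal A \<le> ennreal e * ennreal (T \<omega>) + ennreal (2 * \<theta>) * (\<Sum>n<Suc k. quotient_rate t (int n - 1) \<omega>)"
  proof (rule AE_mp[OF AE_admissible], intro AE_I2 impI)
    fix \<omega> assume \<omega>: "\<omega> \<in> space M" "admissible (Z \<omega>)"
    interpret S: obstacle_solution \<delta> \<phi> "Z \<omega>" F "\<lambda>x t. u x t \<omega>" by (rule obstacle_solution[OF \<omega>])
    define r where "r = (\<lambda>n::nat. integral {real n - 1..real n} (S.rate t))"
    have q: "quotient_rate t (int n - 1) \<omega> = ennreal (r n)" for n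
      using quotient_rate_eq[OF \<omega> t, of "int n - 1"] by (simp add: r_def)
    have r0: "0 \<le> r n" for n unfolding r_def
      using S.rate(2,3)[OF t] by (intro integral_nonneg integrable_continuous_real) (auto intro: continuous_on_subset)
    have "A - 2 * \<theta> * (\<Sum>n<Suc k. r n) \<le> exp (\<theta> * real k - ln (card S) + \<theta> * (- 2 * (F * t + F) - 2 * (\<Sum>n<Suc k. r n)))"
      using exp_ge_add_one_self[of "\<theta> * real k - ln (card S) + \<theta> * (- 2 * (F * t + F) - 2 * (\<Sum>n<Suc k. r n))"]
      by (simp add: A_def algebra_simps)
    also have "\<dots> = e * exp (\<theta> * (- 2 * (F * t + F) - 2 * (\<Sum>n<Suc k. r n)))"
      using cardS by (simp only: exp_add exp_diff exp_ln e_def)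
    also have "\<dots> \<le> e * T \<omega>"
      using S.path_sum_ge[OF t F \<theta> S, of k] e by (simp add: T_def r_def \<theta>_def)
    finally have "A \<le> e * T \<omega> + 2 * \<theta> * (\<Sum>n<Suc k. r n)" by simp
    then have "ennreal A \<le> ennreal (e * T \<omega> + 2 * \<theta> * (\<Sum>n<Suc k. r n))" by (rule ennreal_leI)
    also have "\<dots> = ennreal e * ennreal (T \<omega>) + ennreal (2 * \<theta>) * (\<Sum>n<Suc k. quotient_rate t (int n - 1) \<omega>)"
    proof -
      have "0 \<le> (\<Sum>n<Suc k. r n)" by (intro sum_nonneg r0)
      then show ?thesis unfolding q using r0 e \<theta> T0
        by (simp only: sum_ennreal ennreal_plus mult_nonneg_nonneg ennreal_mult less_imp_le zero_le_numeral)
    qed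
    finally show "ennreal A \<le> ennreal e * ennreal (T \<omega>) + ennreal (2 * \<theta>) * (\<Sum>n<Suc k. quotient_rate t (int n - 1) \<omega>)" .
  qed
  then have "(\<integral>\<^sup>+\<omega>. ennreal A \<partial>M) \<le>
    (\<integral>\<^sup>+\<omega>. ennreal e * ennreal (T \<omega>) + ennreal (2 * \<theta>) * (\<Sum>n<Suc k. quotient_rate t (int n - 1) \<omega>) \<partial>M)"
    by (rule nn_integral_mono_AE)
  also have "\<dots> = ennreal e * (\<integral>\<^sup>+\<omega>. T \<omega> \<partial>M) + ennreal (2 * \<theta>) * (\<Sum>n<Suc k. \<integral>\<^sup>+\<omega>. quotient_rate t (int n - 1) \<omega> \<partial>M)"
    using t by (simp add: nn_integral_add nn_integral_cmult nn_integral_sum del: sum.lessThan_Suc)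
  also have "\<dots> \<le> ennreal e * ennreal (real (card S) * exp (- \<theta> * real k)) + ennreal (2 * \<theta>) * (\<Sum>n<Suc k. ennreal c)"
    by (intro add_mono mult_left_mono nn_T sum_mono rate) auto
  also have "ennreal e * ennreal (real (card S) * exp (- \<theta> * real k)) = ennreal 1"
  proof -
    have "e * (real (card S) * exp (- \<theta> * real k)) = 1"
      using cardS by (simp add: e_def exp_minus field_simps)
    then show ?thesis using e by (simp add: ennreal_mult''[symmetric] flip: ennreal_1)
  qed
  also have "ennreal (2 * \<theta>) * (\<Sum>n<Suc k. ennreal c) = ennreal (2 * \<theta> * (real (Suc k) * c))"
  proof -
    have "(\<Sum>n<Suc k. ennreal c) = ennreal (real (Suc k) * c)"
      using c sum_ennreal[of "{..<Suc k}" "\<lambda>_. c"] by simp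
    then show ?thesis using \<theta> c by (simp add: ennreal_mult''[symmetric])
  qed
  also have "ennreal 1 + ennreal (2 * \<theta> * (real (Suc k) * c)) = ennreal (1 + 2 * \<theta> * (real (Suc k) * c))"
    using \<theta> c by (intro ennreal_plus[symmetric]) auto
  finally have "ennreal A \<le> ennreal (1 + 2 * \<theta> * (real (Suc k) * c))" by (simp add: emeasure_space_1)
  \<comment> \<open>\<open>A\<close> may be negative, and then \<open>ennreal A\<close> is 0; the
    real inequality follows all the same, as its right-hand side is non-negative.\<close>
  then have "A \<le> 1 + 2 * \<theta> * (real (Suc k) * c)" using \<theta> c by (subst (asm) ennreal_le_iff) auto
  then show ?thesis by (simp add: A_def \<theta>_def)
qed

text \<open>If all late difference quotients at some time were below 1/4,
  \<open>path_sum_bound\<close> with c = 1/4 would bound \<open>lam / 4 * real k\<close> uniformly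
  in \<open>k\<close>. Any positive constant below 1/2 could take the place of 1/4.\<close>

lemma g_lower_bound:
  assumes t: "0 < t" and F: "1 \<le> F" and small: "\<beta> * total_weight (lam / 2) F \<le> exp (- (lam / 2))"
  shows "t / 4 \<le> g t"
proof -
  have quot: "\<exists>n::nat. N \<le> n \<and> 0 < n \<and> 1 / 4 \<le> real n * (g (t + 1 / real n) - g t)" if t: "0 < t" for t N
  proof (rule ccontr)
    assume "\<not> ?thesis"
    then have rate: "(\<integral>\<^sup>+\<omega>. quotient_rate t i \<omega> \<partial>M) \<le> ennreal (1 / 4)" for i
      by (intro nn_integral_quotient_rate_le[OF t, of N]) (meson linear not_le)
    define C where "C = lam * (F * t + F) + ln (card ({0..\<lfloor>F * t\<rfloor>} \<times> {- \<lceil>F * t + F\<rceil>..\<lceil>F * t + F\<rceil>}))"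
    have b: "lam / 2 * real k - C \<le> lam * (real (Suc k) * (1 / 4))" for k
      using path_sum_bound[OF t F small refl _ rate, of k] by (simp add: C_def)
    have bound: "lam * real k \<le> 4 * C + lam" for k using b[of k] by (simp add: field_simps)
    obtain k :: nat where "(4 * C + lam) / lam < real k" using reals_Archimedean2 by blast
    then show False using bound[of k] lam by (simp add: field_simps)
  qed
  have "(t - s) / 4 \<le> g t" if s: "0 < s" "s \<le> t" for s
    using diff_quotient_lower_bound[OF _ quot s] g_mono g_nonneg[of s] s by fastforce
  then have *: "t / 4 \<le> g t + s / 4" if "0 < s" "s \<le> t" for s using that by (fastforce simp: field_simps)
  \<comment> \<open>The quotients are controlled at positive times only, so the initial time
    \<open>s\<close> is sent to 0.\<close>
  have "\<forall>\<^sub>F s in at_right 0. t / 4 \<le> g t + s / 4"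
    using eventually_at_right_real[OF t] by eventually_elim (use * in auto)
  moreover have "((\<lambda>s. g t + s / 4) \<longlongrightarrow> g t + 0 / 4) (at_right 0)" by (intro tendsto_intros) simp
  ultimately have "t / 4 \<le> g t + 0 / 4" by (intro tendsto_lowerbound[of _ "g t + 0 / 4" "at_right 0"]) auto
  then show ?thesis by simp
qed

lemma mean_height:
  assumes "complete_measure M" and t: "0 < t"
  shows "integrable M (mean_height u t)" "expectation (mean_height u t) = g t"
proof -
  interpret complete_measure M by fact
  have eq: "AE \<omega> in M. mean_height u t \<omega> = G t (Z \<omega>)"
  proof (rule AE_mp[OF AE_admissible], intro AE_I2 impI)
    fix \<omega> assume "\<omega> \<in> space M" "admissible (Z \<omega>)"
    then show "mean_height u t \<omega> = G t (Z \<omega>)"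
      using integral_unit_interval[of \<omega> t 0] t by (simp add: mean_height_def)
  qed
  have meas: "(\<lambda>\<omega>. G t (Z \<omega>)) \<in> borel_measurable M" using measurable_G[of t 0] t by simp
  then have meas': "mean_height u t \<in> borel_measurable M" by (rule borel_measurable_if_AE_eq) (rule eq)
  have int: "integrable M (\<lambda>\<omega>. G t (Z \<omega>))" using integrable_G[of t 0] t by simp
  show "integrable M (mean_height u t)" using integrable_cong_AE[OF meas' meas eq] int by simp
  show "expectation (mean_height u t) = g t" unfolding g_def by (rule integral_cong_AE[OF meas' meas eq])
qed

end

section \<open>The velocity bound and its transfer between sample spaces\<close>

lemma velocity_boundI:
  fixes V :: "real \<Rightarrow> real"
  assumes V: "V \<in> {0..} \<rightarrow> {0..}" "mono_on {0..} V" "0 \<le> F" "V F \<noteq> 0"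
    and bound: "\<And>(M :: 'w measure) X \<phi> F u t. complete_measure M \<Longrightarrow>
      random_obstacles M lam \<beta> \<delta> F X \<phi> u \<Longrightarrow> 0 < t \<Longrightarrow> V F * t \<le> random_obstacles.g M F X \<phi> t"
    and lam: "0 < lam" and beta: "0 \<le> \<beta>" and delta: "\<delta> < 1/2"
  shows "velocity_bound TYPE('w) lam \<beta> \<delta> V"
  unfolding velocity_bound_def
proof (intro conjI allI impI)
  show "\<exists>F\<ge>0. V F \<noteq> 0" using V by blast
  fix M :: "'w measure" and X \<phi> F u and t :: real
  assume *: "prob_space M" "complete_measure M" "obstacle_strengths M lam \<beta> X" "bump \<delta> \<phi>" "0 < F"
    "\<forall>\<omega>\<in>space M. classical_solution (\<lambda>x y. obstacle_field X \<phi> x y \<omega>) F (\<lambda>x t. u x t \<omega>)" and t: "0 < t"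
  have ro: "random_obstacles M lam \<beta> \<delta> F X \<phi> u"
    unfolding random_obstacles_def random_obstacles_axioms_def using * lam beta delta by auto
  interpret random_obstacles M lam \<beta> \<delta> F X \<phi> u by (fact ro)
  show "integrable M (\<lambda>\<omega>. mean_height u t \<omega> / t)" using mean_height(1)[OF *(2) t] by simp
  show "V F \<le> expectation (\<lambda>\<omega>. mean_height u t \<omega> / t)"
    using bound[OF *(2) ro t] mean_height(2)[OF *(2) t] t by (simp add: field_simps)
qed (use V in auto)

text \<open>A step function will do: 0 below the threshold, by \<open>g_nonneg\<close>, and the rate
  1/4 of \<open>g_lower_bound\<close> from there on. The threshold depends on \<open>lam\<close> and
  \<open>\<beta>\<close> only and is thus common to all spaces and fields.\<close>

lemma velocity_bound_exists:
  assumes "0 < lam" "0 \<le> \<beta>" "\<delta> < 1/2"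
  shows "\<exists>V. velocity_bound TYPE('w) lam \<beta> \<delta> V"
proof -
  obtain F0 where F0: "1 \<le> F0" "\<And>F. F0 \<le> F \<Longrightarrow> \<beta> * total_weight (lam / 2) F \<le> exp (- (lam / 2))"
    using total_weight_small[of "lam / 2" \<beta>] assms by auto
  define V where "V = (\<lambda>F. if F0 \<le> F then 1 / 4 else (0::real))"
  have "velocity_bound TYPE('w) lam \<beta> \<delta> V"
  proof (rule velocity_boundI[where F = F0])
    show "V \<in> {0..} \<rightarrow> {0..}" "mono_on {0..} V" by (auto simp: V_def mono_on_def)
    show "0 \<le> F0" "V F0 \<noteq> 0" using F0 by (auto simp: V_def)
    fix M :: "'w measure" and X \<phi> F u and t :: real
    assume "random_obstacles M lam \<beta> \<delta> F X \<phi> u" and t: "0 < t"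
    then interpret random_obstacles M lam \<beta> \<delta> F X \<phi> u by simp
    show "V F * t \<le> random_obstacles.g M F X \<phi> t"
    proof (cases "F0 \<le> F")
      case True
      then show ?thesis using g_lower_bound[OF t _ F0(2)[OF True]] F0(1) by (simp add: V_def)
    next
      case False
      then show ?thesis using g_nonneg[of t] t by (simp add: V_def)
    qed
  qed (use assms in auto)
  then show ?thesis by blast
qed

text \<open>The sample space is transported to the set of obstacle configurations that actually occur,
  so that a solution exists for every configuration of the new space.\<close>

lemma (in random_obstacles) canonical_space:
  assumes "complete_measure M"
  obtains M' :: "(int \<times> int \<Rightarrow> real) measure" and u' where "complete_measure M'"
    "random_obstacles M' lam \<beta> \<delta> F (\<lambda>i j z. z (i, j)) \<phi> u'"
    "\<And>t. 0 < t \<Longrightarrow> random_obstacles.g M' F (\<lambda>i j z. z (i, j)) \<phi> t = g t"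
proof -
  let ?P = "Pi\<^sub>M UNIV (\<lambda>_. borel) :: (int \<times> int \<Rightarrow> real) measure"
  \<comment> \<open>The set of configurations that occur need not be measurable in the product
    space; with the trace sigma-algebra it becomes a space of its own that carries the law of
    \<open>Z\<close>.\<close>
  define R where "R = restrict_space ?P (Z ` space M)"
  define N where "N = distr M R Z"
  define M' where "M' = completion N"
  have ZR: "Z \<in> M \<rightarrow>\<^sub>M R" unfolding R_def by (rule measurable_restrict_space2) auto
  have spR: "space R = Z ` space M" by (auto simp: R_def space_restrict_space space_PiM)
  have spM': "space M' = Z ` space M" by (simp add: M'_def N_def spR)
  interpret N: prob_space N unfolding N_def by (rule prob_space_distr[OF ZR])
  interpret M': prob_space M' unfolding M'_def by (rule N.prob_space_completion)
  have idN: "id \<in> N \<rightarrow>\<^sub>M ?P"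
    unfolding N_def R_def id_def by (auto intro: measurable_restrict_space1)
  have coN [measurable]: "(\<lambda>z. z p) \<in> N \<rightarrow>\<^sub>M borel" for p
    using measurable_compose[OF idN measurable_component_singleton[of p UNIV "\<lambda>_. borel"]] by simp
  then have coM' [measurable]: "(\<lambda>z. z p) \<in> M' \<rightarrow>\<^sub>M borel" for p
    unfolding M'_def by (rule measurable_completion)
  have law: "distr M' L f = distr M L (\<lambda>\<omega>. f (Z \<omega>))" if "f \<in> N \<rightarrow>\<^sub>M L" for f and L :: "'c measure"
    using that ZR unfolding M'_def
    by (subst distr_completion) (auto simp: N_def distr_distr o_def)
  \<comment> \<open>Any sample with configuration \<open>z\<close> serves, since the equation
    depends on the sample only through \<open>z\<close>.\<close>
  define u' where "u' = (\<lambda>x t z. u x t (SOME \<omega>. \<omega> \<in> space M \<and> Z \<omega> = z))"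
  have ro: "random_obstacles M' lam \<beta> \<delta> F (\<lambda>i j z. z (i, j)) \<phi> u'"
  proof
    show "obstacle_strengths M' lam \<beta> (\<lambda>i j z. z (i, j))"
      unfolding obstacle_strengths_def
    proof (intro conjI allI ballI)
      have "distr M' ?P (\<lambda>z. \<lambda>p\<in>UNIV. z p) = distr M ?P Z"
        using law[OF idN] by (simp add: id_def restrict_def)
      also have "\<dots> = Pi\<^sub>M UNIV (\<lambda>p. distr M borel (\<lambda>\<omega>. Z \<omega> p))"
        using indep_Z by (subst (asm) indep_vars_iff_distr_eq_PiM') (auto simp: restrict_def)
      also have "\<dots> = Pi\<^sub>M UNIV (\<lambda>p. distr M' borel (\<lambda>z. z p))"
        using law[OF coN] by simp
      finally have "M'.indep_vars (\<lambda>_. borel) (\<lambda>p z. z p) UNIV"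
        by (subst M'.indep_vars_iff_distr_eq_PiM') auto
      then show "M'.indep_vars (\<lambda>_. borel) (\<lambda>(i, j) z. z (i, j)) UNIV"
        by (simp add: case_prod_unfold)
      show "distr M' borel (\<lambda>z. z (i, j)) = distr M' borel (\<lambda>z. z (0, 0))" for i j
        using strengths law[OF coN, of "(i, j)"] law[OF coN, of "(0, 0)"]
        by (simp add: Z_def obstacle_strengths_def)
      show "0 \<le> z (i, j)" if "z \<in> space M'" for i j z
        using that strengths by (auto simp: spM' Z_def obstacle_strengths_def)
      have "has_bochner_integral M (\<lambda>\<omega>. exp (lam * Z \<omega> (0, 0))) \<beta>"
        using strengths by (simp add: Z_def obstacle_strengths_def)
      then have "has_bochner_integral N (\<lambda>z. exp (lam * z (0, 0))) \<beta>"
        unfolding has_bochner_integral_iff N_def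
        using ZR coN[unfolded N_def] by (subst integrable_distr_eq, simp, simp) (subst integral_distr, auto)
      then show "has_bochner_integral M' (\<lambda>z. exp (lam * z (0, 0))) \<beta>"
        unfolding has_bochner_integral_iff M'_def by (auto simp: integrable_completion integral_completion)
    qed
    fix z assume "z \<in> space M'"
    then have "\<exists>\<omega>. \<omega> \<in> space M \<and> Z \<omega> = z" by (auto simp: spM')
    from someI_ex[OF this]
    have \<omega>: "(SOME \<omega>. \<omega> \<in> space M \<and> Z \<omega> = z) \<in> space M" "Z (SOME \<omega>. \<omega> \<in> space M \<and> Z \<omega> = z) = z" by auto
    have "(\<lambda>x y. obstacle_field (\<lambda>i j z. z (i, j)) \<phi> x y z) = site_field \<phi> z"
      by (intro ext) (simp add: obstacle_field_eq_site_field[OF bump delta])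
    then show "classical_solution (\<lambda>x y. obstacle_field (\<lambda>i j z. z (i, j)) \<phi> x y z) F (\<lambda>x t. u' x t z)"
      using solution_Z[OF \<omega>(1)] \<omega>(2) by (simp add: u'_def)
  qed (fact lam beta delta F_pos bump)+
  interpret R: random_obstacles M' lam \<beta> \<delta> F "\<lambda>i j z. z (i, j)" \<phi> u' by (fact ro)
  have "random_obstacles.g M' F (\<lambda>i j z. z (i, j)) \<phi> t = g t" if "0 < t" for t
  proof -
    have Z': "R.Z z = z" for z by (simp add: R.Z_def)
    have m: "G t \<in> borel_measurable ?P" using G(1) that by simp
    have "R.g t = (\<integral>z. G t z \<partial>distr M' ?P id)"
      unfolding R.g_def Z' using m coM' by (subst integral_distr) (auto simp: M'_def intro!: measurable_completion idN)
    also have "distr M' ?P id = distr M ?P Z" using law[OF idN] by simp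
    also have "(\<integral>z. G t z \<partial>distr M ?P Z) = g t" unfolding g_def using m by (subst integral_distr) auto
    finally show ?thesis .
  qed
  moreover have "complete_measure M'" unfolding M'_def by (rule completion.complete_measure_axioms)
  ultimately show thesis using ro by (intro that)
qed

theorem theorem1p1:
  fixes lam \<beta> \<delta> :: real
  assumes "lam > 0" and "\<beta> \<ge> 1" and "0 < \<delta>" and "\<delta> < 1/2"
  shows "velocity_bound TYPE('w) lam \<beta> \<delta> (velocity_fun lam \<beta> \<delta>)"
proof -
  define V where "V = velocity_fun lam \<beta> \<delta>"
  \<comment> \<open>The choice operator yields only this property of \<open>V\<close>, on the
    canonical type. The bound over \<open>'w\<close> follows by transporting each sample space to
    that type, where \<open>g\<close> takes the same value.\<close>
  have V: "velocity_bound TYPE(int \<times> int \<Rightarrow> real) lam \<beta> \<delta> V"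
    unfolding V_def velocity_fun_def
    by (rule someI_ex[OF velocity_bound_exists]) (use assms in auto)
  then obtain F1 where V': "V \<in> {0..} \<rightarrow> {0..}" "mono_on {0..} V" "0 \<le> F1" "V F1 \<noteq> 0"
    unfolding velocity_bound_def by blast
  show ?thesis unfolding V_def[symmetric]
  proof (rule velocity_boundI[OF V'])
    fix M :: "'w measure" and X \<phi> F u and t :: real
    assume c: "complete_measure M" and "random_obstacles M lam \<beta> \<delta> F X \<phi> u" and t: "0 < t"
    then interpret random_obstacles M lam \<beta> \<delta> F X \<phi> u by simp
    obtain M' :: "(int \<times> int \<Rightarrow> real) measure" and u' where M': "complete_measure M'"
      and ro: "random_obstacles M' lam \<beta> \<delta> F (\<lambda>i j z. z (i, j)) \<phi> u'"
      and g: "\<And>t. 0 < t \<Longrightarrow> random_obstacles.g M' F (\<lambda>i j z. z (i, j)) \<phi> t = g t"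
      using canonical_space[OF c] by blast
    interpret R: random_obstacles M' lam \<beta> \<delta> F "\<lambda>i j z. z (i, j)" \<phi> u' by (fact ro)
    have "V F \<le> R.expectation (\<lambda>\<omega>. mean_height u' t \<omega> / t)"
      using V M' R.prob_space_axioms R.strengths R.bump R.F_pos R.solution t unfolding velocity_bound_def by blast
    also have "\<dots> = g t / t" using R.mean_height(2)[OF M' t] g[OF t] by simp
    finally show "V F * t \<le> random_obstacles.g M F X \<phi> t" using t by (simp add: field_simps)
  qed (use assms in auto)
qed

end
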